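(* With the notation of the context, one has $$C_{\mathbf v_0,\mathcal N_{\mathbf v_0}}=\Bigl(\bigl(\operatorname{ind}_{\mathbf w}(H_A(\boldsymbol\beta))_{|\mathbf v_0\to\mathbf 0}\bigr)_{\boldsymbol\theta\to\partial_{\mathbf y}}\Bigr)^{\perp,\mathbb C[\mathbf y]},$$ and $$\bigl(\operatorname{ind}_{\mathbf w}(H_A(\boldsymbol\beta))_{|\mathbf v_0\to\mathbf 0}\bigr)_{\boldsymbol\theta\to\partial_{\mathbf y}}=\operatorname{Ann}^{\bullet}_{\mathbb C[\partial_{\mathbf y}]}(C_{\mathbf v_0,\mathcal N_{\mathbf v_0}})=\mathfrak Q_{\mathcal N_{\mathbf v_0}}:\mathfrak m_{\mathcal N_{\mathbf v_0}}.$$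
   Context: $\mathbb N$ is the set of nonnegative integers. Let $A=(\mathbf a_1,\dots,\mathbf a_n)=(a_{ij})$ be a $d\times n$ integer matrix of rank $d$ whose columns all lie in a single affine hyperplane of $\mathbb Q^d$ not passing through the origin. Put $L=\operatorname{Ker}_{\mathbb Z}(A)\subset\mathbb Z^n$. The toric ideal is $I_A=\langle\partial_{\mathbf x}^{\mathbf u}-\partial_{\mathbf x}^{\mathbf v}\mid A\mathbf u=A\mathbf v,\ \mathbf u,\mathbf v\in\mathbb N^n\rangle\subset\mathbb C[\partial_1,\dots,\partial_n]$. For $\boldsymbol\beta\in\mathbb C^d$, $H_A(\boldsymbol\beta)$ is the left ideal of the Weyl algebra $D=\mathbb C\langle x_1,\dots,x_n,\partial_1,\dots,\partial_n\rangle$ generated by $I_A$ and the Euler operators $\sum_j a_{ij}\theta_j-\beta_i$ ($1\le i\le d$), $\theta_j=x_j\partial_j$. Fix a generic weight $\mathbf w\in\mathbb R^n$: $\mathbf w\cdot\mathbf u\ne0$ for every nonzero $\mathbf u\in L$ (in particular $\operatorname{in}_{\mathbf w}(I_A)$, the ideal generated by the parts of maximal $\mathbf w$-weight of elements of $I_A$, is a monomial ideal). A fake exponent of $H_A(\boldsymbol\beta)$ with respect to $\mathbf w$ is a zero in $\mathbb C^n$ of the ideal $(D\operatorname{in}_{\mathbf w}(I_A)\cap\mathbb C[\boldsymbol\theta])+\langle A\boldsymbol\theta-\boldsymbol\beta\rangle\subset\mathbb C[\boldsymbol\theta]$, $\boldsymbol\theta=(\theta_1,\dots,\theta_n)$.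 Fix a fake exponent $\mathbf v_0$. For $\mathbf v\in\mathbb C^n$ let $\operatorname{nsupp}(\mathbf v)=\{j\mid v_j\in\mathbb Z_{<0}\}$. For $\mathbf u\in L$ put $I_{\mathbf u}=\operatorname{nsupp}(\mathbf v_0+\mathbf u)$; put $\mathrm{NS}=\{I_{\mathbf u}\mid\mathbf u\in L\}$ and $\mathcal N_{\mathbf v_0}=\{I\in\mathrm{NS}\mid \mathbf w\cdot\mathbf u\ge0\text{ for every }\mathbf u\in L\text{ with }I_{\mathbf u}=I\}$ (one has $I_{\mathbf 0}\in\mathcal N_{\mathbf v_0}$). Write $N=\mathcal N_{\mathbf v_0}$, $N^c=\mathrm{NS}\setminus N$ and $K_N=\bigcap_{I\in N}I$. Let $\mathbf y=(y_1,\dots,y_n)$ be variables (representing $\log\mathbf x$). $C_{\mathbf v_0,N}$ is the space of all polynomials $r_{\mathbf 0}(\mathbf y)$ occurring as the coefficient of $\mathbf x^{\mathbf v_0}$ in a formal logarithmic series $\sum_{\mathbf u\in L,\,I_{\mathbf u}\in N}\mathbf x^{\mathbf v_0+\mathbf u}r_{\mathbf u}(\log\mathbf x)$, $r_{\mathbf u}\in\mathbb C[\mathbf y]$, annihilated by $H_A(\boldsymbol\beta)$ (termwise formal action). For $S\subset\{1,\dots,n\}$ put $\partial_{\mathbf y}^S=\prod_{j\in S}\partial_{y_j}$ (empty product $=1$). In $\mathbb C[\partial_{\mathbf y}]$ define $\mathfrak m_N=\partial_{\mathbf y}^{I_{\mathbf 0}\setminus K_N}$, $\mathfrak M_N=\langle\partial_{\mathbf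 y}^{I\setminus K_N}\mid I\in N\rangle$, $\mathfrak P_N=\langle\partial_{\mathbf y}^{(I\cup J)\setminus K_N}\mid I\in N,\ J\in N^c\rangle$, $\langle A\partial_{\mathbf y}\rangle=\langle\sum_j a_{ij}\partial_{y_j}\mid 1\le i\le d\rangle$, and $\mathfrak Q_N=\langle A\partial_{\mathbf y}\rangle\mathfrak M_N+\mathfrak P_N$. Indicial ideal: let $\operatorname{in}_{(-\mathbf w,\mathbf w)}(H_A(\boldsymbol\beta))\subset D$ be the initial ideal with respect to the weight giving $x_j$ weight $-w_j$ and $\partial_j$ weight $w_j$ (generated by parts of maximal weight), and let $R=\mathbb C(\mathbf x)\langle\partial_1,\dots,\partial_n\rangle$. Then $\operatorname{ind}_{\mathbf w}(H_A(\boldsymbol\beta))=R\cdot\operatorname{in}_{(-\mathbf w,\mathbf w)}(H_A(\boldsymbol\beta))\cap\mathbb C[\boldsymbol\theta]$. With $\mathfrak m_{\mathbf v_0}=\langle\theta_1-(\mathbf v_0)_1,\dots,\theta_n-(\mathbf v_0)_n\rangle\subset\mathbb C[\boldsymbol\theta]$, put $\operatorname{ind}_{\mathbf w}(H_A(\boldsymbol\beta))_{|\mathbf v_0}=\bigl(\operatorname{ind}_{\mathbf w}(H_A(\boldsymbol\beta))\,\mathbb C[\boldsymbol\theta]_{\mathfrak m_{\mathbf v_0}}\bigr)\cap\mathbb C[\boldsymbol\theta]$ (the component supported at $\mathbf v_0$), and let $\operatorname{ind}_{\mathbf w}(H_A(\boldsymbol\beta))_{|\mathbf v_0\to\mathbf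 0}$ be its image under the automorphism $f(\boldsymbol\theta)\mapsto f(\boldsymbol\theta+\mathbf v_0)$ of $\mathbb C[\boldsymbol\theta]$. For an ideal $J\subset\mathbb C[\boldsymbol\theta]$, $J_{\boldsymbol\theta\to\partial_{\mathbf y}}\subset\mathbb C[\partial_{\mathbf y}]$ is obtained by substituting $\theta_j\mapsto\partial_{y_j}$ for all $j$. $\bullet$ denotes the usual action of constant-coefficient differential operators on polynomials. For $W\subset\mathbb C[\mathbf y]$, $\operatorname{Ann}^\bullet_{\mathbb C[\partial_{\mathbf y}]}(W)=\{f\mid f\bullet w=0\ \forall w\in W\}$. For an ideal $J\subset\mathbb C[\partial_{\mathbf y}]$, $J^{\perp,\mathbb C[\mathbf y]}=\{p\in\mathbb C[\mathbf y]\mid (f\bullet p)|_{\mathbf y=\mathbf 0}=0\ \forall f\in J\}$. $J:m=\{f\mid fm\in J\}$. *)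

theory Defs
  imports
    "HOL-Analysis.Analysis"
    "HOL-Library.Poly_Mapping"
    "HOL-Computational_Algebra.Fraction_Field"
begin

section \<open>Polynomials in variables indexed by a finite type\<close>

text \<open>The index set \<open>{1, ..., n}\<close> is a type of class \<open>{finite, linorder}\<close>. The order makes
  polynomials an integral domain in the library and fixes an order of factors in non-commutative
  products. The rings \<open>\<complex>[x]\<close>, \<open>\<complex>[\<partial>]\<close>, \<open>\<complex>[\<theta>]\<close>, \<open>\<complex>[y]\<close> and \<open>\<complex>[\<partial>\<^sub>y]\<close> are all
  represented by the type \<open>mpoly\<close>, so that the substitution of the \<open>j\<close>-th variable of
  \<open>\<complex>[\<partial>\<^sub>y]\<close> for \<open>\<theta>\<^sub>j\<close> is the identity.\<close>

type_synonym 'n expo = "'n \<Rightarrow>\<^sub>0 nat"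
type_synonym 'n mpoly = "'n expo \<Rightarrow>\<^sub>0 complex"

definition cst :: "complex \<Rightarrow> 'n mpoly" where
  "cst c = Poly_Mapping.single 0 c"

definition monom :: "'n expo \<Rightarrow> 'n mpoly" where
  "monom a = Poly_Mapping.single a 1"

definition var :: "'n \<Rightarrow> 'n mpoly" where
  "var j = monom (Poly_Mapping.single j 1)"

definition power_prod :: "('n::{finite,linorder} \<Rightarrow> 'a::monoid_mult) \<Rightarrow> 'n expo \<Rightarrow> 'a" where
  "power_prod f a = prod_list (map (\<lambda>j. f j ^ Poly_Mapping.lookup a j) (sorted_list_of_set UNIV))"

definition power_comp :: "('n::{finite,linorder} \<Rightarrow> 'b \<Rightarrow> 'b) \<Rightarrow> 'n expo \<Rightarrow> 'b \<Rightarrow> 'b" where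
  "power_comp T a = fold (\<lambda>j. T j ^^ Poly_Mapping.lookup a j) (sorted_list_of_set UNIV)"

definition poly_subst ::
  "(complex \<Rightarrow> 'a::semiring_1) \<Rightarrow> ('n::{finite,linorder} \<Rightarrow> 'a) \<Rightarrow> 'n mpoly \<Rightarrow> 'a" where
  "poly_subst h f p = (\<Sum>a\<in>Poly_Mapping.keys p. h (Poly_Mapping.lookup p a) * power_prod f a)"

definition poly_eval :: "'n::{finite,linorder} mpoly \<Rightarrow> complex^'n::{finite,linorder} \<Rightarrow> complex" where
  "poly_eval p v = poly_subst (\<lambda>c. c) (\<lambda>j. v $ j) p"

definition pd :: "'n \<Rightarrow> 'n mpoly \<Rightarrow> 'n mpoly" where
  "pd j p = (\<Sum>a\<in>Poly_Mapping.keys p.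
     Poly_Mapping.single (a - Poly_Mapping.single j 1)
       (of_nat (Poly_Mapping.lookup a j) * Poly_Mapping.lookup p a))"

definition diff_act :: "'n::{finite,linorder} mpoly \<Rightarrow> 'n mpoly \<Rightarrow> 'n mpoly"  (infixr "\<bullet>\<^sub>\<partial>" 70) where
  "f \<bullet>\<^sub>\<partial> p = (\<Sum>a\<in>Poly_Mapping.keys f. cst (Poly_Mapping.lookup f a) * power_comp pd a p)"

definition Ann :: "'n::{finite,linorder} mpoly set \<Rightarrow> 'n mpoly set" where
  "Ann W = {f. \<forall>p\<in>W. f \<bullet>\<^sub>\<partial> p = 0}"

definition perp :: "'n::{finite,linorder} mpoly set \<Rightarrow> 'n mpoly set" where
  "perp J = {p. \<forall>f\<in>J. poly_eval (f \<bullet>\<^sub>\<partial> p) 0 = 0}"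

text \<open>The sum of the terms of maximal weight.\<close>

definition init_part :: "('k \<Rightarrow> real) \<Rightarrow> ('k \<Rightarrow>\<^sub>0 'b) \<Rightarrow> ('k \<Rightarrow>\<^sub>0 'b::comm_monoid_add)" where
  "init_part wt c =
     (\<Sum>k\<in>{k \<in> Poly_Mapping.keys c. \<forall>l\<in>Poly_Mapping.keys c. wt l \<le> wt k}.
        Poly_Mapping.single k (Poly_Mapping.lookup c k))"

definition ideal :: "'a::comm_ring_1 set \<Rightarrow> 'a set" where
  "ideal G = module.span (*) G"

definition ideal_sum :: "'a::comm_ring_1 set \<Rightarrow> 'a set \<Rightarrow> 'a set" where
  "ideal_sum I J = {f + g |f g. f \<in> I \<and> g \<in> J}"

definition ideal_prod :: "'a::comm_ring_1 set \<Rightarrow> 'a set \<Rightarrow> 'a set" where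
  "ideal_prod I J = ideal {f * g |f g. f \<in> I \<and> g \<in> J}"

definition ideal_quot :: "'a::comm_ring_1 set \<Rightarrow> 'a \<Rightarrow> 'a set" where
  "ideal_quot J m = {f. f * m \<in> J}"

text \<open>The left \<open>S\<close>-submodule generated by \<open>G\<close>, for a subring \<open>S\<close> of the ambient ring. It is a left
  ideal of \<open>S\<close> if \<open>G \<subseteq> S\<close>; for \<open>S \<subseteq> \<complex>(\<theta>)\<close> a localisation of \<open>\<complex>[\<theta>]\<close> it is the extension of an
  ideal of \<open>\<complex>[\<theta>]\<close>.\<close>

definition left_ideal :: "'a::ring_1 set \<Rightarrow> 'a set \<Rightarrow> 'a set" where
  "left_ideal S G = {(\<Sum>g\<in>t. a g * g) |t a. finite t \<and> t \<subseteq> G \<and> (\<forall>g\<in>t. a g \<in> S)}"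


section \<open>Derivations of the field of rational functions\<close>

lemma sum_single_keys:
  "(\<Sum>a\<in>Poly_Mapping.keys p. Poly_Mapping.single a (Poly_Mapping.lookup p a)) = p"
proof (rule poly_mapping_eqI)
  fix k
  have "Poly_Mapping.lookup (\<Sum>a\<in>Poly_Mapping.keys p. Poly_Mapping.single a (Poly_Mapping.lookup p a)) k
      = (\<Sum>a\<in>Poly_Mapping.keys p. if a = k then Poly_Mapping.lookup p a else 0)"
    by (auto simp: lookup_sum lookup_single when_def intro!: sum.cong)
  also have "\<dots> = Poly_Mapping.lookup p k"
    by (simp add: in_keys_iff)
  finally show "Poly_Mapping.lookup (\<Sum>a\<in>Poly_Mapping.keys p.
      Poly_Mapping.single a (Poly_Mapping.lookup p a)) k = Poly_Mapping.lookup p k" .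
qed

lemma mpoly_induct [case_names single add]:
  assumes "\<And>a c. P (Poly_Mapping.single a c)" "\<And>p q. P p \<Longrightarrow> P q \<Longrightarrow> P (p + q)"
  shows "P (p :: 'k \<Rightarrow>\<^sub>0 'b::comm_monoid_add)"
proof -
  have "P 0" using assms(1)[of undefined 0] by simp
  have "P (\<Sum>a\<in>A. Poly_Mapping.single a (Poly_Mapping.lookup p a))" if "finite A" for A
    using that by (induction A) (simp_all add: \<open>P 0\<close> assms)
  from this[of "Poly_Mapping.keys p"] show ?thesis by (simp add: sum_single_keys)
qed

lemma pd_superset:
  assumes "finite S" "Poly_Mapping.keys p \<subseteq> S"
  shows "pd j p = (\<Sum>a\<in>S. Poly_Mapping.single (a - Poly_Mapping.single j 1)
     (of_nat (Poly_Mapping.lookup a j) * Poly_Mapping.lookup p a))"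
  unfolding pd_def using assms
  by (intro sum.mono_neutral_left) (auto simp: in_keys_iff)

lemma pd_add: "pd j (p + q) = pd j p + pd j q"
proof -
  let ?S = "Poly_Mapping.keys p \<union> Poly_Mapping.keys q"
  have "Poly_Mapping.keys (p + q) \<subseteq> ?S" by (rule keys_add)
  then show ?thesis
    by (simp add: pd_superset[of ?S] lookup_add distrib_left single_add sum.distrib)
qed

lemma pd_single:
  "pd j (Poly_Mapping.single a c) =
     Poly_Mapping.single (a - Poly_Mapping.single j 1) (of_nat (Poly_Mapping.lookup a j) * c)"
  by (cases "c = 0") (simp_all add: pd_def)

lemma expo_minus_add:
  fixes a b :: "'n expo"
  assumes "Poly_Mapping.lookup a j \<noteq> 0"
  shows "(a - Poly_Mapping.single j 1) + b = (a + b) - Poly_Mapping.single j 1"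
  by (rule poly_mapping_eqI)
    (use assms in \<open>auto simp: lookup_add lookup_minus lookup_single when_def\<close>)

lemma pd_mult: "pd j (p * q) = pd j p * q + p * pd j q"
proof (induction p rule: mpoly_induct)
  case (add p1 p2)
  then show ?case by (simp add: pd_add algebra_simps)
next
  case (single a c)
  show ?case
  proof (induction q rule: mpoly_induct)
    case (add q1 q2)
    then show ?case by (simp add: pd_add algebra_simps)
  next
    case (single b d)
    let ?e = "Poly_Mapping.single j 1"
    have 1: "Poly_Mapping.single ((a - ?e) + b) (of_nat (Poly_Mapping.lookup a j) * c * d)
        = Poly_Mapping.single ((a + b) - ?e) (of_nat (Poly_Mapping.lookup a j) * c * d)"
      using expo_minus_add[of a j b] by (cases "Poly_Mapping.lookup a j = 0") simp_all
    have 2: "Poly_Mapping.single (a + (b - ?e)) (c * (of_nat (Poly_Mapping.lookup b j) * d))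
        = Poly_Mapping.single ((a + b) - ?e) (c * (of_nat (Poly_Mapping.lookup b j) * d))"
      using expo_minus_add[of b j a]
      by (cases "Poly_Mapping.lookup b j = 0") (simp_all add: add.commute)
    show ?case
      unfolding pd_single mult_single 1 2
      by (simp add: lookup_add algebra_simps flip: single_add)
  qed
qed

type_synonym 'n ratfun = "'n mpoly fract"

text \<open>The quotient rule.\<close>

lift_definition rder :: "'n::{finite,linorder} \<Rightarrow> 'n ratfun \<Rightarrow> 'n ratfun" is
  "\<lambda>j (p, q). (pd j p * q - p * pd j q, q * q)"
proof (clarsimp split: prod.splits)
  fix j :: 'n and p q p' q' :: "'n mpoly"
  assume eq: "p * q' = p' * q"
  have d: "pd j p * q' + p * pd j q' = pd j p' * q + p' * pd j q"
    using arg_cong[OF eq, of "pd j"] by (simp add: pd_mult)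
  have "(pd j p * q - p * pd j q) * (q' * q') - (pd j p' * q' - p' * pd j q') * (q * q)
      = q * q' * ((pd j p * q' + p * pd j q') - (pd j p' * q + p' * pd j q))
        - (p * q' - p' * q) * (q * pd j q' + pd j q * q')"
    by (simp add: algebra_simps)
  also have "\<dots> = 0" using eq d by simp
  finally show "(pd j p * q - p * pd j q) * (q' * q') = (pd j p' * q' - p' * pd j q') * (q * q)"
    by simp
qed

lemma Fract_abs: "q \<noteq> 0 \<Longrightarrow> Fract p q = abs_fract (p, q)"
  by (simp add: Fract_def)

lemma rder_Fract:
  assumes "q \<noteq> 0"
  shows "rder j (Fract p q) = Fract (pd j p * q - p * pd j q) (q * q)"
proof -
  have 2: "q * q \<noteq> 0" using assms by simp
  have "fractrel (p, q) (p, q)" using assms by simp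
  from rder.abs_eq[OF this, of j] show ?thesis
    unfolding Fract_abs[OF assms] Fract_abs[OF 2] by simp
qed

lemma rder_add: "rder j (f + g) = rder j f + rder j g"
proof -
  obtain p q where f: "f = Fract p q" "q \<noteq> 0" by (cases f)
  obtain r s where g: "g = Fract r s" "s \<noteq> 0" by (cases g)
  have num: "pd j (p * s + r * q) * (q * s) - (p * s + r * q) * pd j (q * s)
      = (pd j p * q - p * pd j q) * (s * s) + (pd j r * s - r * pd j s) * (q * q)"
    unfolding pd_add pd_mult by algebra
  have den: "(q * s) * (q * s) = (q * q) * (s * s)"
    by algebra
  have nz: "q * s \<noteq> 0" "q * q \<noteq> 0" "s * s \<noteq> 0"
    using f(2) g(2) by auto
  have "rder j (f + g) = rder j (Fract (p * s + r * q) (q * s))"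
    unfolding f(1) g(1) add_fract[OF f(2) g(2)] ..
  also have "\<dots> = Fract ((pd j p * q - p * pd j q) * (s * s) + (pd j r * s - r * pd j s) * (q * q))
      ((q * q) * (s * s))"
    unfolding rder_Fract[OF nz(1)] num den ..
  also have "\<dots> = rder j f + rder j g"
    unfolding f(1) g(1) rder_Fract[OF f(2)] rder_Fract[OF g(2)] add_fract[OF nz(2,3)] ..
  finally show ?thesis .
qed


section \<open>Differential operators\<close>

text \<open>The ring \<open>R = \<complex>(x)\<langle>\<partial>\<^sub>1, ..., \<partial>\<^sub>n\<rangle>\<close>, realised by its faithful action on
  \<open>\<complex>(x)\<close>: the ring of operators generated by the multiplications by rational functions and the
  partial derivations, with composition as product.\<close>

inductive_set diff_ops :: "('n::{finite,linorder} ratfun \<Rightarrow> 'n ratfun) set" where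
  mult_op: "(\<lambda>g. f * g) \<in> diff_ops"
| der_op: "rder j \<in> diff_ops"
| add_op: "S \<in> diff_ops \<Longrightarrow> T \<in> diff_ops \<Longrightarrow> (\<lambda>g. S g + T g) \<in> diff_ops"
| comp_op: "S \<in> diff_ops \<Longrightarrow> T \<in> diff_ops \<Longrightarrow> (\<lambda>g. S (T g)) \<in> diff_ops"

lemma diff_ops_additive: "T \<in> diff_ops \<Longrightarrow> T (f + g) = T f + T g"
  by (induction arbitrary: f g rule: diff_ops.induct) (simp_all add: algebra_simps rder_add)

typedef (overloaded) 'n dop = "diff_ops :: ('n::{finite,linorder} ratfun \<Rightarrow> 'n ratfun) set"
  by (blast intro: mult_op)

setup_lifting type_definition_dop

instantiation dop :: ("{finite,linorder}") ring_1
begin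

lift_definition zero_dop :: "'a dop" is "\<lambda>g. 0"
  by (rule back_subst[of "\<lambda>T. T \<in> diff_ops", OF mult_op[of 0]]) (simp add: fun_eq_iff)
lift_definition one_dop :: "'a dop" is "\<lambda>g. g"
  by (rule back_subst[of "\<lambda>T. T \<in> diff_ops", OF mult_op[of 1]]) (simp add: fun_eq_iff)
lift_definition plus_dop :: "'a dop \<Rightarrow> 'a dop \<Rightarrow> 'a dop" is "\<lambda>S T g. S g + T g"
  by (rule add_op)
lift_definition uminus_dop :: "'a dop \<Rightarrow> 'a dop" is "\<lambda>S g. - S g"
  using comp_op[OF mult_op[of "-1"]] by simp
lift_definition minus_dop :: "'a dop \<Rightarrow> 'a dop \<Rightarrow> 'a dop" is "\<lambda>S T g. S g - T g"
  using add_op[OF _ comp_op[OF mult_op[of "-1"]]] by simp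
lift_definition times_dop :: "'a dop \<Rightarrow> 'a dop \<Rightarrow> 'a dop" is "\<lambda>S T g. S (T g)"
  by (rule comp_op)

instance
proof
  fix q r s :: "'a dop"
  show "(q * r) * s = q * (r * s)" by transfer (rule refl)
  show "1 * q = q" by transfer (rule refl)
  show "q * 1 = q" by transfer (rule refl)
  show "(q + r) + s = q + (r + s)" by transfer (simp only: add.assoc)
  show "q + r = r + q" by transfer (simp only: add.commute)
  show "0 + q = q" by transfer simp
  show "- q + q = 0" by transfer simp
  show "q - r = q + - r" by transfer simp
  show "(q + r) * s = q * s + r * s" by transfer (rule refl)
  show "q * (r + s) = q * r + q * s" by transfer (simp only: diff_ops_additive)
  show "(0::'a dop) \<noteq> 1" by transfer (metis zero_neq_one)
qed

end

definition rat_op :: "'n::{finite,linorder} ratfun \<Rightarrow> 'n dop" where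
  "rat_op f = Abs_dop (\<lambda>g. f * g)"

definition d_op :: "'n::{finite,linorder} \<Rightarrow> 'n dop" where
  "d_op j = Abs_dop (rder j)"

definition c_op :: "complex \<Rightarrow> 'n::{finite,linorder} dop" where
  "c_op c = rat_op (Fract (cst c) 1)"

definition x_op :: "'n::{finite,linorder} \<Rightarrow> 'n dop" where
  "x_op j = rat_op (Fract (var j) 1)"

definition theta_op :: "'n::{finite,linorder} \<Rightarrow> 'n dop" where
  "theta_op j = x_op j * d_op j"

text \<open>Elements of the Weyl algebra are given by their coefficients with respect to the normally
  ordered monomials \<open>x^a \<partial>^b\<close>, indexed by the pairs \<open>(a, b)\<close>.\<close>

type_synonym 'n weyl_coeffs = "('n expo \<times> 'n expo) \<Rightarrow>\<^sub>0 complex"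

definition weyl_op :: "'n::{finite,linorder} weyl_coeffs \<Rightarrow> 'n dop" where
  "weyl_op c = (\<Sum>(a, b)\<in>Poly_Mapping.keys c.
     c_op (Poly_Mapping.lookup c (a, b)) * power_prod x_op a * power_prod d_op b)"

definition weyl :: "'n::{finite,linorder} dop set" where
  "weyl = range weyl_op"

definition partial_poly :: "'n::{finite,linorder} mpoly \<Rightarrow> 'n dop" where
  "partial_poly = poly_subst c_op d_op"

definition theta_poly :: "'n::{finite,linorder} mpoly \<Rightarrow> 'n dop" where
  "theta_poly = poly_subst c_op theta_op"


section \<open>Hypergeometric ideals\<close>

definition lattice :: "int^'n^'d \<Rightarrow> (int^'n) set" where
  "lattice A = {u. A *v u = 0}"

definition wdot :: "real^'n \<Rightarrow> int^'n \<Rightarrow> real" where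
  "wdot w u = (\<Sum>j\<in>UNIV. w $ j * of_int (u $ j))"

definition generic_weight :: "int^'n^'d \<Rightarrow> real^'n \<Rightarrow> bool" where
  "generic_weight A w \<longleftrightarrow> (\<forall>u\<in>lattice A. u \<noteq> 0 \<longrightarrow> wdot w u \<noteq> 0)"

definition columns_in_hyperplane :: "int^'n^'d \<Rightarrow> bool" where
  "columns_in_hyperplane A \<longleftrightarrow>
     (\<exists>(h :: rat^'d) r. h \<noteq> 0 \<and> r \<noteq> 0 \<and> (\<forall>j. (\<Sum>i\<in>UNIV. h $ i * of_int (A $ i $ j)) = r))"

definition expo_vec :: "'n expo \<Rightarrow> int^'n" where
  "expo_vec a = (\<chi> j. int (Poly_Mapping.lookup a j))"

definition toric_ideal :: "int^'n::{finite,linorder}^'d \<Rightarrow> 'n::{finite,linorder} mpoly set" where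
  "toric_ideal A = ideal {monom u - monom v |u v. A *v expo_vec u = A *v expo_vec v}"

definition linear_form :: "int^'n::{finite,linorder}^'d \<Rightarrow> 'd \<Rightarrow> 'n::{finite,linorder} mpoly" where
  "linear_form A i = (\<Sum>j\<in>UNIV. of_int (A $ i $ j) * var j)"

definition euler_op :: "int^'n::{finite,linorder}^'d \<Rightarrow> complex^'d \<Rightarrow> 'd \<Rightarrow> 'n::{finite,linorder} dop" where
  "euler_op A \<beta> i = (\<Sum>j\<in>UNIV. of_int (A $ i $ j) * theta_op j) - c_op (\<beta> $ i)"

definition H_ideal :: "int^'n::{finite,linorder}^'d \<Rightarrow> complex^'d \<Rightarrow> 'n::{finite,linorder} dop set" where
  "H_ideal A \<beta> = left_ideal weyl (partial_poly ` toric_ideal A \<union> range (euler_op A \<beta>))"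

definition init_toric :: "real^'n::{finite,linorder} \<Rightarrow> int^'n::{finite,linorder}^'d \<Rightarrow> 'n::{finite,linorder} mpoly set" where
  "init_toric w A = ideal (init_part (\<lambda>a. wdot w (expo_vec a)) ` toric_ideal A)"

definition fake_indicial_ideal ::
  "int^'n::{finite,linorder}^'d \<Rightarrow> complex^'d \<Rightarrow> real^'n::{finite,linorder} \<Rightarrow> 'n::{finite,linorder} mpoly set" where
  "fake_indicial_ideal A \<beta> w = ideal_sum
     {f. theta_poly f \<in> left_ideal weyl (partial_poly ` init_toric w A)}
     (ideal (range (\<lambda>i. linear_form A i - cst (\<beta> $ i))))"

definition fake_exponent ::
  "int^'n::{finite,linorder}^'d \<Rightarrow> complex^'d \<Rightarrow> real^'n::{finite,linorder} \<Rightarrow> complex^'n::{finite,linorder} \<Rightarrow> bool" where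
  "fake_exponent A \<beta> w v \<longleftrightarrow> (\<forall>f\<in>fake_indicial_ideal A \<beta> w. poly_eval f v = 0)"

definition init_H ::
  "int^'n::{finite,linorder}^'d \<Rightarrow> complex^'d \<Rightarrow> real^'n::{finite,linorder} \<Rightarrow> 'n::{finite,linorder} dop set" where
  "init_H A \<beta> w = left_ideal weyl
     {weyl_op (init_part (\<lambda>(a, b). wdot w (expo_vec b - expo_vec a)) c) |c. weyl_op c \<in> H_ideal A \<beta>}"

definition indicial_ideal ::
  "int^'n::{finite,linorder}^'d \<Rightarrow> complex^'d \<Rightarrow> real^'n::{finite,linorder} \<Rightarrow> 'n::{finite,linorder} mpoly set" where
  "indicial_ideal A \<beta> w = {f. theta_poly f \<in> left_ideal UNIV (init_H A \<beta> w)}"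

definition max_ideal :: "complex^'n::{finite,linorder} \<Rightarrow> 'n::{finite,linorder} mpoly set" where
  "max_ideal v = ideal (range (\<lambda>j. var j - cst (v $ j)))"

definition local_ring :: "complex^'n::{finite,linorder} \<Rightarrow> 'n::{finite,linorder} mpoly fract set" where
  "local_ring v = {Fract f g |f g. g \<notin> max_ideal v}"

definition local_component ::
  "'n::{finite,linorder} mpoly set \<Rightarrow> complex^'n::{finite,linorder} \<Rightarrow> 'n mpoly set" where
  "local_component J v = {f. Fract f 1 \<in> left_ideal (local_ring v) ((\<lambda>g. Fract g 1) ` J)}"

definition translate :: "complex^'n::{finite,linorder} \<Rightarrow> 'n::{finite,linorder} mpoly \<Rightarrow> 'n mpoly" where
  "translate v = poly_subst cst (\<lambda>j. var j + cst (v $ j))"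

definition indicial_at_zero ::
  "int^'n::{finite,linorder}^'d \<Rightarrow> complex^'d \<Rightarrow> real^'n::{finite,linorder} \<Rightarrow> complex^'n::{finite,linorder} \<Rightarrow> 'n::{finite,linorder} mpoly set" where
  "indicial_at_zero A \<beta> w v = translate v ` local_component (indicial_ideal A \<beta> w) v"


section \<open>Negative supports\<close>

definition nsupp :: "complex^'n \<Rightarrow> 'n set" where
  "nsupp v = {j. \<exists>k::int. k < 0 \<and> v $ j = of_int k}"

definition shift_vec :: "complex^'n \<Rightarrow> int^'n \<Rightarrow> complex^'n" where
  "shift_vec v u = v + (\<chi> j. of_int (u $ j))"

definition NS :: "int^'n^'d \<Rightarrow> complex^'n \<Rightarrow> 'n set set" where
  "NS A v = (\<lambda>u. nsupp (shift_vec v u)) ` lattice A"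

definition NN :: "int^'n^'d \<Rightarrow> real^'n \<Rightarrow> complex^'n \<Rightarrow> 'n set set" where
  "NN A w v = {I \<in> NS A v. \<forall>u\<in>lattice A. nsupp (shift_vec v u) = I \<longrightarrow> wdot w u \<ge> 0}"

definition KK :: "'n set set \<Rightarrow> 'n set" where
  "KK N = \<Inter>N"

definition sqfree :: "'n set \<Rightarrow> 'n::{finite,linorder} mpoly" where
  "sqfree S = (\<Prod>j\<in>S. var j)"

definition m_mon :: "complex^'n::{finite,linorder} \<Rightarrow> 'n set set \<Rightarrow> 'n::{finite,linorder} mpoly" where
  "m_mon v N = sqfree (nsupp v - KK N)"

definition M_ideal :: "'n set set \<Rightarrow> 'n::{finite,linorder} mpoly set" where
  "M_ideal N = ideal {sqfree (I - KK N) |I. I \<in> N}"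

definition P_ideal ::
  "int^'n::{finite,linorder}^'d \<Rightarrow> complex^'n::{finite,linorder} \<Rightarrow> 'n set set \<Rightarrow> 'n::{finite,linorder} mpoly set" where
  "P_ideal A v N = ideal {sqfree ((I \<union> J) - KK N) |I J. I \<in> N \<and> J \<in> NS A v - N}"

definition Q_ideal ::
  "int^'n::{finite,linorder}^'d \<Rightarrow> complex^'n::{finite,linorder} \<Rightarrow> 'n set set \<Rightarrow> 'n::{finite,linorder} mpoly set" where
  "Q_ideal A v N =
     ideal_sum (ideal_prod (ideal (range (linear_form A))) (M_ideal N)) (P_ideal A v N)"


section \<open>Logarithmic series\<close>

text \<open>A function \<open>F\<close> stands for the formal sum of all \<open>x^v (F v)(log x)\<close>. Since
  \<open>\<partial>\<^sub>j (x^u r(log x)) = x^(u - e\<^sub>j) (u\<^sub>j r + \<partial>r/\<partial>y\<^sub>j)(log x)\<close>, each coefficient of the result of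
  applying an operator depends on finitely many coefficients of \<open>F\<close>.\<close>

type_synonym 'n log_series = "(complex, 'n) vec \<Rightarrow> 'n mpoly"

definition x_act :: "'n::{finite,linorder} \<Rightarrow> 'n log_series \<Rightarrow> 'n log_series" where
  "x_act j F = (\<lambda>v. F (v - axis j 1))"

definition d_act :: "'n::{finite,linorder} \<Rightarrow> 'n log_series \<Rightarrow> 'n log_series" where
  "d_act j F = (\<lambda>v. let u = v + axis j 1 in cst (u $ j) * F u + pd j (F u))"

definition weyl_act :: "'n::{finite,linorder} weyl_coeffs \<Rightarrow> 'n log_series \<Rightarrow> 'n log_series" where
  "weyl_act c F = (\<lambda>v. \<Sum>(a, b)\<in>Poly_Mapping.keys c.
     cst (Poly_Mapping.lookup c (a, b)) * power_comp x_act a (power_comp d_act b F) v)"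

definition annihilated_by :: "'n::{finite,linorder} dop set \<Rightarrow> 'n log_series \<Rightarrow> bool" where
  "annihilated_by H F \<longleftrightarrow> (\<forall>c. weyl_op c \<in> H \<longrightarrow> (\<forall>v. weyl_act c F v = 0))"

definition supported_series ::
  "int^'n::{finite,linorder}^'d \<Rightarrow> complex^'n::{finite,linorder} \<Rightarrow> 'n set set \<Rightarrow> 'n::{finite,linorder} log_series set" where
  "supported_series A v N =
     {F. \<forall>z. F z \<noteq> 0 \<longrightarrow> (\<exists>u\<in>lattice A. nsupp (shift_vec v u) \<in> N \<and> z = shift_vec v u)}"

definition C_space ::
  "int^'n::{finite,linorder}^'d \<Rightarrow> complex^'d \<Rightarrow> complex^'n::{finite,linorder} \<Rightarrow> 'n set set \<Rightarrow> 'n::{finite,linorder} mpoly set" where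
  "C_space A \<beta> v N =
     {F v |F. F \<in> supported_series A v N \<and> annihilated_by (H_ideal A \<beta>) F}"

end

theory Submission
  imports Defs "HOL-Library.Function_Algebras"
begin

text \<open>The series with exponents \<open>v\<^sub>0 + u\<close> decouple as follows. The operator \<open>\<partial>\<^sup>a\<close> maps the
  coefficient at \<open>z + a\<close> to the one at \<open>z\<close> by a product of factors \<open>\<partial>\<^sub>y\<^sub>j + z\<^sub>j + k\<close>. Those
  with \<open>z\<^sub>j + k \<noteq> 0\<close> are invertible on \<open>\<complex>[y]\<close>; the others contribute \<open>\<partial>\<^sub>y\<^sub>j\<close> for the \<open>j\<close> that leave
  the negative support. After normalisation by the invertible factors, being a solution means
  that the coefficients \<open>G\<^sub>I\<close> depend on the negative support \<open>I\<close> only and satisfy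
  \<open>\<partial>\<^sup>J\<^sup>-\<^sup>I G\<^sub>I = \<partial>\<^sup>I\<^sup>-\<^sup>J G\<^sub>J\<close> and \<open>A\<partial>\<^sub>y G\<^sub>I = 0\<close>.

  Write \<open>C\<close> for the space of initial coefficients. Everything follows from the cycle
  \<open>ind \<subseteq> Ann C \<subseteq> Q : m \<subseteq> ind\<close> and from \<open>(Q : m)\<^sup>\<bottom> \<subseteq> C\<close>, without any use of holonomic ranks.
  For \<open>ind \<subseteq> Ann C\<close>, initial forms of operators annihilate the initial term \<open>x\<^sup>v r(log x)\<close> of a solution.
  A polynomial \<open>P\<close> with \<open>Q \<bullet> P = 0\<close> gives the solution \<open>G\<^sub>I = \<partial>\<^sup>I\<^sup>-\<^sup>K P\<close> with initial
  coefficient \<open>m \<bullet> P\<close>; since \<open>Q\<close> is graded, there are enough such \<open>P\<close> (truncate a linear functional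
  on \<open>\<complex>[\<partial>\<^sub>y]\<close> that vanishes on \<open>Q\<close>), which yields \<open>Ann C \<subseteq> Q : m\<close> and \<open>(Q : m)\<^sup>\<bottom> \<subseteq> C\<close>.
  Finally, \<open>Q : m \<subseteq> ind\<close> is the dual computation in the Weyl algebra: modulo \<open>H\<^sub>A(\<beta>)\<close> and operators
  of lower weight, the monomials \<open>s\<^sup>I\<^sup>-\<^sup>K\<close> with \<open>s = \<theta> - v\<^sub>0\<close> can be lifted consistently to
  operators \<open>E\<^sub>I\<close>, and the lift of \<open>Q\<close> vanishes.\<close>

section \<open>Polynomials\<close>

text \<open>Unit vectors stay in the form \<open>Poly_Mapping.single j 1\<close>, for which the
  rules below are stated; unfolding \<open>1\<close> would break the matching.\<close>

declare One_nat_def [simp del]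

lemma expo_induct [case_names zero step]:
  fixes a :: "'n::finite expo"
  assumes "P 0" and "\<And>j a. P a \<Longrightarrow> P (a + Poly_Mapping.single j 1)"
  shows "P a"
proof (induction "\<Sum>j\<in>UNIV. Poly_Mapping.lookup a j" arbitrary: a)
  case 0
  then have "a = 0" by (intro poly_mapping_eqI) simp
  then show ?case using assms(1) by simp
next
  case (Suc k)
  have "\<exists>j. Poly_Mapping.lookup a j \<noteq> 0"
    by (rule ccontr) (use Suc(2) in auto)
  then obtain j where j: "Poly_Mapping.lookup a j \<noteq> 0" by blast
  let ?e = "Poly_Mapping.single j 1"
  have a: "a = (a - ?e) + ?e"
    using j by (intro poly_mapping_eqI) (auto simp: lookup_add lookup_minus lookup_single when_def)
  have "(\<Sum>i\<in>UNIV. Poly_Mapping.lookup a i) = (\<Sum>i\<in>UNIV. Poly_Mapping.lookup (a - ?e) i)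
      + (\<Sum>i\<in>UNIV. if j = i then 1 else 0)"
    unfolding sum.distrib [symmetric]
    by (subst a, intro sum.cong) (simp_all add: lookup_add lookup_single when_def)
  then have "k = (\<Sum>i\<in>UNIV. Poly_Mapping.lookup (a - ?e) i)"
    using Suc(2) by simp
  from assms(2)[OF Suc(1)[OF this], of j] show ?case using a by simp
qed

lemma cst_simps [simp]:
  "cst 0 = 0" "cst 1 = 1"
  by (simp_all add: cst_def)

lemma cst_add: "cst (c + d) = cst c + cst d"
  and cst_mult: "cst (c * d) = (cst c * cst d :: 'n mpoly)"
  and cst_uminus: "cst (- c) = - cst c"
  and cst_diff: "cst (c - d) = cst c - cst d"
  by (simp_all add: cst_def single_add mult_single single_uminus single_diff)

lemma cst_eq_0_iff [simp]: "cst c = 0 \<longleftrightarrow> c = 0"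
  by (metis cst_def lookup_single_eq lookup_zero cst_simps(1))

lemma cst_inj: "cst a = cst b \<longleftrightarrow> a = b"
  using cst_eq_0_iff[of "a - b"] by (simp add: cst_diff)

lemma cst_of_nat: "cst (of_nat k) = (of_nat k :: 'n mpoly)"
  by (induction k) (simp_all add: cst_add)

lemma cst_of_int: "cst (of_int k) = (of_int k :: 'n mpoly)"
  by (cases k) (simp_all add: cst_of_nat cst_uminus flip: of_nat_Suc del: of_nat_Suc)

lemma monom_0 [simp]: "monom 0 = 1"
  by (simp add: monom_def)

lemma monom_add: "monom (a + b) = (monom a * monom b :: 'n mpoly)"
  by (simp add: monom_def mult_single)

lemma cst_mult_monom: "cst c * monom a = (Poly_Mapping.single a c :: 'n mpoly)"
  by (simp add: monom_def cst_def mult_single)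

lemma lookup_cst_mult: "Poly_Mapping.lookup (cst c * p :: 'n mpoly) a = c * Poly_Mapping.lookup p a"
proof (induction p rule: mpoly_induct)
  case (single b d)
  then show ?case by (simp add: cst_def mult_single lookup_single when_def)
qed (simp add: algebra_simps lookup_add)

lemma lookup_monom: "Poly_Mapping.lookup (monom a) b = (if a = b then 1 else 0)"
  by (simp add: monom_def lookup_single when_def)

lemma mpoly_var_induct [case_names cst var add]:
  fixes p :: "'n::finite mpoly"
  assumes "\<And>c. P (cst c)" "\<And>j p. P p \<Longrightarrow> P (var j * p)" "\<And>p q. P p \<Longrightarrow> P q \<Longrightarrow> P (p + q)"
  shows "P p"
proof (induction p rule: mpoly_induct)
  case (single a c)
  show ?case
  proof (induction a rule: expo_induct)
    case zero
    show ?case using assms(1) by (simp add: cst_def)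
  next
    case (step j a)
    have "Poly_Mapping.single (a + Poly_Mapping.single j 1) c = var j * Poly_Mapping.single a c"
      by (simp add: var_def monom_def mult_single add.commute)
    then show ?case using assms(2)[OF step] by simp
  qed
qed (rule assms(3))

lemma pd_cst [simp]: "pd j (cst c) = 0"
  by (simp add: cst_def pd_single)

lemma pd_cst_mult: "pd j (cst c * p) = cst c * pd j p"
  by (simp add: pd_mult)

lemma pd_var: "pd i (var j) = (if i = j then 1 else 0)"
  by (auto simp: var_def monom_def pd_single lookup_single)

lemma lookup_pd: "Poly_Mapping.lookup (pd j p) b =
    of_nat (Suc (Poly_Mapping.lookup b j)) * Poly_Mapping.lookup p (b + Poly_Mapping.single j 1)"
proof (induction p rule: mpoly_induct)
  case (add p q)
  then show ?case by (simp add: pd_add lookup_add algebra_simps)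
next
  case (single a c)
  let ?e = "Poly_Mapping.single j 1"
  show ?case
  proof (cases "Poly_Mapping.lookup a j = 0")
    case True
    then have "a \<noteq> b + ?e" by (auto simp: lookup_add)
    then show ?thesis using True by (simp add: pd_single lookup_single)
  next
    case False
    then have "a = (a - ?e) + ?e"
      by (intro poly_mapping_eqI) (auto simp: lookup_add lookup_minus lookup_single when_def)
    then have eq: "a - ?e = b \<longleftrightarrow> a = b + ?e" by (metis add_right_cancel)
    then show ?thesis by (auto simp: pd_single lookup_single when_def lookup_add)
  qed
qed

lemma pd_commute: "pd i (pd j p) = pd j (pd i p)"
  by (rule poly_mapping_eqI)
    (cases "i = j", simp_all add: lookup_pd lookup_add lookup_single algebra_simps)


section \<open>Substitution of commuting elements\<close>

text \<open>An intertwining map carries iterated operators along. This transports actions between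
  operators, polynomials, rational functions and logarithmic series.\<close>

lemma power_comp_hom:
  assumes "\<And>j x. \<phi> (T j x) = S j (\<phi> x)"
  shows "\<phi> (power_comp T a x) = power_comp S a (\<phi> x)"
proof -
  have pow: "\<phi> ((T j ^^ k) x) = (S j ^^ k) (\<phi> x)" for j k x
    by (induction k) (simp_all add: assms)
  have "\<phi> (fold (\<lambda>j. T j ^^ Poly_Mapping.lookup a j) xs x)
      = fold (\<lambda>j. S j ^^ Poly_Mapping.lookup a j) xs (\<phi> x)" for xs
    by (induction xs arbitrary: x) (simp_all add: pow)
  then show ?thesis by (simp add: power_comp_def)
qed

lemma power_comp_0 [simp]: "power_comp T 0 x = x"
proof -
  have "fold (\<lambda>j. T j ^^ Poly_Mapping.lookup 0 j) xs x = x" for xs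
    by (induction xs) simp_all
  then show ?thesis by (simp add: power_comp_def)
qed

text \<open>Commutation lets the extra factor \<open>T j\<close> move out past the factors that
  \<open>fold\<close> applies after it.\<close>

lemma power_comp_step:
  assumes comm: "\<And>i j x. T i (T j x) = T j (T i x)"
  shows "power_comp T (a + Poly_Mapping.single j 1) x = T j (power_comp T a x)"
proof -
  have pow: "(T i ^^ k) (T j x) = T j ((T i ^^ k) x)" for i j k x
    by (induction k) (simp_all add: comm)
  define F where "F a xs = fold (\<lambda>j. T j ^^ Poly_Mapping.lookup a j) xs" for a xs
  have fold: "F a xs (T j x) = T j (F a xs x)" for a j xs x
    unfolding F_def by (induction xs arbitrary: x) (simp_all add: pow)
  \<comment> \<open>Generalised to all lists without repetition, so that \<open>j\<close> may be
    missing from the tail.\<close>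
  have "distinct xs \<Longrightarrow> F (a + Poly_Mapping.single j 1) xs x
     = (if j \<in> set xs then T j (F a xs x) else F a xs x)" for xs
  proof (induction xs arbitrary: x)
    case (Cons i xs)
    show ?case
    proof (cases "i = j")
      case True
      then have "j \<notin> set xs" using Cons(2) by auto
      then have "F (a + Poly_Mapping.single j 1) (i # xs) x
          = F a xs (T j ((T j ^^ Poly_Mapping.lookup a j) x))"
        using Cons True by (simp add: F_def lookup_add One_nat_def)
      then show ?thesis unfolding fold using True by (simp add: F_def)
    next
      case False
      then show ?thesis using Cons by (simp add: F_def lookup_add lookup_single)
    qed
  qed (simp add: F_def)
  from this[of "sorted_list_of_set UNIV"] show ?thesis
    by (simp add: power_comp_def F_def)
qed

lemma power_comp_add:
  assumes comm: "\<And>i j x. T i (T j x) = T j (T i x)"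
  shows "power_comp T (a + b) x = power_comp T a (power_comp T b x)"
proof (induction a rule: expo_induct)
  case (step j a)
  have "a + Poly_Mapping.single j 1 + b = (a + b) + Poly_Mapping.single j 1"
    by (simp add: ac_simps)
  then show ?case
    by (simp only: power_comp_step[of T, OF comm] step)
qed simp

lemma power_comp_single:
  assumes comm: "\<And>i j x. T i (T j x) = T j (T i x)"
  shows "power_comp T (Poly_Mapping.single j 1) x = T j x"
  using power_comp_step[of T 0, OF comm] by simp

text \<open>\<open>fold\<close> applies the first factor first, whereas in the product that factor
  stands leftmost and acts last; commutation reconciles the two orders.\<close>

lemma power_prod_power_comp:
  assumes "\<And>i j. f i * f j = f j * (f i :: 'a::monoid_mult)"
  shows "power_prod f a * x = power_comp (\<lambda>j x. f j * x) a x"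
proof -
  have pow: "((*) (f j) ^^ k) x = f j ^ k * x" for j k x
    by (induction k) (simp_all add: mult.assoc)
  have comm: "f i ^ k * f j ^ l = f j ^ l * f i ^ k" for i j k l
    using assms[of i j] by (metis power_commuting_commutes)
  have comm': "f i ^ k * prod_list (map (\<lambda>j. f j ^ Poly_Mapping.lookup a j) xs)
    = prod_list (map (\<lambda>j. f j ^ Poly_Mapping.lookup a j) xs) * f i ^ k" for i k xs
  proof (induction xs)
    case (Cons j xs)
    let ?y = "f j ^ Poly_Mapping.lookup a j"
      and ?P = "prod_list (map (\<lambda>j. f j ^ Poly_Mapping.lookup a j) xs)"
    have "f i ^ k * (?y * ?P) = ?y * (f i ^ k * ?P)"
      by (simp only: mult.assoc [symmetric] comm[of i k])
    then show ?case by (simp add: Cons mult.assoc)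
  qed simp
  have "prod_list (map (\<lambda>j. f j ^ Poly_Mapping.lookup a j) xs) * x
      = fold (\<lambda>j. (*) (f j) ^^ Poly_Mapping.lookup a j) xs x" for xs
  proof (induction xs arbitrary: x)
    case (Cons i xs)
    show ?case
      unfolding fold_Cons o_apply pow[where j=i] Cons [symmetric]
      by (simp only: list.map prod_list.Cons comm' mult.assoc)
  qed simp
  then show ?thesis by (simp add: power_prod_def power_comp_def)
qed

text \<open>The values of \<open>h\<close> and \<open>f\<close> lie in a commutative subring of a ring that need not be
  commutative.\<close>

locale commuting_subst =
  fixes h :: "complex \<Rightarrow> 'a::ring_1" and f :: "'n::{finite,linorder} \<Rightarrow> 'a"
  assumes h_add: "h (c + d) = h c + h d"
    and h_mult: "h (c * d) = h c * h d"
    and h_1: "h 1 = 1"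
    and h_f: "h c * f j = f j * h c"
    and f_f: "f i * f j = f j * f i"
begin

lemma h_0: "h 0 = 0"
  using h_add[of 0 0] by simp

lemma power_prod_0 [simp]: "power_prod f 0 = 1"
  using power_prod_power_comp[of f 0 1] f_f by simp

lemma power_prod_step: "power_prod f (a + Poly_Mapping.single j 1) = f j * power_prod f a"
proof -
  have "f i * (f j * x) = f j * (f i * x)" for i j x
    by (metis f_f mult.assoc)
  from power_comp_step[of "\<lambda>j x. f j * x", OF this] show ?thesis
    using power_prod_power_comp[of f _ 1] f_f by simp
qed

lemma subst_add: "poly_subst h f (p + q) = poly_subst h f p + poly_subst h f q"
  unfolding poly_subst_def
  by (rule setsum_keys_plus_distrib) (simp_all add: h_0 h_add algebra_simps)

lemma subst_0 [simp]: "poly_subst h f 0 = 0"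
  by (simp add: poly_subst_def)

lemma subst_single: "poly_subst h f (Poly_Mapping.single a c) = h c * power_prod f a"
  by (cases "c = 0") (simp_all add: poly_subst_def h_0)

lemma subst_cst [simp]: "poly_subst h f (cst c) = h c"
  by (simp add: cst_def subst_single)

lemma subst_1 [simp]: "poly_subst h f 1 = 1"
  using subst_cst[of 1] h_1 by simp

lemma subst_monom: "poly_subst h f (monom a) = power_prod f a"
  by (simp add: monom_def subst_single h_1)

lemma subst_var [simp]: "poly_subst h f (var j) = f j"
  using power_prod_step[of 0 j] by (simp add: var_def subst_monom)

lemma subst_var_mult: "poly_subst h f (var j * p) = f j * poly_subst h f p"
proof (induction p rule: mpoly_induct)
  case (single a c)
  have "var j * Poly_Mapping.single a c = Poly_Mapping.single (a + Poly_Mapping.single j 1) c"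
    by (simp add: var_def monom_def mult_single add.commute)
  then show ?case by (simp add: subst_single power_prod_step h_f flip: mult.assoc)
qed (simp add: subst_add algebra_simps)

lemma subst_cst_mult: "poly_subst h f (cst c * p) = h c * poly_subst h f p"
proof (induction p rule: mpoly_induct)
  case (single a d)
  then show ?case by (simp add: cst_def mult_single subst_single h_mult mult.assoc)
qed (simp add: subst_add algebra_simps)

lemma subst_mult: "poly_subst h f (p * q) = poly_subst h f p * poly_subst h f q"
  by (induction p rule: mpoly_var_induct)
    (simp_all add: subst_cst_mult subst_var_mult subst_add mult.assoc distrib_right)

lemma subst_uminus: "poly_subst h f (- p) = - poly_subst h f p"
  using subst_add[of p "- p"] by (simp add: add_eq_0_iff)

lemma subst_diff: "poly_subst h f (p - q) = poly_subst h f p - poly_subst h f q"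
  using subst_add[of p "- q"] subst_uminus[of q] by simp

lemma subst_sum: "poly_subst h f (sum g S) = (\<Sum>i\<in>S. poly_subst h f (g i))"
  by (induction S rule: infinite_finite_induct) (simp_all add: subst_add)

end

section \<open>Evaluation and translation as substitutions\<close>

lemma commuting_subst_eval: "commuting_subst (\<lambda>c. c) (\<lambda>j. v $ j)"
  by unfold_locales simp_all

lemmas poly_eval_simps =
  commuting_subst.subst_add[OF commuting_subst_eval, folded poly_eval_def]
  commuting_subst.subst_mult[OF commuting_subst_eval, folded poly_eval_def]
  commuting_subst.subst_diff[OF commuting_subst_eval, folded poly_eval_def]
  commuting_subst.subst_sum[OF commuting_subst_eval, folded poly_eval_def]
  commuting_subst.subst_var[OF commuting_subst_eval, folded poly_eval_def]
  commuting_subst.subst_cst[OF commuting_subst_eval, folded poly_eval_def]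
  commuting_subst.subst_0[OF commuting_subst_eval, folded poly_eval_def]
  commuting_subst.subst_1[OF commuting_subst_eval, folded poly_eval_def]

lemma poly_eval_prod: "poly_eval (prod g S) v = (\<Prod>i\<in>S. poly_eval (g i) v)"
  by (induction S rule: infinite_finite_induct) (simp_all add: poly_eval_simps)

lemma poly_eval_at_0: "poly_eval p 0 = Poly_Mapping.lookup p 0"
proof (induction p rule: mpoly_var_induct)
  case (cst c)
  show ?case by (simp add: poly_eval_simps) (simp add: cst_def)
next
  case (var j p)
  have "Poly_Mapping.lookup (var j * p) 0 = 0"
  proof (induction p rule: mpoly_induct)
    case (single a c)
    have "Poly_Mapping.single j (1::nat) + a \<noteq> 0"
      using lookup_add[of "Poly_Mapping.single j 1" a j] by (metis lookup_single_eq
          lookup_zero add_is_0 zero_neq_one)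
    then show ?case by (simp add: var_def monom_def mult_single lookup_single)
  qed (simp add: algebra_simps lookup_add)
  then show ?case by (simp add: poly_eval_simps)
qed (simp add: poly_eval_simps lookup_add)

lemma commuting_subst_translate: "commuting_subst cst (\<lambda>j. var j + cst (v $ j) :: 'n::{finite,linorder} mpoly)"
  by unfold_locales (simp_all add: cst_add cst_mult algebra_simps)

lemmas translate_simps =
  commuting_subst.subst_add[OF commuting_subst_translate, folded translate_def]
  commuting_subst.subst_mult[OF commuting_subst_translate, folded translate_def]
  commuting_subst.subst_diff[OF commuting_subst_translate, folded translate_def]
  commuting_subst.subst_sum[OF commuting_subst_translate, folded translate_def]
  commuting_subst.subst_var[OF commuting_subst_translate, folded translate_def]
  commuting_subst.subst_cst[OF commuting_subst_translate, folded translate_def]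
  commuting_subst.subst_0[OF commuting_subst_translate, folded translate_def]
  commuting_subst.subst_1[OF commuting_subst_translate, folded translate_def]

lemma translate_translate: "translate v (translate w p) = translate (v + w) p"
  by (induction p rule: mpoly_var_induct) (simp_all add: translate_simps cst_add algebra_simps)

lemma translate_zero [simp]: "translate 0 p = p"
  by (induction p rule: mpoly_var_induct) (simp_all add: translate_simps)

lemma poly_eval_translate: "poly_eval (translate v p) w = poly_eval p (v + w)"
  by (induction p rule: mpoly_var_induct) (simp_all add: translate_simps poly_eval_simps add.commute)

lemma translate_prod: "translate v (prod g S) = (\<Prod>i\<in>S. translate v (g i))"
  by (induction S rule: infinite_finite_induct) (simp_all add: translate_simps)


section \<open>Constant-coefficient operators acting on polynomials\<close>

lemma diff_act_add_left: "(f + g) \<bullet>\<^sub>\<partial> p = f \<bullet>\<^sub>\<partial> p + g \<bullet>\<^sub>\<partial> p"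
  unfolding diff_act_def
  by (rule setsum_keys_plus_distrib) (simp_all add: cst_add algebra_simps)

lemma diff_act_single: "Poly_Mapping.single a c \<bullet>\<^sub>\<partial> p = cst c * power_comp pd a p"
  by (cases "c = 0") (simp_all add: diff_act_def)

lemma diff_act_0_left [simp]: "0 \<bullet>\<^sub>\<partial> p = 0"
  by (simp add: diff_act_def)

lemma diff_act_cst_left: "cst c \<bullet>\<^sub>\<partial> p = cst c * p"
  by (simp add: cst_def diff_act_single)

lemma diff_act_1 [simp]: "1 \<bullet>\<^sub>\<partial> p = p"
  using diff_act_cst_left[of 1] by simp

lemma diff_act_var_mult: "(var j * f) \<bullet>\<^sub>\<partial> p = pd j (f \<bullet>\<^sub>\<partial> p)"
proof (induction f rule: mpoly_induct)
  case (single a c)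
  have "var j * Poly_Mapping.single a c = Poly_Mapping.single (a + Poly_Mapping.single j 1) c"
    by (simp add: var_def monom_def mult_single add.commute)
  then show ?case
    by (simp add: diff_act_single power_comp_step[of pd, OF pd_commute] pd_cst_mult)
qed (simp add: diff_act_add_left distrib_left pd_add)

lemma diff_act_var: "var j \<bullet>\<^sub>\<partial> p = pd j p"
  using diff_act_var_mult[of j 1] by simp

lemma diff_act_cst_mult: "(cst c * f) \<bullet>\<^sub>\<partial> p = cst c * (f \<bullet>\<^sub>\<partial> p)"
proof (induction f rule: mpoly_induct)
  case (single a d)
  have "cst c * Poly_Mapping.single a d = Poly_Mapping.single a (c * d)"
    by (simp add: cst_def mult_single)
  then show ?case by (simp add: diff_act_single cst_mult mult.assoc)
qed (simp add: diff_act_add_left distrib_left)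

lemma diff_act_mult: "(f * g) \<bullet>\<^sub>\<partial> p = f \<bullet>\<^sub>\<partial> g \<bullet>\<^sub>\<partial> p"
  by (induction f rule: mpoly_var_induct)
    (simp_all add: diff_act_cst_left diff_act_cst_mult diff_act_var_mult distrib_right
      mult.assoc diff_act_add_left)

lemma diff_act_add_right: "f \<bullet>\<^sub>\<partial> (p + q) = f \<bullet>\<^sub>\<partial> p + f \<bullet>\<^sub>\<partial> q"
  by (induction f rule: mpoly_var_induct)
    (simp_all add: diff_act_cst_left diff_act_var_mult diff_act_add_left pd_add distrib_left add_ac)

lemma diff_act_0_right [simp]: "f \<bullet>\<^sub>\<partial> 0 = 0"
  using diff_act_add_right[of f 0 0] by simp

lemma diff_act_uminus_left: "(- f) \<bullet>\<^sub>\<partial> p = - (f \<bullet>\<^sub>\<partial> p)"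
  using diff_act_add_left[of f "- f" p] by (simp add: add_eq_0_iff)

lemma diff_act_diff_left: "(f - g) \<bullet>\<^sub>\<partial> p = f \<bullet>\<^sub>\<partial> p - g \<bullet>\<^sub>\<partial> p"
  using diff_act_add_left[of f "- g" p] by (simp add: diff_act_uminus_left)

lemma diff_act_uminus_right: "f \<bullet>\<^sub>\<partial> (- p) = - (f \<bullet>\<^sub>\<partial> p)"
  using diff_act_add_right[of f p "- p"] by (simp add: add_eq_0_iff)

lemma diff_act_diff_right: "f \<bullet>\<^sub>\<partial> (p - q) = f \<bullet>\<^sub>\<partial> p - f \<bullet>\<^sub>\<partial> q"
  using diff_act_add_right[of f p "- q"] by (simp add: diff_act_uminus_right)

section \<open>Multi-index factorials and the pairing of operators with polynomials\<close>

definition expo_fact :: "'n::finite expo \<Rightarrow> complex" where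
  "expo_fact a = (\<Prod>j\<in>UNIV. fact (Poly_Mapping.lookup a j))"

lemma expo_fact_nz [simp]: "expo_fact a \<noteq> 0"
  by (simp add: expo_fact_def)

lemma expo_fact_0 [simp]: "expo_fact 0 = 1"
  by (simp add: expo_fact_def)

lemma expo_fact_step: "expo_fact (a + Poly_Mapping.single j 1)
    = of_nat (Suc (Poly_Mapping.lookup a j)) * expo_fact a"
proof -
  have "expo_fact (a + Poly_Mapping.single j 1)
      = (\<Prod>i\<in>UNIV. (if i = j then of_nat (Suc (Poly_Mapping.lookup a j)) else 1)
           * fact (Poly_Mapping.lookup a i))"
    unfolding expo_fact_def
    by (intro prod.cong) (auto simp: lookup_add lookup_single when_def One_nat_def)
  then show ?thesis by (simp add: prod.distrib expo_fact_def)
qed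

text \<open>Weighted by factorials, coefficients merely shift under differentiation, so no quotients
  of factorials occur.\<close>

lemma lookup_diff_act_monom:
  "Poly_Mapping.lookup (monom a \<bullet>\<^sub>\<partial> p) b * expo_fact b
     = expo_fact (a + b) * Poly_Mapping.lookup p (a + b)"
proof (induction a arbitrary: b rule: expo_induct)
  case (step j a)
  let ?e = "Poly_Mapping.single j 1"
  have "monom (a + ?e) = var j * monom a"
    by (simp add: monom_add var_def mult.commute)
  then have "Poly_Mapping.lookup (monom (a + ?e) \<bullet>\<^sub>\<partial> p) b * expo_fact b
      = Poly_Mapping.lookup (monom a \<bullet>\<^sub>\<partial> p) (b + ?e) * expo_fact (b + ?e)"
    by (simp add: diff_act_var_mult lookup_pd expo_fact_step)
  then show ?case unfolding step by (simp add: ac_simps)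
qed simp

lemma lookup_diff_act:
  "Poly_Mapping.lookup (f \<bullet>\<^sub>\<partial> p) b * expo_fact b
     = (\<Sum>a\<in>Poly_Mapping.keys f. Poly_Mapping.lookup f a
          * (expo_fact (a + b) * Poly_Mapping.lookup p (a + b)))"
proof -
  have "f \<bullet>\<^sub>\<partial> p = (\<Sum>a\<in>Poly_Mapping.keys f. cst (Poly_Mapping.lookup f a) * (monom a \<bullet>\<^sub>\<partial> p))"
    by (simp add: diff_act_def monom_def diff_act_single)
  then show ?thesis
    by (simp add: lookup_sum lookup_cst_mult sum_distrib_right mult.assoc lookup_diff_act_monom)
qed

text \<open>The bilinear form behind \<open>perp\<close>. It is diagonal in the monomial bases with
  the nonzero entries \<open>a!\<close>, hence nondegenerate.\<close>

definition pairing :: "'n::{finite,linorder} mpoly \<Rightarrow> 'n mpoly \<Rightarrow> complex" where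
  "pairing f p = poly_eval (f \<bullet>\<^sub>\<partial> p) 0"

lemma pairing_eq: "pairing f p = (\<Sum>a\<in>Poly_Mapping.keys f. Poly_Mapping.lookup f a
    * (expo_fact a * Poly_Mapping.lookup p a))"
  using lookup_diff_act[of f p 0] by (simp add: pairing_def poly_eval_at_0)

lemma pairing_monom: "pairing (monom a) p = expo_fact a * Poly_Mapping.lookup p a"
  by (simp add: pairing_eq monom_def)

lemma pairing_mult: "pairing (f * g) p = pairing f (g \<bullet>\<^sub>\<partial> p)"
  by (simp add: pairing_def diff_act_mult)

lemma eq_if_pairing_eq:
  assumes "\<And>f. pairing f p = pairing f q"
  shows "p = q"
  using assms[of "monom _"] by (intro poly_mapping_eqI) (simp add: pairing_monom)

section \<open>Degrees and invertible operators\<close>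

definition tdeg :: "'n::finite expo \<Rightarrow> nat" where
  "tdeg a = (\<Sum>j\<in>UNIV. Poly_Mapping.lookup a j)"

lemma tdeg_add: "tdeg (a + b) = tdeg a + tdeg b"
  by (simp add: tdeg_def lookup_add sum.distrib)

lemma tdeg_0_iff [simp]: "tdeg a = 0 \<longleftrightarrow> a = 0"
  by (auto simp: tdeg_def intro!: poly_mapping_eqI)

lemma tdeg_bound: obtains m where "\<And>a. Poly_Mapping.lookup p a \<noteq> 0 \<Longrightarrow> tdeg a \<le> m"
proof
  fix a assume "Poly_Mapping.lookup p a \<noteq> 0"
  then show "tdeg a \<le> Max (tdeg ` Poly_Mapping.keys p)"
    by (intro Max_ge) (auto simp: in_keys_iff)
qed

text \<open>An operator without constant term lowers degrees, so the degree bound \<open>m\<close>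
  of \<open>p\<close> is used up after \<open>Suc m\<close> applications.\<close>

lemma diff_act_nilpotent:
  assumes "Poly_Mapping.lookup f 0 = 0"
  shows "\<exists>k. f ^ k \<bullet>\<^sub>\<partial> p = 0"
proof -
  obtain m where m: "\<And>a. Poly_Mapping.lookup p a \<noteq> 0 \<Longrightarrow> tdeg a \<le> m"
    using tdeg_bound by blast
  have "m < tdeg a + k \<Longrightarrow> Poly_Mapping.lookup (f ^ k \<bullet>\<^sub>\<partial> p) a = 0" for k a
  proof (induction k arbitrary: a)
    case 0
    then show ?case using m[of a] by auto
  next
    case (Suc k)
    have "Poly_Mapping.lookup (f ^ Suc k \<bullet>\<^sub>\<partial> p) a * expo_fact a = 0"
      unfolding power_Suc diff_act_mult lookup_diff_act
    proof (rule sum.neutral, rule ballI)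
      fix b assume "b \<in> Poly_Mapping.keys f"
      then have "b \<noteq> 0" using assms by (auto simp: in_keys_iff)
      then have "0 < tdeg b" using tdeg_0_iff[of b] by linarith
      then have "m < tdeg (b + a) + k" using Suc.prems by (simp add: tdeg_add)
      from Suc.IH[OF this] show "Poly_Mapping.lookup f b
          * (expo_fact (b + a) * Poly_Mapping.lookup (f ^ k \<bullet>\<^sub>\<partial> p) (b + a)) = 0" by simp
    qed
    then show ?case by simp
  qed
  from this[of _ "Suc m"] have "f ^ Suc m \<bullet>\<^sub>\<partial> p = 0"
    by (intro poly_mapping_eqI) simp
  then show ?thesis ..
qed

text \<open>Up to a nonzero constant, \<open>f\<close> is \<open>1 - g\<close> with \<open>g\<close>
  nilpotent on each polynomial. A polynomial fixed by \<open>g\<close> therefore vanishes, and a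
  finite geometric sum inverts \<open>f\<close> on \<open>p\<close>.\<close>

lemma diff_act_unit:
  assumes "poly_eval f 0 \<noteq> 0"
  shows diff_act_unit_inj: "f \<bullet>\<^sub>\<partial> p = 0 \<Longrightarrow> p = 0"
    and diff_act_unit_surj: "\<exists>q. f \<bullet>\<^sub>\<partial> q = p"
proof -
  define c where "c = poly_eval f 0"
  define g where "g = 1 - cst (1 / c) * f"
  have f: "f = cst c * (1 - g)"
    using assms by (simp add: g_def c_def mult.assoc[symmetric] cst_mult[symmetric])
  have "Poly_Mapping.lookup g 0 = 0"
    using assms by (simp add: g_def c_def poly_eval_simps flip: poly_eval_at_0)
  then obtain k where k: "g ^ k \<bullet>\<^sub>\<partial> p = 0" using diff_act_nilpotent by blast
  show "p = 0" if "f \<bullet>\<^sub>\<partial> p = 0"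
  proof -
    have "(cst (1 / c) * f) \<bullet>\<^sub>\<partial> p = 0" using that by (simp add: diff_act_mult)
    then have *: "g \<bullet>\<^sub>\<partial> p = p" by (simp add: g_def diff_act_diff_left)
    have "g ^ l \<bullet>\<^sub>\<partial> p = p" for l
      by (induction l) (simp_all add: * diff_act_mult)
    then show ?thesis using k by metis
  qed
  have "cst c * cst (1 / c) = (1 :: 'a mpoly)"
    using assms by (simp add: c_def flip: cst_mult)
  moreover have "cst c * (1 - g) * (cst (1 / c) * (\<Sum>i<k. g ^ i))
      = (cst c * cst (1 / c)) * ((1 - g) * (\<Sum>i<k. g ^ i))"
    by (simp only: ac_simps)
  ultimately have "cst c * (1 - g) * (cst (1 / c) * (\<Sum>i<k. g ^ i)) = (1 - g) * (\<Sum>i<k. g ^ i)"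
    by simp
  then have "f * (cst (1 / c) * (\<Sum>i<k. g ^ i)) = 1 - g ^ k"
    unfolding one_diff_power_eq f
    by (simp add: algebra_simps)
  then have "(f * (cst (1 / c) * (\<Sum>i<k. g ^ i))) \<bullet>\<^sub>\<partial> p = p"
    by (simp add: diff_act_diff_left k)
  then show "\<exists>q. f \<bullet>\<^sub>\<partial> q = p" by (metis diff_act_mult)
qed


section \<open>Graded ideals and duality\<close>

interpretation ring_mod: module "(*) :: 'a::comm_ring_1 \<Rightarrow> 'a \<Rightarrow> 'a"
  by unfold_locales (simp_all add: algebra_simps)

declare ring_mod.scale_scale [simp del]

lemma ideal_subspace [simp]: "ring_mod.subspace (ideal G)"
  by (simp add: ideal_def)

lemma ideal_gen: "g \<in> G \<Longrightarrow> g \<in> ideal G"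
  by (simp add: ideal_def ring_mod.span_base)

lemma ideal_minimal: "G \<subseteq> J \<Longrightarrow> ring_mod.subspace J \<Longrightarrow> ideal G \<subseteq> J"
  by (simp add: ideal_def ring_mod.span_minimal)

lemma ideal_sum_subspace:
  "ring_mod.subspace I \<Longrightarrow> ring_mod.subspace J \<Longrightarrow> ring_mod.subspace (ideal_sum I J)"
proof -
  assume I: "ring_mod.subspace I" and J: "ring_mod.subspace J"
  show ?thesis
  proof (rule ring_mod.subspaceI)
    show "0 \<in> ideal_sum I J"
      unfolding ideal_sum_def using I J
      by (auto intro!: exI[of _ 0] simp: ring_mod.subspace_0)
    fix x y c assume "x \<in> ideal_sum I J"
    then obtain f g where x: "x = f + g" "f \<in> I" "g \<in> J" by (auto simp: ideal_sum_def)
    show "c * x \<in> ideal_sum I J"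
      unfolding ideal_sum_def x(1) distrib_left
      using x I J by (blast intro: ring_mod.subspace_scale)
    assume "y \<in> ideal_sum I J"
    then obtain f' g' where y: "y = f' + g'" "f' \<in> I" "g' \<in> J" by (auto simp: ideal_sum_def)
    have "x + y = (f + f') + (g + g')" by (simp add: x y)
    then show "x + y \<in> ideal_sum I J"
      unfolding ideal_sum_def using x y I J by (blast intro: ring_mod.subspace_add)
  qed
qed

lemma in_ideal_sumI1:
  assumes "0 \<in> J" "f \<in> I"
  shows "f \<in> ideal_sum I J"
proof -
  have "f = f + 0" by simp
  then show ?thesis using assms unfolding ideal_sum_def by blast
qed

lemma in_ideal_sumI2:
  assumes "0 \<in> I" "f \<in> J"
  shows "f \<in> ideal_sum I J"
proof -
  have "f = 0 + f" by simp
  then show ?thesis using assms unfolding ideal_sum_def by blast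
qed

section \<open>Homogeneous components and graded ideals\<close>

definition restr :: "'k set \<Rightarrow> ('k \<Rightarrow>\<^sub>0 'b) \<Rightarrow> ('k \<Rightarrow>\<^sub>0 'b::comm_monoid_add)" where
  "restr S p = (\<Sum>a\<in>Poly_Mapping.keys p \<inter> S. Poly_Mapping.single a (Poly_Mapping.lookup p a))"

lemma lookup_restr:
  "Poly_Mapping.lookup (restr S p) a = (if a \<in> S then Poly_Mapping.lookup p a else 0)"
proof -
  have "Poly_Mapping.lookup (restr S p) a
      = (\<Sum>b\<in>Poly_Mapping.keys p \<inter> S. if b = a then Poly_Mapping.lookup p b else 0)"
    by (auto simp: restr_def lookup_sum lookup_single when_def intro!: sum.cong)
  then show ?thesis by (simp add: in_keys_iff)
qed

lemma restr_add: "restr S (p + q) = restr S p + restr S q"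
  by (rule poly_mapping_eqI) (simp add: lookup_restr lookup_add)

lemma restr_0 [simp]: "restr S 0 = 0"
  by (simp add: restr_def)

lemma restr_sum: "restr S (sum g T) = (\<Sum>i\<in>T. restr S (g i))"
  by (induction T rule: infinite_finite_induct) (simp_all add: restr_add)

lemma restr_single: "restr S (Poly_Mapping.single a c) = (if a \<in> S then Poly_Mapping.single a c else 0)"
  by (rule poly_mapping_eqI) (auto simp: lookup_restr lookup_single when_def)

abbreviation hpart :: "nat \<Rightarrow> 'n::finite mpoly \<Rightarrow> 'n mpoly" where
  "hpart m \<equiv> restr {a. tdeg a = m}"

abbreviation trunc :: "nat \<Rightarrow> 'n::finite mpoly \<Rightarrow> 'n mpoly" where
  "trunc m \<equiv> restr {a. tdeg a \<le> m}"

lemma trunc_hpart: "trunc m p = (\<Sum>i\<le>m. hpart i p)"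
  by (rule poly_mapping_eqI) (simp add: lookup_sum lookup_restr)

lemma hpart_mult: "hpart m (p * q) = (\<Sum>i\<le>m. hpart i p * hpart (m - i) q)"
proof (induction p rule: mpoly_induct)
  case (single a c)
  show ?case
  proof (induction q rule: mpoly_induct)
    case (single b d)
    have "(\<Sum>i\<le>m. hpart i (Poly_Mapping.single a c) * hpart (m - i) (Poly_Mapping.single b d))
      = (\<Sum>i\<le>m. if i = tdeg a then (if tdeg b = m - tdeg a then Poly_Mapping.single (a + b) (c * d) else 0) else 0)"
      by (rule sum.cong) (auto simp: restr_single mult_single)
    then show ?case by (auto simp: mult_single restr_single tdeg_add)
  qed (simp add: restr_add distrib_left sum.distrib)
qed (simp add: restr_add distrib_right sum.distrib)

definition graded :: "'n::finite mpoly set \<Rightarrow> bool" where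
  "graded J \<longleftrightarrow> (\<forall>p\<in>J. \<forall>m. hpart m p \<in> J)"

text \<open>By the product formula for components, the polynomials with all components in the ideal
  form an ideal, so checking generators suffices.\<close>

lemma graded_ideal:
  assumes "\<And>g m. g \<in> G \<Longrightarrow> hpart m g \<in> ideal G"
  shows "graded (ideal G)"
proof -
  have "ideal G \<subseteq> {p. \<forall>m. hpart m p \<in> ideal G}"
  proof (rule ideal_minimal)
    show "G \<subseteq> {p. \<forall>m. hpart m p \<in> ideal G}" using assms by blast
    show "ring_mod.subspace {p. \<forall>m. hpart m p \<in> ideal G}"
      unfolding ring_mod.subspace_def
      by (auto simp: restr_add hpart_mult ring_mod.subspace_0 ring_mod.subspace_add
          intro!: ring_mod.subspace_sum ring_mod.subspace_scale)
  qed
  then show ?thesis by (auto simp: graded_def)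
qed

lemma graded_ideal_sum: "graded I \<Longrightarrow> graded J \<Longrightarrow> graded (ideal_sum I J)"
  unfolding graded_def ideal_sum_def by (fastforce simp: restr_add)

lemma graded_ideal_prod:
  assumes "graded I" "graded J"
  shows "graded (ideal_prod I J)"
  unfolding ideal_prod_def
proof (rule graded_ideal)
  fix g m assume "g \<in> {f * g |f g. f \<in> I \<and> g \<in> J}"
  then obtain p q where "g = p * q" "p \<in> I" "q \<in> J" by blast
  then show "hpart m g \<in> ideal {f * g |f g. f \<in> I \<and> g \<in> J}"
    using assms unfolding hpart_mult \<open>g = p * q\<close>
    by (intro ring_mod.subspace_sum ideal_subspace ideal_gen) (auto simp: graded_def, blast)
qed

lemma graded_ideal_monom:
  assumes "\<And>g. g \<in> G \<Longrightarrow> \<exists>a. g = monom a"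
  shows "graded (ideal G)"
proof (rule graded_ideal)
  fix g m assume g: "g \<in> G"
  then obtain a where "g = monom a" using assms by blast
  then have "hpart m g = g \<or> hpart m g = 0"
    by (simp add: monom_def restr_single)
  then show "hpart m g \<in> ideal G"
    using g by (auto simp: ideal_gen ring_mod.subspace_0)
qed

lemma linear_form_eq: "linear_form A i
    = (\<Sum>j\<in>UNIV. Poly_Mapping.single (Poly_Mapping.single j 1) (of_int (A $ i $ j)))"
  unfolding linear_form_def
  by (rule sum.cong) (simp_all add: var_def cst_mult_monom flip: cst_of_int)

lemma graded_linear_forms: "graded (ideal (range (linear_form A)))"
proof (rule graded_ideal)
  fix g m assume g: "g \<in> range (linear_form A)"
  then obtain i where i: "g = linear_form A i" by blast
  have "tdeg (Poly_Mapping.single j 1) = 1" for j :: 'a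
    by (simp add: tdeg_def lookup_single when_def)
  then have "hpart m g = (if m = 1 then g else 0)"
    unfolding i linear_form_eq by (simp add: restr_sum restr_single)
  then show "hpart m g \<in> ideal (range (linear_form A))"
    using g by (auto simp: ideal_gen ring_mod.subspace_0)
qed

definition indE :: "'n set \<Rightarrow> 'n::finite expo" where
  "indE S = (\<Sum>j\<in>S. Poly_Mapping.single j 1)"

lemma lookup_indE: "Poly_Mapping.lookup (indE S) j = (if j \<in> S then 1 else 0)"
  by (simp add: indE_def lookup_sum lookup_single when_def)

lemma sqfree_monom: "sqfree S = monom (indE S)"
proof -
  have "finite S \<Longrightarrow> (\<Prod>j\<in>S. var j) = (monom (\<Sum>j\<in>S. Poly_Mapping.single j 1) :: 'a mpoly)"
    by (induction S rule: finite_induct) (simp_all add: monom_add var_def)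
  then show ?thesis by (simp add: sqfree_def indE_def)
qed

lemma sqfree_union: "S \<inter> T = {} \<Longrightarrow> sqfree (S \<union> T) = sqfree S * sqfree T"
  by (simp add: sqfree_def prod.union_disjoint)

lemma Q_ideal_subspace: "ring_mod.subspace (Q_ideal A v N)"
  unfolding Q_ideal_def P_ideal_def ideal_prod_def by (intro ideal_sum_subspace ideal_subspace)

lemma graded_Q_ideal: "graded (Q_ideal A v N)"
  unfolding Q_ideal_def P_ideal_def M_ideal_def
  by (intro graded_ideal_sum graded_ideal_prod graded_linear_forms graded_ideal_monom)
    (auto simp: sqfree_monom)

section \<open>Linear functionals and the polynomials representing them\<close>

interpretation mpoly_space: vector_space "\<lambda>c p. cst c * (p :: 'n::{finite,linorder} mpoly)"
  by unfold_locales (simp_all add: cst_add cst_mult algebra_simps)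

declare mpoly_space.scale_scale [simp del]

interpretation mpoly_pair: vector_space_pair "\<lambda>c p. cst c * (p :: 'n::{finite,linorder} mpoly)"
  "\<lambda>c p. cst c * (p :: 'n::{finite,linorder} mpoly)" ..

text \<open>With a linear projection \<open>\<pi>\<close> with kernel \<open>Q\<close>, the map \<open>\<psi>\<close> factors through \<open>\<pi> \<circ> \<phi>\<close>.\<close>

lemma functional_factorization:
  fixes \<phi> :: "'n::{finite,linorder} mpoly \<Rightarrow> 'n mpoly" and \<psi> :: "'n mpoly \<Rightarrow> complex"
  assumes Q: "mpoly_space.subspace Q"
    and \<phi>: "\<And>f g. \<phi> (f + g) = \<phi> f + \<phi> g" "\<And>c f. \<phi> (cst c * f) = cst c * \<phi> f"
    and \<psi>: "\<And>f g. \<psi> (f + g) = \<psi> f + \<psi> g" "\<And>c f. \<psi> (cst c * f) = c * \<psi> f"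
    and ker: "\<And>f. \<phi> f \<in> Q \<Longrightarrow> \<psi> f = 0"
  obtains \<Lambda> :: "'n mpoly \<Rightarrow> complex"
  where "\<And>f g. \<Lambda> (f + g) = \<Lambda> f + \<Lambda> g" "\<And>c f. \<Lambda> (cst c * f) = c * \<Lambda> f"
    "\<And>q. q \<in> Q \<Longrightarrow> \<Lambda> q = 0" "\<And>f. \<Lambda> (\<phi> f) = \<psi> f"
proof -
  let ?s = "\<lambda>c p. cst c * (p :: 'n mpoly)"
  have "Vector_Spaces.linear ?s ?s (\<lambda>p. p)"
    by (rule mpoly_space.linear_ident)
  \<comment> \<open>\<open>r\<close> is a linear projection onto \<open>Q\<close>; subtracting it
    turns membership in \<open>Q\<close> into the kernel of a linear map.\<close>
  from mpoly_pair.linear_exists_left_inverse_on[OF this Q]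
  obtain r where r: "range r \<subseteq> Q" "Vector_Spaces.linear ?s ?s r" "\<And>q. q \<in> Q \<Longrightarrow> r q = q"
    by (auto simp: inj_on_def)
  interpret r: Vector_Spaces.linear ?s ?s r by (rule r(2))
  define \<Phi> where "\<Phi> f = \<phi> f - r (\<phi> f)" for f
  have lin: "Vector_Spaces.linear ?s ?s \<Phi>"
    unfolding Vector_Spaces.linear_iff
    by (auto simp: \<Phi>_def \<phi> r.add r.scale add_diff_add right_diff_distrib
        mpoly_space.vector_space_axioms)
  interpret \<Phi>: Vector_Spaces.linear ?s ?s \<Phi> by (rule lin)
  \<comment> \<open>\<open>g\<close> is a linear section of \<open>\<Phi>\<close> over its image;
    \<open>\<psi>\<close> does not depend on the choice since it vanishes on the kernel of
    \<open>\<Phi>\<close>.\<close>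
  obtain g where g: "Vector_Spaces.linear ?s ?s g" "\<And>f. \<Phi> (g (\<Phi> f)) = \<Phi> f"
    using mpoly_pair.linear_exists_right_inverse_on[OF lin mpoly_space.subspace_UNIV] by auto
  interpret g: Vector_Spaces.linear ?s ?s g by (rule g(1))
  have \<psi>_0: "\<psi> 0 = 0" using \<psi>(2)[of 0 0] by simp
  have \<psi>_diff: "\<psi> (f - h) = \<psi> f - \<psi> h" for f h
    using \<psi>(1)[of "f - h" h] by simp
  have ker': "\<psi> f = 0" if "\<Phi> f = 0" for f
    using that r(1) by (intro ker) (auto simp: \<Phi>_def)
  show thesis
  proof (rule that[of "\<lambda>p. \<psi> (g (p - r p))"])
    fix f h :: "'n mpoly" and c
    show "\<psi> (g ((f + h) - r (f + h))) = \<psi> (g (f - r f)) + \<psi> (g (h - r h))"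
      by (simp add: r.add add_diff_add g.add \<psi>)
    show "\<psi> (g (cst c * f - r (cst c * f))) = c * \<psi> (g (f - r f))"
      by (simp add: r.scale g.scale \<psi> flip: right_diff_distrib)
    show "\<psi> (g (f - r f)) = 0" if "f \<in> Q"
      using that by (simp add: r(3) g.zero \<psi>_0)
    have "\<Phi> (g (\<Phi> f) - f) = 0" by (simp add: \<Phi>.diff g(2))
    from ker'[OF this] show "\<psi> (g (\<phi> f - r (\<phi> f))) = \<psi> f"
      by (simp add: \<psi>_diff \<Phi>_def)
  qed
qed

lemma finite_tdeg_le: "finite {a :: 'n::finite expo. tdeg a \<le> m}"
proof -
  have "Poly_Mapping.lookup a j \<le> tdeg a" for a :: "'n expo" and j
    unfolding tdeg_def by (rule member_le_sum) auto
  then have "Poly_Mapping.lookup ` {a :: 'n expo. tdeg a \<le> m} \<subseteq> (\<Pi>\<^sub>E j\<in>UNIV. {..m})"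
    by (auto intro: order_trans)
  then have "finite (Poly_Mapping.lookup ` {a :: 'n expo. tdeg a \<le> m})"
    by (rule finite_subset) (simp add: finite_PiE)
  then show ?thesis
    by (rule finite_imageD) (auto simp: inj_on_def intro: poly_mapping_eqI)
qed

text \<open>A functional on polynomials is a power series; killing a graded ideal is inherited by its
  truncations, which are polynomials.\<close>

lemma truncated_functional:
  fixes \<Lambda> :: "'n::{finite,linorder} mpoly \<Rightarrow> complex"
  assumes Q: "ring_mod.subspace Q" "graded Q"
    and \<Lambda>: "\<And>f g. \<Lambda> (f + g) = \<Lambda> f + \<Lambda> g" "\<And>c f. \<Lambda> (cst c * f) = c * \<Lambda> f"
    and \<Lambda>_Q: "\<And>q. q \<in> Q \<Longrightarrow> \<Lambda> q = 0"
  obtains P where "\<And>f. pairing f P = \<Lambda> (trunc m f)" "\<And>q. q \<in> Q \<Longrightarrow> q \<bullet>\<^sub>\<partial> P = 0"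
proof -
  \<comment> \<open>Dividing by \<open>a!\<close> makes the pairing with \<open>monom a\<close>
    equal to \<open>\<Lambda> (monom a)\<close> up to degree \<open>m\<close>.\<close>
  define P where "P = (\<Sum>a\<in>{a. tdeg a \<le> m}.
    Poly_Mapping.single a (\<Lambda> (monom a) / expo_fact a))"
  have P: "Poly_Mapping.lookup P a = (if tdeg a \<le> m then \<Lambda> (monom a) / expo_fact a else 0)" for a
    unfolding P_def by (simp add: lookup_sum lookup_single when_def finite_tdeg_le)
  have \<Lambda>_0: "\<Lambda> 0 = 0" using \<Lambda>(2)[of 0 0] by simp
  have \<Lambda>_sum: "\<Lambda> (sum g S) = (\<Sum>i\<in>S. \<Lambda> (g i))" for g and S :: "'n expo set"
    by (induction S rule: infinite_finite_induct) (simp_all add: \<Lambda> \<Lambda>_0)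
  have pair: "pairing f P = \<Lambda> (trunc m f)" for f
  proof -
    have "pairing f P = (\<Sum>a\<in>Poly_Mapping.keys f.
        if tdeg a \<le> m then \<Lambda> (Poly_Mapping.single a (Poly_Mapping.lookup f a)) else 0)"
      unfolding pairing_eq by (rule sum.cong) (auto simp: P \<Lambda> simp flip: cst_mult_monom)
    then show ?thesis
      by (simp add: restr_def \<Lambda>_sum sum.inter_restrict if_distrib[of \<Lambda>] \<Lambda>_0 cong: if_cong)
  qed
  moreover have "q \<bullet>\<^sub>\<partial> P = 0" if q: "q \<in> Q" for q
  proof (rule eq_if_pairing_eq)
    fix g
    \<comment> \<open>The homogeneous components of \<open>g * q\<close> remain in the graded ideal
      \<open>Q\<close>, hence so does the truncation.\<close>
    have "trunc m (g * q) \<in> Q"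
      unfolding trunc_hpart
      by (intro ring_mod.subspace_sum Q(1))
        (use Q ring_mod.subspace_scale[OF Q(1) q, of g] in \<open>auto simp: graded_def\<close>)
    then have "pairing (g * q) P = 0" by (simp add: pair \<Lambda>_Q)
    then show "pairing g (q \<bullet>\<^sub>\<partial> P) = pairing g 0"
      by (simp add: pairing_mult) (simp add: pairing_def poly_eval_simps)
  qed
  ultimately show thesis by (rule that)
qed

lemma subspace_over_constants: "ring_mod.subspace Q \<Longrightarrow> mpoly_space.subspace Q"
  by (simp add: ring_mod.subspace_def mpoly_space.subspace_def)

lemma pairing_add_left: "pairing (f + g) p = pairing f p + pairing g p"
  by (simp add: pairing_def diff_act_add_left poly_eval_simps)

lemma pairing_cst_mult: "pairing (cst c * f) p = c * pairing f p"
  by (simp add: pairing_def diff_act_cst_mult poly_eval_simps)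

lemma pairing_trunc:
  assumes "\<And>a. Poly_Mapping.lookup p a \<noteq> 0 \<Longrightarrow> tdeg a \<le> m"
  shows "pairing (trunc m f) p = pairing f p"
proof (induction f rule: mpoly_induct)
  case (single a c)
  have "pairing (Poly_Mapping.single a c) p = c * (expo_fact a * Poly_Mapping.lookup p a)"
    by (simp add: pairing_cst_mult pairing_monom flip: cst_mult_monom)
  then show ?case
    using assms[of a] by (auto simp: restr_single pairing_def[of 0] poly_eval_simps)
qed (simp add: restr_add pairing_add_left)

text \<open>A functional that vanishes on \<open>Q\<close> and is 1 at
  \<open>f * monom \<mu>\<close> separates the two; truncating at a degree that bounds this product
  keeps the value.\<close>

lemma Ann_quotient_dual:
  fixes Q :: "'n::{finite,linorder} mpoly set"
  assumes Q: "ring_mod.subspace Q" "graded Q" and f: "f * monom \<mu> \<notin> Q"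
  obtains P where "\<And>q. q \<in> Q \<Longrightarrow> q \<bullet>\<^sub>\<partial> P = 0" "f \<bullet>\<^sub>\<partial> monom \<mu> \<bullet>\<^sub>\<partial> P \<noteq> 0"
proof -
  let ?f = "f * monom \<mu>"
  have ker: "Poly_Mapping.lookup p 0 = 0" if "cst (Poly_Mapping.lookup p 0) * ?f \<in> Q" for p :: "'n mpoly"
  proof (rule ccontr)
    assume c: "Poly_Mapping.lookup p 0 \<noteq> 0"
    have "cst (1 / Poly_Mapping.lookup p 0) * (cst (Poly_Mapping.lookup p 0) * ?f) \<in> Q"
      by (rule ring_mod.subspace_scale[OF Q(1) that])
    then show False using c f by (simp add: mult.assoc[symmetric] flip: cst_mult)
  qed
  obtain \<Lambda> where \<Lambda>: "\<And>f g. \<Lambda> (f + g) = \<Lambda> f + \<Lambda> g" "\<And>c f. \<Lambda> (cst c * f) = c * \<Lambda> f"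
    "\<And>q. q \<in> Q \<Longrightarrow> \<Lambda> q = 0" "\<And>p :: 'n mpoly. \<Lambda> (cst (Poly_Mapping.lookup p 0) * ?f) = Poly_Mapping.lookup p 0"
    \<comment> \<open>Only the constant coefficient of \<open>p\<close> enters, so this prescribes
      \<open>\<Lambda>\<close> on the line spanned by \<open>?f\<close> and on
      \<open>Q\<close>.\<close>
    by (rule functional_factorization[of Q "\<lambda>p. cst (Poly_Mapping.lookup p 0) * ?f"
          "\<lambda>p. Poly_Mapping.lookup p 0", OF subspace_over_constants[OF Q(1)]])
      (simp add: lookup_add cst_add distrib_right, simp add: lookup_cst_mult cst_mult mult.assoc,
        simp add: lookup_add, simp add: lookup_cst_mult, erule ker, rule that)
  have 1: "\<Lambda> ?f = 1" using \<Lambda>(4)[of 1] by (simp add: lookup_one)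
  obtain m where m: "\<And>a. Poly_Mapping.lookup ?f a \<noteq> 0 \<Longrightarrow> tdeg a \<le> m"
    using tdeg_bound by blast
  have tr: "trunc m ?f = ?f"
    by (rule poly_mapping_eqI) (use m in \<open>auto simp: lookup_restr\<close>)
  obtain P where P: "\<And>f. pairing f P = \<Lambda> (trunc m f)" "\<And>q. q \<in> Q \<Longrightarrow> q \<bullet>\<^sub>\<partial> P = 0"
    using truncated_functional[OF Q \<Lambda>(1-3)] by blast
  have "pairing ?f P \<noteq> 0" by (simp add: P(1) tr 1)
  then have "?f \<bullet>\<^sub>\<partial> P \<noteq> 0" by (auto simp: pairing_def poly_eval_simps)
  with P(2) show thesis by (intro that) (auto simp: diff_act_mult)
qed

text \<open>Pairing cofactors with \<open>p\<close> defines a functional on the multiples of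
  \<open>monom \<mu>\<close>. It is well defined modulo \<open>Q\<close> because \<open>p\<close> is
  orthogonal to the quotient ideal.\<close>

lemma perp_quotient_dual:
  fixes Q :: "'n::{finite,linorder} mpoly set"
  assumes Q: "ring_mod.subspace Q" "graded Q" and p: "p \<in> perp (ideal_quot Q (monom \<mu>))"
  obtains P where "\<And>q. q \<in> Q \<Longrightarrow> q \<bullet>\<^sub>\<partial> P = 0" "monom \<mu> \<bullet>\<^sub>\<partial> P = p"
proof -
  have ker: "pairing f p = 0" if "f * monom \<mu> \<in> Q" for f
    using p that by (simp add: perp_def ideal_quot_def pairing_def)
  obtain \<Lambda> where \<Lambda>: "\<And>f g. \<Lambda> (f + g) = \<Lambda> f + \<Lambda> g" "\<And>c f. \<Lambda> (cst c * f) = c * \<Lambda> f"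
    "\<And>q. q \<in> Q \<Longrightarrow> \<Lambda> q = 0" "\<And>f. \<Lambda> (f * monom \<mu>) = pairing f p"
    by (rule functional_factorization[of Q "\<lambda>f. f * monom \<mu>" "\<lambda>f. pairing f p",
          OF subspace_over_constants[OF Q(1)]])
      (simp add: distrib_right, simp add: mult.assoc, rule pairing_add_left,
        rule pairing_cst_mult, erule ker, rule that)
  obtain m where m: "\<And>a. Poly_Mapping.lookup p a \<noteq> 0 \<Longrightarrow> tdeg a \<le> m"
    using tdeg_bound by blast
  \<comment> \<open>Truncating multiples of \<open>monom \<mu>\<close> at
    \<open>m + tdeg \<mu>\<close> truncates the cofactor at \<open>m\<close>, which the pairing with
    \<open>p\<close> does not see.\<close>
  obtain P where P: "\<And>f. pairing f P = \<Lambda> (trunc (m + tdeg \<mu>) f)" "\<And>q. q \<in> Q \<Longrightarrow> q \<bullet>\<^sub>\<partial> P = 0"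
    using truncated_functional[OF Q \<Lambda>(1-3)] by blast
  have trunc_mult: "trunc (m + tdeg \<mu>) (f * monom \<mu>) = trunc m f * monom \<mu>" for f
    by (induction f rule: mpoly_induct)
      (simp_all add: monom_def mult_single restr_single tdeg_add restr_add distrib_right)
  have "monom \<mu> \<bullet>\<^sub>\<partial> P = p"
    by (rule eq_if_pairing_eq) (simp add: P(1) trunc_mult \<Lambda>(4) pairing_trunc[OF m] flip: pairing_mult)
  with P(2) show thesis by (rule that)
qed


section \<open>The Weyl algebra and its modules\<close>

type_synonym 'n wexpo = "'n expo \<times> 'n expo"

definition smul :: "complex \<Rightarrow> 'n weyl_coeffs \<Rightarrow> 'n weyl_coeffs" where
  "smul s c = (\<Sum>k\<in>Poly_Mapping.keys c. Poly_Mapping.single k (s * Poly_Mapping.lookup c k))"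

definition xmul :: "'n \<Rightarrow> 'n weyl_coeffs \<Rightarrow> 'n weyl_coeffs" where
  "xmul j c = (\<Sum>k\<in>Poly_Mapping.keys c.
     Poly_Mapping.single (fst k + Poly_Mapping.single j 1, snd k) (Poly_Mapping.lookup c k))"

text \<open>The normal form of \<open>\<partial>\<^sub>j x\<^sup>a \<partial>\<^sup>b\<close> is \<open>x\<^sup>a \<partial>\<^sub>j \<partial>\<^sup>b + a\<^sub>j x\<^sup>a\<^sup>-\<^sup>e \<partial>\<^sup>b\<close> with the unit vector \<open>e\<close> of \<open>j\<close>.\<close>

definition dmul :: "'n \<Rightarrow> 'n weyl_coeffs \<Rightarrow> 'n weyl_coeffs" where
  "dmul j c = (\<Sum>k\<in>Poly_Mapping.keys c.
     Poly_Mapping.single (fst k, snd k + Poly_Mapping.single j 1) (Poly_Mapping.lookup c k)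
     + Poly_Mapping.single (fst k - Poly_Mapping.single j 1, snd k)
         (of_nat (Poly_Mapping.lookup (fst k) j) * Poly_Mapping.lookup c k))"

text \<open>The product of coefficient families. Left multiplication by \<open>p\<close> is
  assembled from \<open>xmul\<close> and \<open>dmul\<close>, which avoids a closed formula for
  normal ordering.\<close>

definition star :: "'n::{finite,linorder} weyl_coeffs \<Rightarrow> 'n weyl_coeffs \<Rightarrow> 'n weyl_coeffs" where
  "star p q = (\<Sum>k\<in>Poly_Mapping.keys p. smul (Poly_Mapping.lookup p k)
     (power_comp xmul (fst k) (power_comp dmul (snd k) q)))"

lemma smul_add: "smul s (c + d) = smul s c + smul s d"
  unfolding smul_def
  by (rule setsum_keys_plus_distrib[where f = "\<lambda>k l. Poly_Mapping.single k (s * l)"])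
    (simp_all add: distrib_left single_add)

lemma smul_add_left: "smul (s + t) c = smul s c + smul t c"
  by (simp add: smul_def distrib_right single_add sum.distrib)

lemma smul_0 [simp]: "smul 0 c = 0"
  by (simp add: smul_def)

lemma smul_single: "smul s (Poly_Mapping.single k l) = Poly_Mapping.single k (s * l)"
  by (cases "l = 0") (simp_all add: smul_def)

lemma xmul_add: "xmul j (c + d) = xmul j c + xmul j d"
  unfolding xmul_def
  by (rule setsum_keys_plus_distrib[where f = "\<lambda>k l. Poly_Mapping.single (fst k + Poly_Mapping.single j 1, snd k) l"])
    (simp_all add: single_add)

lemma xmul_single: "xmul j (Poly_Mapping.single (a, b) l)
    = Poly_Mapping.single (a + Poly_Mapping.single j 1, b) l"
  by (cases "l = 0") (simp_all add: xmul_def)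

lemma dmul_add: "dmul j (c + d) = dmul j c + dmul j d"
  unfolding dmul_def
  by (rule setsum_keys_plus_distrib[where f = "\<lambda>k l.
        Poly_Mapping.single (fst k, snd k + Poly_Mapping.single j 1) l
        + Poly_Mapping.single (fst k - Poly_Mapping.single j 1, snd k)
         (of_nat (Poly_Mapping.lookup (fst k) j) * l)"])
    (simp_all add: single_add distrib_left add_ac)

lemma dmul_single: "dmul j (Poly_Mapping.single (a, b) l)
    = Poly_Mapping.single (a, b + Poly_Mapping.single j 1) l
      + Poly_Mapping.single (a - Poly_Mapping.single j 1, b) (of_nat (Poly_Mapping.lookup a j) * l)"
  by (cases "l = 0") (simp_all add: dmul_def)

lemma star_add: "star (p + p') q = star p q + star p' q"
  unfolding star_def
  by (rule setsum_keys_plus_distrib[where f = "\<lambda>k l. smul l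
     (power_comp xmul (fst k) (power_comp dmul (snd k) q))"])
    (simp_all add: smul_add_left)

lemma star_single: "star (Poly_Mapping.single (a, b) l) q
    = smul l (power_comp xmul a (power_comp dmul b q))"
  by (cases "l = 0") (simp_all add: star_def)

text \<open>Left modules over the Weyl algebra by generators and relations. Of the instances,
  polynomials give faithfulness, rational functions carry the operators of type \<open>dop\<close>,
  and logarithmic series carry the solutions.\<close>

locale weyl_module =
  fixes sc :: "complex \<Rightarrow> 'm::ab_group_add \<Rightarrow> 'm"
    and X D :: "'n::{finite,linorder} \<Rightarrow> 'm \<Rightarrow> 'm"
  assumes sc_add: "sc c (x + y) = sc c x + sc c y"
    and sc_add_left: "sc (c + d) x = sc c x + sc d x"
    and sc_mult: "sc (c * d) x = sc c (sc d x)"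
    and sc_1: "sc 1 x = x"
    and X_add: "X j (x + y) = X j x + X j y"
    and D_add: "D j (x + y) = D j x + D j y"
    and X_sc: "X j (sc c x) = sc c (X j x)"
    and D_sc: "D j (sc c x) = sc c (D j x)"
    and X_X: "X i (X j x) = X j (X i x)"
    and D_D: "D i (D j x) = D j (D i x)"
    and D_X: "D i (X j x) = X j (D i x) + (if i = j then x else 0)"
begin

lemma sc_0_left [simp]: "sc 0 x = 0"
  using sc_add_left[of 0 0 x] by simp

lemma sc_0_right [simp]: "sc c 0 = 0"
  using sc_add[of c 0 0] by simp

lemma X_0 [simp]: "X j 0 = 0"
  using X_add[of j 0 0] by simp

lemma D_0 [simp]: "D j 0 = 0"
  using D_add[of j 0 0] by simp

lemmas X_step = power_comp_step[of X, OF X_X]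
lemmas D_step = power_comp_step[of D, OF D_D]

definition act :: "'n weyl_coeffs \<Rightarrow> 'm \<Rightarrow> 'm" where
  "act c m = (\<Sum>(a, b)\<in>Poly_Mapping.keys c.
     sc (Poly_Mapping.lookup c (a, b)) (power_comp X a (power_comp D b m)))"

lemma act_add: "act (c + d) m = act c m + act d m"
  unfolding act_def case_prod_unfold prod.collapse
  by (rule setsum_keys_plus_distrib[where f = "\<lambda>k l. sc l (power_comp X (fst k) (power_comp D (snd k) m))"])
    (simp_all add: sc_add_left)

lemma act_0 [simp]: "act 0 m = 0"
  by (simp add: act_def)

lemma act_single: "act (Poly_Mapping.single (a, b) l) m = sc l (power_comp X a (power_comp D b m))"
  by (cases "l = 0") (simp_all add: act_def)

lemma act_smul: "act (smul s c) m = sc s (act c m)"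
proof (induction c rule: mpoly_induct)
  case (single k l)
  then show ?case by (cases k) (simp add: smul_single act_single sc_mult)
qed (simp add: smul_add act_add sc_add)

lemma act_xmul: "act (xmul j c) m = X j (act c m)"
proof (induction c rule: mpoly_induct)
  case (single k l)
  then show ?case by (cases k) (simp add: xmul_single act_single X_step X_sc)
qed (simp add: xmul_add act_add X_add)

text \<open>\<open>D j\<close> is moved past one factor \<open>X i\<close> at a time. Where
  \<open>a\<close> is zero at \<open>j\<close>, the truncated subtraction is harmless because its
  coefficient vanishes.\<close>

lemma D_power_X: "D j (power_comp X a y) = power_comp X a (D j y)
    + sc (of_nat (Poly_Mapping.lookup a j)) (power_comp X (a - Poly_Mapping.single j 1) y)"
proof (induction a rule: expo_induct)
  case (step i a)
  let ?ei = "Poly_Mapping.single i (1::nat)" and ?ej = "Poly_Mapping.single j (1::nat)"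
  have "X i (sc (of_nat (Poly_Mapping.lookup a j)) (power_comp X (a - ?ej) y))
      + (if j = i then power_comp X a y else 0)
    = sc (of_nat (Poly_Mapping.lookup (a + ?ei) j)) (power_comp X (a + ?ei - ?ej) y)"
  proof (cases "Poly_Mapping.lookup a j = 0")
    case True
    then show ?thesis by (auto simp: lookup_add lookup_single sc_1)
  next
    case False
    then have "a - ?ej + ?ei = a + ?ei - ?ej" by (rule expo_minus_add)
    then have "X i (power_comp X (a - ?ej) y) = power_comp X (a + ?ei - ?ej) y"
      by (metis X_step)
    then show ?thesis
      by (auto simp: X_sc lookup_add lookup_single sc_add_left sc_1)
  qed
  then show ?case
    by (simp add: X_step D_X step X_add add.assoc)
qed simp

lemma act_dmul: "act (dmul j c) m = D j (act c m)"
proof (induction c rule: mpoly_induct)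
  case (single k l)
  then show ?case
    by (cases k) (simp add: dmul_single act_add act_single D_step D_sc D_power_X sc_add
        mult.commute[of _ l] sc_mult)
qed (simp add: dmul_add act_add D_add)

lemma act_star: "act (star p q) m = act p (act q m)"
proof (induction p rule: mpoly_induct)
  case (single k l)
  have "act (power_comp dmul b q) m = power_comp D b (act q m)" for b
    by (rule power_comp_hom) (rule act_dmul)
  moreover have "act (power_comp xmul a c) m = power_comp X a (act c m)" for a c
    by (rule power_comp_hom) (rule act_xmul)
  ultimately show ?case by (cases k) (simp add: star_single act_smul act_single)
qed (simp add: star_add act_add)

end

section \<open>Polynomials as a faithful module over the Weyl algebra\<close>

interpretation poly_weyl: weyl_module "\<lambda>c p. cst c * (p :: 'n::{finite,linorder} mpoly)"
  "\<lambda>j p. var j * p" pd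
  by unfold_locales
    (simp_all add: cst_add cst_mult pd_add pd_cst_mult pd_commute pd_mult pd_var algebra_simps)

lemma poly_power_X: "power_comp (\<lambda>j p. var j * p) a p = monom a * p"
proof (induction a rule: expo_induct)
  case (step j a)
  then show ?case by (simp only: poly_weyl.X_step) (simp add: monom_add var_def ac_simps)
qed simp

lemma poly_power_D: "power_comp pd b p = monom b \<bullet>\<^sub>\<partial> p"
  by (simp add: monom_def diff_act_single)

lemma diff_act_monom_monom:
  assumes "tdeg c \<le> tdeg b"
  shows "monom b \<bullet>\<^sub>\<partial> monom c = (if b = c then cst (expo_fact c) else 0)"
proof (rule poly_mapping_eqI)
  fix d
  have "b + d = c \<longleftrightarrow> d = 0 \<and> b = c"
    using assms by (auto simp: tdeg_add)
  then have "Poly_Mapping.lookup (monom b \<bullet>\<^sub>\<partial> monom c) d * expo_fact d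
      = (if d = 0 \<and> b = c then expo_fact c else 0)"
    by (auto simp: lookup_diff_act_monom lookup_monom)
  then show "Poly_Mapping.lookup (monom b \<bullet>\<^sub>\<partial> monom c) d
      = Poly_Mapping.lookup (if b = c then cst (expo_fact c) else 0) d"
    by (auto simp: cst_def lookup_single when_def split: if_splits)
qed

text \<open>Take a term of least order in the derivatives and test on the monomial with its
  derivative exponent. Other derivative monomials in \<open>c\<close> kill it, and terms with the
  same derivatives differ in their power of \<open>x\<close>.\<close>

lemma poly_act_faithful:
  assumes "\<And>p. poly_weyl.act c p = (0 :: 'n::{finite,linorder} mpoly)"
  shows "c = 0"
proof (rule ccontr)
  assume "c \<noteq> 0"
  then have "Poly_Mapping.keys c \<noteq> {}" by simp
  then obtain k where k: "k \<in> Poly_Mapping.keys c"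
    "\<And>l. l \<in> Poly_Mapping.keys c \<Longrightarrow> tdeg (snd k) \<le> tdeg (snd l)"
    using ex_has_least_nat[of "\<lambda>k. k \<in> Poly_Mapping.keys c" _ "\<lambda>k. tdeg (snd k)"] by blast
  obtain a b where ab: "k = (a, b)" by (cases k)
  have "Poly_Mapping.lookup (poly_weyl.act c (monom b)) a
    = (\<Sum>l\<in>Poly_Mapping.keys c. if l = k then Poly_Mapping.lookup c k * expo_fact b else 0)"
    unfolding poly_weyl.act_def lookup_sum case_prod_unfold poly_power_X poly_power_D prod.collapse
  proof (rule sum.cong)
    fix l assume l: "l \<in> Poly_Mapping.keys c"
    from k(2)[OF l] have "tdeg b \<le> tdeg (snd l)" by (simp add: ab)
    from diff_act_monom_monom[OF this]
    show "Poly_Mapping.lookup (cst (Poly_Mapping.lookup c l)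
        * (monom (fst l) * (monom (snd l) \<bullet>\<^sub>\<partial> monom b))) a
      = (if l = k then Poly_Mapping.lookup c k * expo_fact b else 0)"
      by (cases l) (auto simp: ab lookup_cst_mult mult.commute[of "monom _"] lookup_monom)
  qed simp
  also have "\<dots> = Poly_Mapping.lookup c k * expo_fact b" using k(1) by simp
  finally show False using assms k(1) by (simp add: in_keys_iff)
qed


section \<open>Differential operators with rational coefficients\<close>

lemma Fract_poly_mult: "Fract p 1 * Fract q 1 = Fract (p * q) 1"
  by simp

lemma rder_poly: "rder j (Fract p 1) = Fract (pd j p) 1"
  using pd_cst[of j 1] by (simp add: rder_Fract)

lemma rder_mult: "rder j (f * g) = rder j f * g + f * rder j g"
proof -
  obtain p q where f: "f = Fract p q" "q \<noteq> 0" by (cases f)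
  obtain r s where g: "g = Fract r s" "s \<noteq> 0" by (cases g)
  have nz: "q * s \<noteq> 0" "q * q \<noteq> 0" "s * s \<noteq> 0" "q * q * s \<noteq> 0" "q * (s * s) \<noteq> 0"
    using f(2) g(2) by auto
  have "rder j f * g + f * rder j g
      = Fract ((pd j p * q - p * pd j q) * r * (q * (s * s)) + p * (pd j r * s - r * pd j s) * (q * q * s))
          (q * q * s * (q * (s * s)))"
    unfolding f(1) g(1) rder_Fract[OF f(2)] rder_Fract[OF g(2)] mult_fract add_fract[OF nz(4,5)] ..
  also have "\<dots> = Fract (pd j (p * r) * (q * s) - p * r * pd j (q * s)) (q * s * (q * s))"
    using f(2) g(2) by (simp add: eq_fract pd_mult) (simp add: algebra_simps)
  also have "\<dots> = rder j (f * g)"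
    unfolding f(1) g(1) mult_fract rder_Fract[OF nz(1)] ..
  finally show ?thesis ..
qed

text \<open>The commutator of two derivations is a derivation; it vanishes on polynomials, hence on
  their quotients.\<close>

lemma rder_commute: "rder i (rder j f) = rder j (rder i f)"
proof -
  obtain p q where f: "f = Fract p q" "q \<noteq> 0" by (cases f)
  define E where "E g = rder i (rder j g) - rder j (rder i g)" for g
  have E_mult: "E (g * h) = E g * h + g * E h" for g h
    by (simp add: E_def rder_mult rder_add algebra_simps)
  have E_poly: "E (Fract r 1) = 0" for r
    by (simp add: E_def rder_poly pd_commute)
  have "Fract q 1 * f = Fract p 1" using f by (simp add: eq_fract)
  then have "E (Fract q 1 * f) = 0" by (simp add: E_poly)
  then have "Fract q 1 * E f = 0" by (simp add: E_mult E_poly)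
  moreover have "Fract q 1 \<noteq> 0" using f(2) by (simp add: Zero_fract_def eq_fract)
  ultimately show ?thesis by (simp add: E_def)
qed

lemma Fract_poly_eq_0 [simp]: "Fract p 1 = 0 \<longleftrightarrow> p = 0"
  by (simp add: Zero_fract_def eq_fract)

lemma Fract_1_1 [simp]: "Fract 1 1 = 1"
  by (simp add: One_fract_def)

interpretation rat_weyl: weyl_module "\<lambda>c g. Fract (cst c) 1 * (g :: 'n::{finite,linorder} ratfun)"
  "\<lambda>j g. Fract (var j) 1 * g" rder
proof unfold_locales
  fix c d :: complex and x y :: "'n ratfun" and i j :: 'n
  have "Fract (cst (c + d)) 1 = Fract (cst c) 1 + (Fract (cst d) 1 :: 'n ratfun)"
    by (simp add: cst_add)
  then show "Fract (cst (c + d)) 1 * x = Fract (cst c) 1 * x + Fract (cst d) 1 * x"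
    by (simp only: distrib_right)
  show "Fract (cst (c * d)) 1 * x = Fract (cst c) 1 * (Fract (cst d) 1 * x)"
    by (simp only: cst_mult mult.assoc [symmetric] Fract_poly_mult)
  show "rder i (Fract (var j) 1 * x) = Fract (var j) 1 * rder i x + (if i = j then x else 0)"
    by (simp add: rder_mult rder_poly pd_var)
  show "rder j (Fract (cst c) 1 * x) = Fract (cst c) 1 * rder j x"
    by (simp add: rder_mult rder_poly)
  show "rder i (rder j x) = rder j (rder i x)" by (rule rder_commute)
  show "rder j (x + y) = rder j x + rder j y" by (rule rder_add)
qed (simp_all add: distrib_left mult.left_commute del: mult_fract)

section \<open>Relations among the generating operators\<close>

lemma dop_eqI: "(\<And>g. Rep_dop S g = Rep_dop T g) \<Longrightarrow> S = T"
  by (metis Rep_dop_inject ext)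

lemma Rep_dop_rat_op: "Rep_dop (rat_op f) = (\<lambda>g. f * g)"
  by (simp add: rat_op_def Abs_dop_inverse mult_op)

lemma Rep_dop_d_op: "Rep_dop (d_op j) = rder j"
  by (simp add: d_op_def Abs_dop_inverse der_op)

lemmas Rep_dop_simps = Rep_dop_rat_op Rep_dop_d_op plus_dop.rep_eq times_dop.rep_eq
  zero_dop.rep_eq one_dop.rep_eq c_op_def x_op_def

lemma Rep_dop_sum: "Rep_dop (sum F S) g = (\<Sum>i\<in>S. Rep_dop (F i) g)"
  by (induction S rule: infinite_finite_induct) (simp_all add: Rep_dop_simps)

lemma rat_op_mult: "rat_op (f * g) = rat_op f * rat_op g"
  by (rule dop_eqI) (simp add: Rep_dop_simps mult.assoc)

lemma rat_op_1 [simp]: "rat_op 1 = 1"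
  by (rule dop_eqI) (simp add: Rep_dop_simps)

lemma rat_op_add: "rat_op (f + g) = rat_op f + rat_op g"
  by (rule dop_eqI) (simp add: Rep_dop_simps distrib_right)

lemma c_op_commute: "c_op c * T = T * (c_op c :: 'n::{finite,linorder} dop)"
proof (rule dop_eqI)
  fix g :: "'n ratfun"
  have "T \<in> diff_ops \<Longrightarrow> Fract (cst c) 1 * T g = T (Fract (cst c) 1 * g)" for T
  proof (induction arbitrary: g rule: diff_ops.induct)
    case (mult_op f)
    then show ?case by (simp only: mult.left_commute)
  next
    case (der_op j)
    then show ?case by (simp only: rat_weyl.D_sc)
  qed (simp_all add: distrib_left)
  from this[OF Rep_dop] show "Rep_dop (c_op c * T) g = Rep_dop (T * c_op c) g"
    by (simp add: Rep_dop_simps)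
qed

lemma c_op_add: "c_op (c + d) = c_op c + c_op d"
  by (rule dop_eqI) (simp only: Rep_dop_simps rat_weyl.sc_add_left)

lemma c_op_mult: "c_op (c * d) = c_op c * c_op d"
  by (rule dop_eqI) (simp only: Rep_dop_simps rat_weyl.sc_mult)

lemma c_op_1 [simp]: "c_op 1 = 1"
  by (rule dop_eqI) (simp add: Rep_dop_simps)

lemma c_op_0 [simp]: "c_op 0 = 0"
  by (rule dop_eqI) (simp add: Rep_dop_simps flip: Zero_fract_def)

lemma x_op_commute: "x_op i * x_op j = x_op j * (x_op i :: 'n::{finite,linorder} dop)"
  by (rule dop_eqI) (simp only: Rep_dop_simps rat_weyl.X_X)

lemma d_op_commute: "d_op i * d_op j = d_op j * (d_op i :: 'n::{finite,linorder} dop)"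
  by (rule dop_eqI) (simp only: Rep_dop_simps rat_weyl.D_D)

lemma d_op_x_op: "d_op i * x_op j = x_op j * d_op i + (if i = j then 1 else 0 :: 'n::{finite,linorder} dop)"
  by (rule dop_eqI) (simp only: Rep_dop_simps rat_weyl.D_X split: if_split, simp)

lemma commuting_subst_x: "commuting_subst c_op (x_op :: 'n::{finite,linorder} \<Rightarrow> _)"
  by unfold_locales
    (rule c_op_add c_op_mult c_op_1 c_op_commute x_op_commute)+

lemma commuting_subst_d: "commuting_subst c_op (d_op :: 'n::{finite,linorder} \<Rightarrow> _)"
  by unfold_locales
    (rule c_op_add c_op_mult c_op_1 c_op_commute d_op_commute)+

lemma theta_op_commute: "theta_op i * theta_op j = theta_op j * (theta_op i :: 'n::{finite,linorder} dop)"
proof (cases "i = j")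
  case False
  then have d: "d_op i * x_op j = x_op j * d_op i" "d_op j * x_op i = x_op i * d_op j"
    by (simp_all add: d_op_x_op)
  have "theta_op i * theta_op j = x_op i * (d_op i * x_op j) * d_op j"
    by (simp add: theta_op_def mult.assoc)
  also have "\<dots> = (x_op i * x_op j) * (d_op i * d_op j)"
    unfolding d by (simp add: mult.assoc)
  also have "\<dots> = x_op j * (x_op i * d_op j) * d_op i"
    unfolding x_op_commute[of i j] d_op_commute[of i j] by (simp add: mult.assoc)
  also have "\<dots> = theta_op j * theta_op i"
    unfolding d(2) [symmetric] by (simp add: theta_op_def mult.assoc)
  finally show ?thesis .
qed simp

lemma commuting_subst_theta: "commuting_subst c_op (theta_op :: 'n::{finite,linorder} \<Rightarrow> _)"
  by unfold_locales
    (rule c_op_add c_op_mult c_op_1 c_op_commute theta_op_commute)+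

lemmas theta_poly_simps =
  commuting_subst.subst_add[OF commuting_subst_theta, folded theta_poly_def]
  commuting_subst.subst_mult[OF commuting_subst_theta, folded theta_poly_def]
  commuting_subst.subst_diff[OF commuting_subst_theta, folded theta_poly_def]
  commuting_subst.subst_sum[OF commuting_subst_theta, folded theta_poly_def]
  commuting_subst.subst_var[OF commuting_subst_theta, folded theta_poly_def]
  commuting_subst.subst_cst[OF commuting_subst_theta, folded theta_poly_def]
  commuting_subst.subst_0[OF commuting_subst_theta, folded theta_poly_def]
  commuting_subst.subst_1[OF commuting_subst_theta, folded theta_poly_def]

lemmas partial_poly_simps =
  commuting_subst.subst_add[OF commuting_subst_d, folded partial_poly_def]
  commuting_subst.subst_mult[OF commuting_subst_d, folded partial_poly_def]
  commuting_subst.subst_diff[OF commuting_subst_d, folded partial_poly_def]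
  commuting_subst.subst_monom[OF commuting_subst_d, folded partial_poly_def]
  commuting_subst.subst_var[OF commuting_subst_d, folded partial_poly_def]
  commuting_subst.subst_cst[OF commuting_subst_d, folded partial_poly_def]
  commuting_subst.subst_0[OF commuting_subst_d, folded partial_poly_def]

lemma Rep_dop_power_prod:
  assumes "\<And>i j. f i * f j = f j * f i"
  shows "Rep_dop (power_prod f a) g = power_comp (\<lambda>j. Rep_dop (f j)) a g"
proof -
  have "power_prod f a = power_comp (\<lambda>j x. f j * x) a 1"
    using power_prod_power_comp[of f a 1] assms by simp
  then have "Rep_dop (power_prod f a) g = power_comp (\<lambda>j. Rep_dop (f j)) a (Rep_dop 1 g)"
    by (simp only:, intro power_comp_hom[of "\<lambda>T. Rep_dop T g"]) (simp add: Rep_dop_simps)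
  then show ?thesis by (simp add: Rep_dop_simps)
qed

lemma Rep_dop_weyl_op: "Rep_dop (weyl_op c) g = rat_weyl.act c g"
  unfolding weyl_op_def rat_weyl.act_def case_prod_unfold
  by (simp add: Rep_dop_sum times_dop.rep_eq Rep_dop_power_prod[OF x_op_commute]
      Rep_dop_power_prod[OF d_op_commute] c_op_def x_op_def Rep_dop_rat_op Rep_dop_d_op)

text \<open>Polynomials form a submodule of the rational functions, so an operator that is zero on
  the latter is zero on the former.\<close>

lemma rat_act_poly: "rat_weyl.act c (Fract p 1) = Fract (poly_weyl.act c p) 1"
proof (induction c rule: mpoly_induct)
  case (single k l)
  have "Fract (power_comp pd b p) 1 = power_comp rder b (Fract p 1)" for b
    by (rule power_comp_hom) (simp add: rder_poly)
  moreover have "Fract (power_comp (\<lambda>j p. var j * p) a p) 1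
      = power_comp (\<lambda>j g. Fract (var j) 1 * g) a (Fract p 1)" for a and p :: "'a mpoly"
    by (rule power_comp_hom) simp
  ultimately show ?case
    by (cases k) (simp add: rat_weyl.act_single poly_weyl.act_single flip: Fract_poly_mult)
qed (simp add: rat_weyl.act_add poly_weyl.act_add)

lemma weyl_op_add: "weyl_op (c + d) = weyl_op c + weyl_op d"
  by (rule dop_eqI) (simp add: Rep_dop_weyl_op plus_dop.rep_eq rat_weyl.act_add)

lemma weyl_op_star: "weyl_op (star c d) = weyl_op c * weyl_op d"
  by (rule dop_eqI) (simp add: Rep_dop_weyl_op times_dop.rep_eq rat_weyl.act_star)

lemma weyl_op_0 [simp]: "weyl_op 0 = 0"
  by (simp add: weyl_op_def)

lemma weyl_op_single: "weyl_op (Poly_Mapping.single (a, b) l)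
    = c_op l * power_prod x_op a * power_prod d_op b"
  by (cases "l = 0") (simp_all add: weyl_op_def)

text \<open>Uniqueness of normally ordered expressions, from faithfulness on polynomials.\<close>

lemma weyl_op_inj: "inj weyl_op"
proof (rule injI)
  fix c d :: "'a weyl_coeffs" assume "weyl_op c = weyl_op d"
  then have "weyl_op (c - d) = 0"
    using weyl_op_add[of "c - d" d] by simp
  then have "Fract (poly_weyl.act (c - d) p) 1 = 0" for p
    by (metis Rep_dop_weyl_op rat_act_poly zero_dop.rep_eq)
  then have "c - d = 0"
    by (intro poly_act_faithful) simp
  then show "c = d" by simp
qed


section \<open>Logarithmic series as a module over the Weyl algebra\<close>

definition cvec :: "'n expo \<Rightarrow> complex^'n" where
  "cvec a = (\<chi> j. of_nat (Poly_Mapping.lookup a j))"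

lemma cvec_nth [simp]: "cvec a $ j = of_nat (Poly_Mapping.lookup a j)"
  by (simp add: cvec_def)

lemma cvec_0 [simp]: "cvec 0 = 0"
  by (simp add: vec_eq_iff)

lemma cvec_add: "cvec (a + b) = cvec a + cvec b"
  by (simp add: vec_eq_iff lookup_add)

lemma cvec_single: "cvec (Poly_Mapping.single j 1) = axis j 1"
  by (simp add: vec_eq_iff axis_def lookup_single when_def)

lemma cvec_inj: "cvec a = cvec b \<longleftrightarrow> a = b"
  by (auto simp: vec_eq_iff intro: poly_mapping_eqI)

lemma sum_fun_apply: "(\<Sum>i\<in>S. F i) v = (\<Sum>i\<in>S. F i v)"
  by (induction S rule: infinite_finite_induct) simp_all

definition lsingle :: "complex^'n::{finite,linorder} \<Rightarrow> 'n mpoly \<Rightarrow> 'n::{finite,linorder} log_series" where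
  "lsingle v r = (\<lambda>z. if z = v then r else 0)"

lemma d_act_eq: "d_act j F v = (var j + cst (v $ j + 1)) \<bullet>\<^sub>\<partial> F (v + axis j 1)"
  by (simp add: d_act_def Let_def diff_act_add_left diff_act_var diff_act_cst_left axis_def add.commute)

interpretation log_weyl: weyl_module "\<lambda>c (F :: 'n::{finite,linorder} log_series) v. cst c * F v" x_act d_act
proof unfold_locales
  fix c :: complex and F G :: "'n log_series" and i j :: 'n
  show "d_act j (F + G) = d_act j F + d_act j G"
    by (simp add: fun_eq_iff d_act_eq diff_act_add_right)
  show "d_act j (\<lambda>v. cst c * F v) = (\<lambda>v. cst c * d_act j F v)"
    by (simp add: fun_eq_iff d_act_eq mult.commute flip: diff_act_cst_left diff_act_mult)
  show "d_act i (d_act j F) = d_act j (d_act i F)"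
  proof
    fix v
    show "d_act i (d_act j F) v = d_act j (d_act i F) v"
      by (cases "i = j")
        (simp_all add: d_act_eq axis_def add_ac mult.commute flip: diff_act_mult)
  qed
  show "d_act i (x_act j F) = x_act j (d_act i F) + (if i = j then F else 0)"
  proof
    fix v
    show "d_act i (x_act j F) v = (x_act j (d_act i F) + (if i = j then F else 0)) v"
      by (cases "i = j")
        (simp_all add: d_act_eq x_act_def axis_def add_diff_eq diff_add_eq cst_add
          diff_act_add_left algebra_simps)
  qed
qed (simp_all add: fun_eq_iff x_act_def cst_add cst_mult algebra_simps)

lemma weyl_act_eq: "weyl_act c F = log_weyl.act c F"
  by (simp add: fun_eq_iff weyl_act_def log_weyl.act_def case_prod_unfold sum_fun_apply)

lemma x_act_apply: "x_act j F v = F (v - axis j 1)"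
  by (simp add: x_act_def)

lemma power_x_act: "power_comp x_act a F v = F (v - cvec a)"
proof (induction a arbitrary: v rule: expo_induct)
  case (step j a)
  have "power_comp x_act (a + Poly_Mapping.single j 1) F v = power_comp x_act a F (v - axis j 1)"
    unfolding log_weyl.X_step by (rule x_act_apply)
  then show ?case by (simp only: step) (simp add: cvec_add cvec_single algebra_simps)
qed simp

text \<open>\<open>\<partial>\<^sup>a\<close> takes the coefficient at \<open>z + a\<close> to the coefficient at \<open>z\<close> by applying \<open>fall z a\<close>.\<close>

definition fall :: "complex^'n::{finite,linorder} \<Rightarrow> 'n expo \<Rightarrow> 'n::{finite,linorder} mpoly" where
  "fall z a = (\<Prod>j\<in>UNIV. \<Prod>k<Poly_Mapping.lookup a j. var j + cst (z $ j + of_nat k + 1))"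

lemma fall_step: "fall z (a + Poly_Mapping.single j 1)
    = fall z a * (var j + cst (z $ j + of_nat (Poly_Mapping.lookup a j) + 1))"
proof -
  let ?p = "\<lambda>i k. var i + cst (z $ i + of_nat k + 1)"
  have "fall z (a + Poly_Mapping.single j 1)
    = (\<Prod>i\<in>UNIV. (\<Prod>k<Poly_Mapping.lookup a i. ?p i k)
        * (if i = j then ?p j (Poly_Mapping.lookup a j) else 1))"
    unfolding fall_def
    by (intro prod.cong) (auto simp: lookup_add lookup_single when_def One_nat_def)
  then show ?thesis by (simp add: prod.distrib fall_def)
qed

lemma power_d_act: "power_comp d_act a F v = fall v a \<bullet>\<^sub>\<partial> F (v + cvec a)"
proof (induction a arbitrary: F rule: expo_induct)
  case zero
  show ?case by (simp add: fall_def)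
next
  case (step j a)
  \<comment> \<open>The new derivative is applied first, to match the induction hypothesis, which
    holds for every series.\<close>
  have "power_comp d_act (a + Poly_Mapping.single j 1) F = power_comp d_act a (d_act j F)"
    by (simp only: power_comp_add[of d_act, OF log_weyl.D_D] power_comp_single[of d_act, OF log_weyl.D_D])
  then have "power_comp d_act (a + Poly_Mapping.single j 1) F v
      = fall v a \<bullet>\<^sub>\<partial> d_act j F (v + cvec a)"
    by (simp only: step)
  also have "d_act j F (v + cvec a) = (var j + cst (v $ j + of_nat (Poly_Mapping.lookup a j) + 1))
      \<bullet>\<^sub>\<partial> F (v + cvec a + axis j 1)"
    using d_act_eq[of j F "v + cvec a"] by simp
  finally show ?case
    by (simp add: fall_step cvec_add cvec_single add.assoc diff_act_mult)
qed

lemma weyl_act_single: "weyl_act (Poly_Mapping.single (a, b) l) F v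
    = cst l * (fall (v - cvec a) b \<bullet>\<^sub>\<partial> F (v - cvec a + cvec b))"
  by (simp add: weyl_act_eq log_weyl.act_single power_x_act power_d_act)

text \<open>Polynomials are the logarithmic series without logarithms and with exponents in \<open>\<nat>\<^sup>n\<close>.\<close>

definition poly_series :: "'n::{finite,linorder} mpoly \<Rightarrow> 'n log_series" where
  "poly_series p = (\<Sum>a\<in>Poly_Mapping.keys p. lsingle (cvec a) (cst (Poly_Mapping.lookup p a)))"

lemma lsingle_add: "lsingle v (r + s) = lsingle v r + lsingle v s"
  by (simp add: lsingle_def fun_eq_iff)

lemma lsingle_0 [simp]: "lsingle v 0 = 0"
  by (simp add: lsingle_def fun_eq_iff)

lemma poly_series_add: "poly_series (p + q) = poly_series p + poly_series q"
  unfolding poly_series_def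
  by (rule setsum_keys_plus_distrib[where f = "\<lambda>a l. lsingle (cvec a) (cst l)"])
    (simp_all add: cst_add lsingle_add)

lemma poly_series_single: "poly_series (Poly_Mapping.single a l) = lsingle (cvec a) (cst l)"
  by (cases "l = 0") (simp_all add: poly_series_def)

lemma poly_series_cvec: "poly_series p (cvec a) = cst (Poly_Mapping.lookup p a)"
proof (induction p rule: mpoly_induct)
  case (single b l)
  then show ?case by (auto simp: poly_series_single lsingle_def cvec_inj lookup_single when_def)
qed (simp add: poly_series_add lookup_add cst_add)

lemma x_act_lsingle: "x_act j (lsingle v r) = lsingle (v + axis j 1) r"
  by (auto simp: x_act_def lsingle_def fun_eq_iff algebra_simps)

lemma d_act_lsingle: "d_act j (lsingle v r) = lsingle (v - axis j 1) (cst (v $ j) * r + pd j r)"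
proof
  fix z
  have "z + axis j 1 = v \<longleftrightarrow> z = v - axis j 1" by (auto simp: algebra_simps)
  then show "d_act j (lsingle v r) z = lsingle (v - axis j 1) (cst (v $ j) * r + pd j r) z"
    by (auto simp: d_act_def lsingle_def Let_def)
qed

text \<open>The embedding commutes with each multiplication and each derivation, hence with the
  whole Weyl algebra.\<close>

lemma poly_series_act: "weyl_act c (poly_series p) = poly_series (poly_weyl.act c p)"
proof -
  have x: "poly_series (var j * p) = x_act j (poly_series p)" for j and p :: "'a mpoly"
  proof (induction p rule: mpoly_induct)
    case (single a l)
    then show ?case
      by (simp add: var_def monom_def mult_single poly_series_single x_act_lsingle cvec_add
          cvec_single add.commute)
  qed (simp only: distrib_left poly_series_add log_weyl.X_add)
  have d: "poly_series (pd j p) = d_act j (poly_series p)" for j and p :: "'a mpoly"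
  proof (induction p rule: mpoly_induct)
    case (single a l)
    show ?case
    proof (cases "Poly_Mapping.lookup a j = 0")
      case True
      then show ?thesis
        by (simp add: pd_single poly_series_single d_act_lsingle poly_series_def[of 0] fun_eq_iff)
    next
      case False
      then have "a = (a - Poly_Mapping.single j 1) + Poly_Mapping.single j 1"
        by (intro poly_mapping_eqI) (auto simp: lookup_add lookup_minus lookup_single when_def)
      then have "cvec a - axis j 1 = cvec (a - Poly_Mapping.single j 1)"
        by (metis cvec_add cvec_single add_diff_cancel_right')
      then show ?thesis
        by (simp add: pd_single poly_series_single d_act_lsingle cst_mult)
    qed
  qed (simp only: pd_add poly_series_add log_weyl.D_add)
  have sc: "poly_series (cst l * p) = (\<lambda>v. cst l * poly_series p v)" for l and p :: "'a mpoly"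
  proof (induction p rule: mpoly_induct)
    case (single a l')
    then show ?case
      by (simp add: cst_def[of l] mult_single poly_series_single)
        (simp add: fun_eq_iff lsingle_def cst_def mult_single)
  qed (simp add: distrib_left poly_series_add fun_eq_iff)
  show ?thesis
    unfolding weyl_act_eq
  proof (induction c rule: mpoly_induct)
    case (single k l)
    have "poly_series (power_comp (\<lambda>j p. var j * p) a q) = power_comp x_act a (poly_series q)" for a and q :: "'a mpoly"
      by (rule power_comp_hom) (rule x)
    moreover have "poly_series (power_comp pd a q) = power_comp d_act a (poly_series q)" for a and q :: "'a mpoly"
      by (rule power_comp_hom) (rule d)
    ultimately show ?case
      by (cases k) (simp add: log_weyl.act_single poly_weyl.act_single sc)
  qed (simp add: log_weyl.act_add poly_weyl.act_add poly_series_add)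
qed

text \<open>The embedded polynomials already tell operators apart.\<close>

lemma weyl_act_faithful:
  assumes "\<And>F. weyl_act c F = weyl_act d F"
  shows "c = d"
proof -
  have "poly_weyl.act c p = poly_weyl.act d p" for p
  proof (rule poly_mapping_eqI)
    fix a
    have "poly_series (poly_weyl.act c p) (cvec a) = poly_series (poly_weyl.act d p) (cvec a)"
      using assms by (simp flip: poly_series_act)
    then show "Poly_Mapping.lookup (poly_weyl.act c p) a = Poly_Mapping.lookup (poly_weyl.act d p) a"
      by (simp add: poly_series_cvec cst_inj)
  qed
  moreover have "poly_weyl.act (c - d) p + poly_weyl.act d p = poly_weyl.act c p" for p
    by (simp flip: poly_weyl.act_add)
  ultimately have "poly_weyl.act (c - d) p = 0" for p
    by (metis add_cancel_left_left)
  then have "c - d = 0" by (rule poly_act_faithful)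
  then show ?thesis by simp
qed

text \<open>Well defined on \<open>weyl\<close> because coefficients are unique; outside
  \<open>weyl\<close> the value of \<open>inv\<close> is arbitrary.\<close>

definition dact :: "'n::{finite,linorder} dop \<Rightarrow> 'n log_series \<Rightarrow> 'n log_series" where
  "dact T F = weyl_act (inv weyl_op T) F"

lemma dact_weyl_op [simp]: "dact (weyl_op c) F = weyl_act c F"
  by (simp add: dact_def inv_f_f weyl_op_inj)

lemma weyl_cases:
  assumes "T \<in> weyl"
  obtains c where "T = weyl_op c"
  using assms by (auto simp: weyl_def)

lemma weyl_op_weyl [simp]: "weyl_op c \<in> weyl"
  by (simp add: weyl_def)

lemma weyl_mult: "S \<in> weyl \<Longrightarrow> T \<in> weyl \<Longrightarrow> S * T \<in> weyl"
  by (metis weyl_cases weyl_op_star weyl_op_weyl)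

lemma weyl_add: "S \<in> weyl \<Longrightarrow> T \<in> weyl \<Longrightarrow> S + T \<in> weyl"
  by (metis weyl_cases weyl_op_add weyl_op_weyl)

lemma weyl_0 [simp]: "0 \<in> weyl"
  using weyl_op_weyl[of 0] by simp

lemma weyl_sum: "(\<And>i. i \<in> S \<Longrightarrow> F i \<in> weyl) \<Longrightarrow> sum F S \<in> weyl"
  by (induction S rule: infinite_finite_induct) (simp_all add: weyl_add)

lemma dact_mult: "S \<in> weyl \<Longrightarrow> T \<in> weyl \<Longrightarrow> dact (S * T) F = dact S (dact T F)"
  by (elim weyl_cases) (simp add: weyl_act_eq log_weyl.act_star flip: weyl_op_star)

lemma dact_add: "S \<in> weyl \<Longrightarrow> T \<in> weyl \<Longrightarrow> dact (S + T) F = dact S F + dact T F"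
  by (elim weyl_cases) (simp add: weyl_act_eq log_weyl.act_add flip: weyl_op_add)

lemma dact_0 [simp]: "dact 0 F = 0"
  using dact_weyl_op[of 0 F] by (simp add: weyl_act_eq)

lemma dact_sum: "(\<And>i. i \<in> S \<Longrightarrow> G i \<in> weyl) \<Longrightarrow> dact (sum G S) F = (\<Sum>i\<in>S. dact (G i) F)"
  by (induction S rule: infinite_finite_induct) (simp_all add: dact_add weyl_sum)

lemma dact_0_right [simp]: "T \<in> weyl \<Longrightarrow> dact T 0 = 0"
  by (elim weyl_cases) (simp add: weyl_act_eq log_weyl.act_def case_prod_unfold power_x_act
      power_d_act fun_eq_iff sum_fun_apply)

text \<open>Operator identities are checked below on logarithmic series, where powers of
  \<open>x\<close> shift exponents and polynomials in theta act on each coefficient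
  separately.\<close>

lemma dact_faithful:
  assumes "S \<in> weyl" "T \<in> weyl" "\<And>F v. dact S F v = dact T F v"
  shows "S = T"
proof -
  obtain c d where cd: "S = weyl_op c" "T = weyl_op d"
    using assms by (elim weyl_cases)
  have "weyl_act c F = weyl_act d F" for F
    using assms(3)[of F] by (simp add: cd fun_eq_iff)
  then show ?thesis using weyl_act_faithful cd by blast
qed

lemma c_op_weyl_op: "c_op l = weyl_op (Poly_Mapping.single (0, 0) l)"
  by (simp add: weyl_op_single commuting_subst.power_prod_0[OF commuting_subst_x]
      commuting_subst.power_prod_0[OF commuting_subst_d])

lemma x_monom_weyl_op: "power_prod x_op a = weyl_op (Poly_Mapping.single (a, 0) 1)"
  by (simp add: weyl_op_single commuting_subst.power_prod_0[OF commuting_subst_d])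

lemma d_monom_weyl_op: "power_prod d_op a = weyl_op (Poly_Mapping.single (0, a) 1)"
  by (simp add: weyl_op_single commuting_subst.power_prod_0[OF commuting_subst_x])

lemma x_op_monom: "x_op j = power_prod x_op (Poly_Mapping.single j 1)"
  using commuting_subst.power_prod_step[OF commuting_subst_x, of 0 j]
  by (simp add: commuting_subst.power_prod_0[OF commuting_subst_x])

lemma d_op_monom: "d_op j = power_prod d_op (Poly_Mapping.single j 1)"
  using commuting_subst.power_prod_step[OF commuting_subst_d, of 0 j]
  by (simp add: commuting_subst.power_prod_0[OF commuting_subst_d])

lemma dact_c_op: "dact (c_op l) F v = cst l * F v"
  by (simp add: c_op_weyl_op weyl_act_single fall_def)

lemma dact_x_monom: "dact (power_prod x_op a) F v = F (v - cvec a)"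
  by (simp add: x_monom_weyl_op weyl_act_single fall_def)

lemma dact_d_monom: "dact (power_prod d_op a) F v = fall v a \<bullet>\<^sub>\<partial> F (v + cvec a)"
  by (simp add: d_monom_weyl_op weyl_act_single)

lemma weyl_generators [simp]:
  "c_op l \<in> weyl" "x_op j \<in> weyl" "d_op j \<in> weyl" "1 \<in> weyl"
  "power_prod x_op a \<in> weyl" "power_prod d_op a \<in> weyl" "theta_op j \<in> weyl"
proof -
  show c: "c_op l \<in> weyl" and x: "x_op j \<in> weyl" and d: "d_op j \<in> weyl"
    and "power_prod x_op a \<in> weyl" "power_prod d_op a \<in> weyl" for l
    by (simp_all add: c_op_weyl_op x_op_monom d_op_monom x_monom_weyl_op d_monom_weyl_op)
  show "1 \<in> weyl" using c[of 1] by simp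
  show "theta_op j \<in> weyl" using x d by (simp add: theta_op_def weyl_mult)
qed

lemma theta_poly_weyl [simp]: "theta_poly f \<in> weyl"
  by (induction f rule: mpoly_var_induct) (simp_all add: theta_poly_simps weyl_mult weyl_add)

lemma partial_poly_weyl [simp]: "partial_poly f \<in> weyl"
  by (induction f rule: mpoly_var_induct) (simp_all add: partial_poly_simps weyl_mult weyl_add)

lemma dact_theta_op: "dact (theta_op j) F v = (var j + cst (v $ j)) \<bullet>\<^sub>\<partial> F v"
proof -
  have "cst (v $ j - 1 + 1) = cst (v $ j)" by simp
  moreover have "fall (v - axis j 1) (Poly_Mapping.single j 1) = var j + cst (v $ j)"
    using fall_step[of "v - axis j 1" 0 j] by (simp add: fall_def axis_def)
  ultimately show ?thesis
    by (simp add: theta_op_def dact_mult x_op_monom d_op_monom dact_x_monom dact_d_monom cvec_single)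
qed

text \<open>On the coefficient at \<open>v\<close>, each theta acts as the derivative in its
  \<open>y\<close> variable plus the exponent; this is where the translation of \<open>v\<close> to
  the origin comes from.\<close>

lemma dact_theta_poly: "dact (theta_poly f) F v = translate v f \<bullet>\<^sub>\<partial> F v"
proof (induction f rule: mpoly_var_induct)
  case (cst c)
  then show ?case by (simp add: theta_poly_simps translate_simps dact_c_op diff_act_cst_left)
next
  case (var j p)
  then show ?case
    by (simp add: theta_poly_simps translate_simps dact_mult dact_theta_op diff_act_mult)
next
  case (add p q)
  then show ?case by (simp add: theta_poly_simps translate_simps dact_add diff_act_add_left)
qed


section \<open>The hypergeometric ideal\<close>

lemma left_ideal_gen: "1 \<in> S \<Longrightarrow> g \<in> G \<Longrightarrow> g \<in> left_ideal S G"
  unfolding left_ideal_def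
  by (rule CollectI, rule exI[of _ "{g}"], rule exI[of _ "\<lambda>_. 1"]) simp

lemma left_ideal_0: "0 \<in> left_ideal S G"
  unfolding left_ideal_def by (rule CollectI, rule exI[of _ "{}"]) simp

lemma left_ideal_add:
  assumes S: "0 \<in> S" "\<And>a b. a \<in> S \<Longrightarrow> b \<in> S \<Longrightarrow> a + b \<in> S"
    and "x \<in> left_ideal S G" "y \<in> left_ideal S G"
  shows "x + y \<in> left_ideal S G"
proof -
  obtain s a where x: "x = (\<Sum>g\<in>s. a g * g)" "finite s" "s \<subseteq> G" "\<forall>g\<in>s. a g \<in> S"
    using assms(3) by (auto simp: left_ideal_def)
  obtain t b where y: "y = (\<Sum>g\<in>t. b g * g)" "finite t" "t \<subseteq> G" "\<forall>g\<in>t. b g \<in> S"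
    using assms(4) by (auto simp: left_ideal_def)
  \<comment> \<open>Each coefficient function is extended by zero, so that both sums run over the
    union.\<close>
  let ?c = "\<lambda>g. (if g \<in> s then a g else 0) + (if g \<in> t then b g else 0)"
  have "x = (\<Sum>g\<in>s \<union> t. (if g \<in> s then a g else 0) * g)"
    unfolding x(1) using x(2) y(2) by (intro sum.mono_neutral_cong_left) auto
  moreover have "y = (\<Sum>g\<in>s \<union> t. (if g \<in> t then b g else 0) * g)"
    unfolding y(1) using x(2) y(2) by (intro sum.mono_neutral_cong_left) auto
  ultimately have "x + y = (\<Sum>g\<in>s \<union> t. ?c g * g)"
    by (simp only: distrib_right sum.distrib)
  moreover have "\<forall>g\<in>s \<union> t. ?c g \<in> S" using S x(4) y(4) by auto
  ultimately show ?thesis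
    unfolding left_ideal_def using x(2,3) y(2,3)
    by (intro CollectI exI[of _ "s \<union> t"] exI[of _ ?c]) auto
qed

lemma left_ideal_mult:
  assumes "\<And>b. b \<in> S \<Longrightarrow> a * b \<in> S" "x \<in> left_ideal S G"
  shows "a * x \<in> left_ideal S G"
proof -
  obtain s b where x: "x = (\<Sum>g\<in>s. b g * g)" "finite s" "s \<subseteq> G" "\<forall>g\<in>s. b g \<in> S"
    using assms(2) by (auto simp: left_ideal_def)
  have "a * x = (\<Sum>g\<in>s. (a * b g) * g)" by (simp add: x(1) sum_distrib_left mult.assoc)
  then show ?thesis
    unfolding left_ideal_def using x(2-4) assms(1)
    by (intro CollectI exI[of _ s] exI[of _ "\<lambda>g. a * b g"]) auto
qed

lemma left_ideal_induct [consumes 1, case_names zero gen add]: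
  assumes "x \<in> left_ideal S G" "P 0" "\<And>a g. a \<in> S \<Longrightarrow> g \<in> G \<Longrightarrow> P (a * g)"
    "\<And>x y. P x \<Longrightarrow> P y \<Longrightarrow> P (x + y)"
  shows "P x"
proof -
  obtain s b where x: "x = (\<Sum>g\<in>s. b g * g)" "finite s" "s \<subseteq> G" "\<forall>g\<in>s. b g \<in> S"
    using assms(1) by (auto simp: left_ideal_def)
  show ?thesis unfolding x(1) using x(2-4)
    by (induction s rule: finite_induct) (auto intro: assms)
qed

section \<open>Membership in the hypergeometric ideal\<close>

lemma H_ideal_add: "S \<in> H_ideal A \<beta> \<Longrightarrow> T \<in> H_ideal A \<beta> \<Longrightarrow> S + T \<in> H_ideal A \<beta>"
  unfolding H_ideal_def by (rule left_ideal_add) (auto intro: weyl_add)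

lemma H_ideal_mult: "W \<in> weyl \<Longrightarrow> T \<in> H_ideal A \<beta> \<Longrightarrow> W * T \<in> H_ideal A \<beta>"
  unfolding H_ideal_def by (rule left_ideal_mult) (auto intro: weyl_mult)

lemma H_ideal_0: "0 \<in> H_ideal A \<beta>"
  unfolding H_ideal_def by (rule left_ideal_0)

lemma H_ideal_binomial:
  assumes "A *v expo_vec a = A *v expo_vec b"
  shows "power_prod d_op a - power_prod d_op b \<in> H_ideal A \<beta>"
proof -
  have "monom a - monom b \<in> toric_ideal A"
    unfolding toric_ideal_def using assms by (intro ideal_gen) blast
  then have "partial_poly (monom a - monom b) \<in> H_ideal A \<beta>"
    unfolding H_ideal_def by (intro left_ideal_gen UnI1 imageI weyl_generators)
  then show ?thesis by (simp add: partial_poly_simps)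
qed

lemma H_ideal_euler: "euler_op A \<beta> i \<in> H_ideal A \<beta>"
  unfolding H_ideal_def by (intro left_ideal_gen UnI2 rangeI weyl_generators)

lemma c_op_uminus: "c_op (- c) = - c_op c"
  using c_op_add[of c "- c"] by (simp add: eq_neg_iff_add_eq_0 add.commute)

lemma c_op_of_int: "c_op (of_int k) = of_int k"
proof -
  have "c_op (of_nat m) = of_nat m" for m
    by (induction m) (simp_all add: c_op_add)
  then show ?thesis by (cases k) (simp_all add: c_op_uminus flip: of_nat_Suc del: of_nat_Suc)
qed

lemma euler_op_theta_poly: "euler_op A \<beta> i = theta_poly (linear_form A i - cst (\<beta> $ i))"
  by (simp add: euler_op_def linear_form_def theta_poly_simps c_op_of_int flip: cst_of_int)

lemma translate_linear_form: "translate v (linear_form A i)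
    = linear_form A i + cst (\<Sum>j\<in>UNIV. of_int (A $ i $ j) * v $ j)"
proof -
  have sum: "cst (\<Sum>j\<in>S. f j) = (\<Sum>j\<in>S. cst (f j) :: 'a mpoly)" for f and S :: "'a set"
    by (induction S rule: infinite_finite_induct) (simp_all add: cst_add)
  show ?thesis
    by (simp add: linear_form_def translate_simps sum cst_mult distrib_left sum.distrib
        flip: cst_of_int)
qed

text \<open>By linearity and composition, annihilation passes from the binomials to the toric ideal
  and from the generators to the left ideal.\<close>

lemma annihilated_by_H_idealI:
  fixes A :: "int^'n::{finite,linorder}^'d"
  assumes toric: "\<And>a b. A *v expo_vec a = A *v expo_vec b \<Longrightarrow>
      dact (power_prod d_op a) F = dact (power_prod d_op b) F"
    and euler: "\<And>i. dact (euler_op A \<beta> i) F = 0"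
  shows "annihilated_by (H_ideal A \<beta>) F"
proof -
  have part: "dact (partial_poly f) F = 0" if "f \<in> toric_ideal A" for f
  proof -
    have "toric_ideal A \<subseteq> {f. dact (partial_poly f) F = 0}"
      unfolding toric_ideal_def
    proof (rule ideal_minimal)
      have "dact (partial_poly (monom a - monom b)) F = 0"
        if ab: "A *v expo_vec a = A *v expo_vec b" for a b
      proof -
        have "partial_poly (monom a - monom b) + power_prod d_op b = power_prod d_op a"
          by (simp add: partial_poly_simps)
        then have "dact (partial_poly (monom a - monom b)) F + dact (power_prod d_op b) F
            = dact (power_prod d_op a) F"
          by (metis dact_add partial_poly_weyl weyl_generators(6))
        then show ?thesis using toric[OF ab] by simp
      qed
      then show "{monom u - monom v |u v. A *v expo_vec u = A *v expo_vec v}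
          \<subseteq> {f. dact (partial_poly f) F = 0}"
        by blast
      show "ring_mod.subspace {f. dact (partial_poly f) F = 0}"
        by (rule ring_mod.subspaceI) (simp_all add: partial_poly_simps dact_add dact_mult)
    qed
    then show ?thesis using that by blast
  qed
  have "T \<in> weyl \<and> dact T F = 0" if "T \<in> H_ideal A \<beta>" for T
    using that unfolding H_ideal_def
  proof (induction rule: left_ideal_induct)
    case (gen W T)
    have "T \<in> weyl \<and> dact T F = 0"
      using gen(2) part euler by (auto simp: euler_op_theta_poly)
    then show ?case using gen(1) by (simp add: dact_mult weyl_mult)
  qed (simp_all add: dact_add weyl_add)
  then show ?thesis
    unfolding annihilated_by_def by (metis dact_weyl_op zero_fun_apply)
qed


section \<open>Fake exponents\<close>

lemma translate_fall: "translate v (fall z a) = fall (v + z) a"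
  by (simp add: fall_def translate_prod translate_simps add_ac flip: cst_add)

text \<open>The classical falling factorial in theta, read off from the actions on series.\<close>

lemma monom_x_d: "power_prod x_op a * power_prod d_op a = theta_poly (fall (- cvec a) a)"
  by (rule dact_faithful)
    (simp_all add: weyl_mult dact_mult dact_x_monom dact_d_monom dact_theta_poly translate_fall)

definition mk_expo :: "('n::finite \<Rightarrow> nat) \<Rightarrow> 'n expo" where
  "mk_expo f = (\<Sum>j\<in>UNIV. Poly_Mapping.single j (f j))"

lemma lookup_mk_expo [simp]: "Poly_Mapping.lookup (mk_expo f) j = f j"
  by (simp add: mk_expo_def lookup_sum lookup_single when_def)

lemma expo_vec_nth [simp]: "expo_vec a $ j = int (Poly_Mapping.lookup a j)"
  by (simp add: expo_vec_def)

lemma lattice_expo_vec: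
  assumes "expo_vec a - expo_vec b \<in> lattice A"
  shows "A *v expo_vec a = A *v expo_vec b"
  using assms by (simp add: lattice_def vec_eq_iff matrix_vector_mult_def right_diff_distrib sum_subtractf)

lemma wdot_diff: "wdot w (u - v) = wdot w u - wdot w v"
  by (simp add: wdot_def right_diff_distrib sum_subtractf)

lemma wdot_add: "wdot w (u + v) = wdot w u + wdot w v"
  by (simp add: wdot_def distrib_left sum.distrib)

lemma wdot_0 [simp]: "wdot w 0 = 0"
  by (simp add: wdot_def)

lemma shift_vec_0 [simp]: "shift_vec v 0 = v"
  by (simp add: shift_vec_def vec_eq_iff)

lemma shift_vec_nth [simp]: "shift_vec v u $ j = v $ j + of_int (u $ j)"
  by (simp add: shift_vec_def)

lemma zero_in_lattice [simp]: "0 \<in> lattice A"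
  by (simp add: lattice_def)

lemma nsupp_of_int: "v $ j = of_int m \<Longrightarrow> j \<in> nsupp v \<longleftrightarrow> m < 0"
  by (auto simp: nsupp_def)

lemma fake_exponent_euler:
  assumes "fake_exponent A \<beta> w v"
  shows "(\<Sum>j\<in>UNIV. of_int (A $ i $ j) * v $ j) = \<beta> $ i"
proof -
  let ?f = "linear_form A i - cst (\<beta> $ i)"
  have "?f \<in> fake_indicial_ideal A \<beta> w"
    unfolding fake_indicial_ideal_def
    by (rule in_ideal_sumI2) (simp_all add: theta_poly_simps left_ideal_0 ideal_gen)
  then have "poly_eval ?f v = 0" using assms by (simp add: fake_exponent_def)
  then show ?thesis
    by (simp add: linear_form_def poly_eval_simps flip: cst_of_int)
qed

lemma init_part_binomial:
  assumes "wt a < wt b"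
  shows "init_part wt (monom b - monom a) = monom b"
proof -
  have "a \<noteq> b" using assms by auto
  then have l: "Poly_Mapping.lookup (monom b - monom a) k = (if k = b then 1 else if k = a then -1 else 0)" for k
    by (auto simp: lookup_minus lookup_monom)
  then have "Poly_Mapping.keys (monom b - monom a :: 'a mpoly) = {a, b}"
    by (auto simp: in_keys_iff split: if_splits)
  then have "{k \<in> Poly_Mapping.keys (monom b - monom a :: 'a mpoly).
      \<forall>l\<in>Poly_Mapping.keys (monom b - monom a :: 'a mpoly). wt l \<le> wt k} = {b}"
    using assms by auto
  then show ?thesis unfolding init_part_def by (simp add: l) (simp add: monom_def)
qed

text \<open>If the minimality failed for some \<open>u\<close> with the negative support of \<open>v\<close>, the initial monomial
  of the binomial of \<open>u\<close> would give an element of the fake indicial ideal not vanishing at \<open>v\<close>.\<close>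

lemma fake_exponent_NN:
  assumes "fake_exponent A \<beta> w v"
  shows "nsupp v \<in> NN A w v"
proof -
  have "wdot w u \<ge> 0" if u: "u \<in> lattice A" "nsupp (shift_vec v u) = nsupp v" for u
  proof (rule ccontr)
    assume neg: "\<not> wdot w u \<ge> 0"
    \<comment> \<open>Positive and negative parts of \<open>u\<close>; as \<open>u\<close> has
      negative weight, the monomial of \<open>b\<close> is the initial one.\<close>
    define a where "a = mk_expo (\<lambda>j. nat (u $ j))"
    define b where "b = mk_expo (\<lambda>j. nat (- u $ j))"
    have u_ab: "u = expo_vec a - expo_vec b"
      by (simp add: vec_eq_iff a_def b_def)
    then have "A *v expo_vec b = A *v expo_vec a"
      using u(1) lattice_expo_vec by metis
    then have bin: "monom b - monom a \<in> toric_ideal A"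
      unfolding toric_ideal_def by (intro ideal_gen) blast
    have "wdot w (expo_vec a) < wdot w (expo_vec b)"
      using neg by (simp add: u_ab wdot_diff)
    then have "init_part (\<lambda>a. wdot w (expo_vec a)) (monom b - monom a) = monom b"
      by (rule init_part_binomial)
    then have "monom b \<in> init_toric w A"
      unfolding init_toric_def using bin by (intro ideal_gen) force
    \<comment> \<open>Multiplication by \<open>x^b\<close> turns the initial monomial into a
      polynomial in theta.\<close>
    then have "power_prod x_op b * partial_poly (monom b) \<in> left_ideal weyl (partial_poly ` init_toric w A)"
      by (intro left_ideal_mult left_ideal_gen) (auto intro: weyl_mult)
    then have "fall (- cvec b) b \<in> fake_indicial_ideal A \<beta> w"
      unfolding fake_indicial_ideal_def
      by (intro in_ideal_sumI1) (simp_all add: partial_poly_simps monom_x_d ring_mod.subspace_0)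
    then have "poly_eval (fall (- cvec b) b) v = 0"
      using assms by (simp add: fake_exponent_def)
    \<comment> \<open>A vanishing factor means that \<open>v_j\<close> is an integer with
      \<open>0 \<le> v_j < b_j\<close>. Adding \<open>u_j = - b_j\<close> makes it negative, so the
      supports differ.\<close>
    then obtain j k where k: "k < Poly_Mapping.lookup b j"
      and v: "v $ j + (- of_nat (Poly_Mapping.lookup b j) + of_nat k + 1) = 0"
      by (auto simp: fall_def poly_eval_prod poly_eval_simps)
    have bj: "int (Poly_Mapping.lookup b j) = - u $ j"
      using k by (simp add: b_def)
    have vj: "v $ j = of_int (int (Poly_Mapping.lookup b j) - int k - 1)"
      using v by (simp add: algebra_simps eq_neg_iff_add_eq_0)
    have "u $ j = - int (Poly_Mapping.lookup b j)" using bj by simp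
    then have sj: "shift_vec v u $ j = of_int (- int k - 1)" by (simp add: vj)
    have "j \<notin> nsupp v" "j \<in> nsupp (shift_vec v u)"
      using k unfolding nsupp_of_int[OF vj] nsupp_of_int[OF sj] by simp_all
    then show False using u(2) by simp
  qed
  moreover have "nsupp v \<in> NS A v"
    unfolding NS_def by (rule image_eqI[of _ _ 0]) simp_all
  ultimately show ?thesis by (auto simp: NN_def)
qed


section \<open>The indicial ideal annihilates the initial coefficients\<close>

lemma init_part_restr:
  "init_part wt c = restr {k. \<forall>l\<in>Poly_Mapping.keys c. wt l \<le> wt k} c"
  unfolding init_part_def restr_def by (rule sum.cong) auto

lemma weyl_act_restr: "weyl_act (restr M c) F v = (\<Sum>(a, b)\<in>Poly_Mapping.keys c.
   if (a, b) \<in> M then cst (Poly_Mapping.lookup c (a, b))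
     * (fall (v - cvec a) b \<bullet>\<^sub>\<partial> F (v - cvec a + cvec b)) else 0)"
proof -
  have k: "Poly_Mapping.keys (restr M c) = Poly_Mapping.keys c \<inter> M"
    by (auto simp: in_keys_iff lookup_restr split: if_splits)
  have "weyl_act (restr M c) F v = (\<Sum>k\<in>Poly_Mapping.keys c \<inter> M.
     cst (Poly_Mapping.lookup c k) * (fall (v - cvec (fst k)) (snd k) \<bullet>\<^sub>\<partial> F (v - cvec (fst k) + cvec (snd k))))"
    unfolding weyl_act_def k case_prod_unfold
    by (rule sum.cong) (auto simp: power_x_act power_d_act lookup_restr)
  then show ?thesis
    unfolding case_prod_unfold prod.collapse by (simp add: sum.inter_restrict)
qed

lemma restr_UNIV [simp]: "restr UNIV c = c"
  by (rule poly_mapping_eqI) (simp add: lookup_restr)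

abbreviation wdeg :: "real^'n \<Rightarrow> 'n wexpo \<Rightarrow> real" where
  "wdeg w \<equiv> \<lambda>(a, b). wdot w (expo_vec b - expo_vec a)"

text \<open>If a term of maximal weight moves \<open>v\<close> to \<open>z\<close>, every other term
  reaches \<open>z\<close> from an exponent \<open>v + u\<close> with \<open>u\<close> of weight at
  most 0. There \<open>F\<close> vanishes unless \<open>u = 0\<close>.\<close>

lemma init_part_initial_term:
  fixes A :: "int^'n::{finite,linorder}^'d"
  assumes generic: "generic_weight A w"
    and F: "F \<in> supported_series A v (NN A w v)" and ann: "weyl_act c F = 0"
  shows "weyl_act (init_part (wdeg w) c) (lsingle v (F v)) = 0"
proof
  fix z
  let ?M = "{k. \<forall>l\<in>Poly_Mapping.keys c. wdeg w l \<le> wdeg w k}"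
  let ?t = "\<lambda>(F :: 'n log_series) k. cst (Poly_Mapping.lookup c k)
     * (fall (z - cvec (fst k)) (snd k) \<bullet>\<^sub>\<partial> F (z - cvec (fst k) + cvec (snd k)))"
  \<comment> \<open>\<open>NN\<close> makes the weight nonnegative, and genericity excludes weight
    zero for nonzero \<open>u\<close>.\<close>
  have supp: "u = 0 \<or> 0 < wdot w u" if nz: "F (v + (\<chi> j. of_int (u $ j))) \<noteq> 0" for u
  proof -
    obtain u' where u': "u' \<in> lattice A" "nsupp (shift_vec v u') \<in> NN A w v"
      "v + (\<chi> j. of_int (u $ j)) = shift_vec v u'"
      using F nz unfolding supported_series_def by blast
    have "u = u'" using u'(3) by (simp add: shift_vec_def vec_eq_iff)
    have "wdot w u' \<ge> 0" using u'(1,2) by (auto simp: NN_def)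
    then show ?thesis
      using generic u'(1) \<open>u = u'\<close> by (auto simp: generic_weight_def less_le)
  qed
  have shift_neq: "v + (\<chi> j. of_int (u $ j)) \<noteq> v" if "u \<noteq> 0" for u :: "(int, 'n) vec"
    using that by (simp add: vec_eq_iff)
  have init: "weyl_act (init_part (wdeg w) c) (lsingle v (F v)) z
      = (\<Sum>k\<in>Poly_Mapping.keys c. if k \<in> ?M then ?t (lsingle v (F v)) k else 0)"
    unfolding init_part_restr weyl_act_restr case_prod_unfold prod.collapse ..
  have full: "weyl_act c F z = (\<Sum>k\<in>Poly_Mapping.keys c. ?t F k)"
    using weyl_act_restr[of UNIV c F z] by (simp add: case_prod_unfold)
  show "weyl_act (init_part (wdeg w) c) (lsingle v (F v)) z = 0 z"
  proof (cases "\<exists>k\<in>Poly_Mapping.keys c \<inter> ?M. z - cvec (fst k) + cvec (snd k) = v")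
    case False
    have "weyl_act (init_part (wdeg w) c) (lsingle v (F v)) z = 0"
      unfolding init
    proof (intro sum.neutral ballI)
      fix k assume k: "k \<in> Poly_Mapping.keys c"
      show "(if k \<in> ?M then ?t (lsingle v (F v)) k else 0) = 0"
      proof (cases "k \<in> ?M")
        case True
        then have "z - cvec (fst k) + cvec (snd k) \<noteq> v" using False k by blast
        then show ?thesis by (simp add: lsingle_def)
      qed (rule if_not_P)
    qed
    then show ?thesis by simp
  next
    case True
    then obtain k where k: "k \<in> Poly_Mapping.keys c" "k \<in> ?M"
      and z: "z - cvec (fst k) + cvec (snd k) = v" by blast
    have "?t F l = (if l \<in> ?M then ?t (lsingle v (F v)) l else 0)" if l: "l \<in> Poly_Mapping.keys c" for l
    proof -
      \<comment> \<open>The exponent of \<open>F\<close> used by the term \<open>l\<close>, relative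
        to \<open>v\<close>; its weight is the weight of \<open>l\<close> minus that of
        \<open>k\<close>.\<close>
      let ?u = "(expo_vec (fst k) - expo_vec (snd k)) - (expo_vec (fst l) - expo_vec (snd l)) :: (int, 'n) vec"
      have zl: "z - cvec (fst l) + cvec (snd l) = v + (\<chi> j. of_int (?u $ j))"
        by (simp add: vec_eq_iff flip: z)
      have wu: "wdot w ?u = wdeg w l - wdeg w k"
        by (simp add: wdot_diff case_prod_unfold)
      have le: "wdeg w l \<le> wdeg w k" using k(2) l by blast
      consider "?u = 0" | "F (z - cvec (fst l) + cvec (snd l)) = 0" "?u \<noteq> 0"
        using supp[of ?u] wu le unfolding zl by fastforce
      then show ?thesis
      proof cases
        case 1
        then have "wdeg w l = wdeg w k" using wu by simp
        then have "l \<in> ?M" using k(2) by auto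
        moreover have "z - cvec (fst l) + cvec (snd l) = v"
          unfolding zl 1 by (simp add: vec_eq_iff)
        ultimately show ?thesis by (simp add: lsingle_def)
      next
        case 2
        have "z - cvec (fst l) + cvec (snd l) \<noteq> v"
          unfolding zl by (rule shift_neq[OF 2(2)])
        then show ?thesis using 2 by (simp add: lsingle_def)
      qed
    qed
    then have "weyl_act (init_part (wdeg w) c) (lsingle v (F v)) z = weyl_act c F z"
      unfolding init full by (intro sum.cong) simp_all
    then show ?thesis using ann by simp
  qed
qed

section \<open>Clearing denominators\<close>

abbreviation poly_op :: "'n::{finite,linorder} mpoly \<Rightarrow> 'n dop" where
  "poly_op p \<equiv> rat_op (Fract p 1)"

lemma poly_op_subst: "poly_op p = poly_subst c_op x_op p"
proof (induction p rule: mpoly_var_induct)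
  case (cst c)
  then show ?case by (simp only: commuting_subst.subst_cst[OF commuting_subst_x]) (simp add: c_op_def)
next
  case (var j p)
  then show ?case
    by (simp add: commuting_subst.subst_mult[OF commuting_subst_x]
        commuting_subst.subst_var[OF commuting_subst_x] flip: var)
      (simp add: x_op_def flip: rat_op_mult)
next
  case (add p q)
  then show ?case
    using rat_op_add[of "Fract p 1" "Fract q 1"]
    by (simp add: commuting_subst.subst_add[OF commuting_subst_x])
qed

lemma poly_op_weyl [simp]: "poly_op p \<in> weyl"
  by (simp add: poly_op_subst poly_subst_def weyl_sum weyl_mult)

lemma dact_poly_op: "dact (poly_op p) F v
    = (\<Sum>a\<in>Poly_Mapping.keys p. cst (Poly_Mapping.lookup p a) * F (v - cvec a))"
  by (simp add: poly_op_subst poly_subst_def dact_sum weyl_mult dact_mult dact_c_op dact_x_monom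
      sum_fun_apply)

text \<open>Distinct monomials move \<open>v\<close> to distinct exponents, so nothing
  cancels.\<close>

lemma dact_poly_op_lsingle:
  assumes "p \<noteq> 0" "dact (poly_op p) (lsingle v r) = 0"
  shows "r = 0"
proof -
  obtain a where a: "a \<in> Poly_Mapping.keys p"
    using assms(1) by (meson ex_in_conv keys_eq_empty)
  have "dact (poly_op p) (lsingle v r) (v + cvec a)
      = (\<Sum>b\<in>Poly_Mapping.keys p. if b = a then cst (Poly_Mapping.lookup p a) * r else 0)"
    unfolding dact_poly_op
    by (intro sum.cong) (auto simp: lsingle_def cvec_inj)
  then have "cst (Poly_Mapping.lookup p a) * r = 0" using assms(2) a by simp
  then show ?thesis using a by (simp add: in_keys_iff)
qed

text \<open>The statement is stable under composition because of the arbitrary denominator on the right.\<close>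

lemma clear_denominators:
  assumes "T \<in> diff_ops" "q \<noteq> 0"
  shows "\<exists>q' W. q' \<noteq> 0 \<and> W \<in> weyl \<and>
    (\<forall>g. Fract q' 1 * T (Fract 1 q * g) = Rep_dop (W :: 'n::{finite,linorder} dop) g)"
  using assms
proof (induction arbitrary: q rule: diff_ops.induct)
  case (mult_op f)
  obtain p s where f: "f = Fract p s" "s \<noteq> 0" by (cases f)
  have "Fract (s * q) 1 * (f * (Fract 1 q * g)) = Rep_dop (poly_op p) g" for g
  proof -
    have "Fract (s * q) 1 * Fract p s * Fract 1 q = Fract p 1"
      using f(2) mult_op by (simp add: eq_fract)
    then show ?thesis
      unfolding f(1) Rep_dop_rat_op by (simp only: mult.assoc [symmetric])
  qed
  then show ?case using f(2) mult_op by (intro exI[of _ "s * q"] exI[of _ "poly_op p"]) simp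
next
  case (der_op j)
  \<comment> \<open>The quotient rule in the form
    \<open>q^2 \<partial>_j q^(-1) = q \<partial>_j - \<partial>_j(q)\<close>.\<close>
  let ?W = "poly_op (- pd j q) + poly_op q * d_op j"
  have "Fract (q * q) 1 * rder j (Fract 1 q * g) = Rep_dop ?W g" for g
  proof -
    have "rder j (Fract 1 q) = Fract (- pd j q) (q * q)"
      using pd_cst[of j 1] der_op by (simp add: rder_Fract)
    moreover have "Fract (q * q) 1 * Fract (- pd j q) (q * q) = Fract (- pd j q) 1"
      "Fract (q * q) 1 * Fract 1 q = Fract q 1"
      using der_op by (simp_all add: eq_fract)
    ultimately show ?thesis
      by (simp only: rder_mult distrib_left mult.assoc [symmetric] plus_dop.rep_eq times_dop.rep_eq
          Rep_dop_rat_op Rep_dop_d_op)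
  qed
  then show ?case
    using der_op by (intro exI[of _ "q * q"] exI[of _ ?W]) (simp add: weyl_add weyl_mult)
next
  case (add_op S T)
  obtain q1 W1 where 1: "q1 \<noteq> 0" "W1 \<in> weyl" "\<forall>g. Fract q1 1 * S (Fract 1 q * g) = Rep_dop W1 g"
    using add_op.IH(1)[OF add_op.prems] by (elim exE conjE) (rule that)
  obtain q2 W2 where 2: "q2 \<noteq> 0" "W2 \<in> weyl" "\<forall>g. Fract q2 1 * T (Fract 1 q * g) = Rep_dop W2 g"
    using add_op.IH(2)[OF add_op.prems] by (elim exE conjE) (rule that)
  have "Fract (q1 * q2) 1 * (S (Fract 1 q * g) + T (Fract 1 q * g))
      = Rep_dop (poly_op q2 * W1 + poly_op q1 * W2) g" for g
    by (simp only: plus_dop.rep_eq times_dop.rep_eq Rep_dop_rat_op 1(3)[rule_format, symmetric] 2(3)[rule_format, symmetric]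
        Fract_poly_mult [symmetric] distrib_left ac_simps)
  then show ?case
    using 1 2 by (intro exI[of _ "q1 * q2"] exI[of _ "poly_op q2 * W1 + poly_op q1 * W2"])
      (simp add: weyl_add weyl_mult)
next
  case (comp_op S T)
  obtain q1 W1 where 1: "q1 \<noteq> 0" "W1 \<in> weyl" "\<forall>g. Fract q1 1 * T (Fract 1 q * g) = Rep_dop W1 g"
    using comp_op.IH(2)[OF comp_op.prems] by (elim exE conjE) (rule that)
  \<comment> \<open>The denominator \<open>q1\<close> left by \<open>T\<close> becomes the
    right-hand denominator for \<open>S\<close>.\<close>
  obtain q2 W2 where 2: "q2 \<noteq> 0" "W2 \<in> weyl" "\<forall>g. Fract q2 1 * S (Fract 1 q1 * g) = Rep_dop W2 g"
    using comp_op.IH(1)[OF 1(1)] by (elim exE conjE) (rule that)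
  have "Fract q2 1 * S (T (Fract 1 q * g)) = Rep_dop (W2 * W1) g" for g
  proof -
    have "Fract 1 q1 * Fract q1 1 = 1"
      unfolding One_fract_def mult_fract using 1(1) by (simp add: eq_fract del: Fract_1_1)
    then have "T (Fract 1 q * g) = Fract 1 q1 * Rep_dop W1 g"
      unfolding 1(3)[rule_format, symmetric] by (simp only: mult.assoc [symmetric] mult_1_left)
    then show ?thesis by (simp add: 2(3) times_dop.rep_eq)
  qed
  then show ?case
    using 1 2 by (intro exI[of _ q2] exI[of _ "W2 * W1"]) (simp add: weyl_mult)
qed

lemma clear_denominators_dop:
  obtains q where "q \<noteq> 0" "poly_op q * T \<in> weyl"
proof -
  obtain q W where q: "q \<noteq> 0" "W \<in> weyl" "\<And>g. Fract q 1 * Rep_dop T (Fract 1 1 * g) = Rep_dop W g"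
    using clear_denominators[OF Rep_dop[of T], of 1] by auto
  have "poly_op q * T = W"
    by (rule dop_eqI) (use q(3) in \<open>simp add: times_dop.rep_eq Rep_dop_rat_op\<close>)
  then show thesis using q that by blast
qed

lemma clear_denominators_left_ideal:
  assumes "T \<in> left_ideal UNIV G"
  shows "\<exists>q. q \<noteq> 0 \<and> poly_op q * T \<in> left_ideal weyl G"
  using assms
proof (induction rule: left_ideal_induct)
  case zero
  show ?case by (intro exI[of _ 1]) (simp add: left_ideal_0)
next
  case (gen S g)
  obtain q where q: "q \<noteq> 0" "poly_op q * S \<in> weyl" by (rule clear_denominators_dop)
  have "(poly_op q * S) * g \<in> left_ideal weyl G"
    using q gen by (intro left_ideal_mult left_ideal_gen) (auto intro: weyl_mult)
  then show ?case using q(1) by (auto simp: mult.assoc)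
next
  case (add S T)
  then obtain p q where p: "p \<noteq> 0" "poly_op p * S \<in> left_ideal weyl G"
    and q: "q \<noteq> 0" "poly_op q * T \<in> left_ideal weyl G" by blast
  have eq: "poly_op (p * q) * (S + T) = poly_op q * (poly_op p * S) + poly_op p * (poly_op q * T)"
    by (simp only: distrib_left mult.assoc [symmetric] rat_op_mult [symmetric] Fract_poly_mult
        mult.commute[of q p])
  have "poly_op (p * q) * (S + T) \<in> left_ideal weyl G"
    unfolding eq
    by (rule left_ideal_add[OF _ _ left_ideal_mult[OF _ p(2)] left_ideal_mult[OF _ q(2)]])
      (simp_all add: weyl_add weyl_mult)
  then show ?case using p(1) q(1) by (intro exI[of _ "p * q"]) simp
qed

text \<open>Every polynomial is congruent to its value at \<open>v\<close> modulo the linear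
  generators.\<close>

lemma max_ideal_eval:
  assumes "poly_eval q v = 0"
  shows "q \<in> max_ideal v"
proof -
  have sub: "ring_mod.subspace (max_ideal v)" by (simp add: max_ideal_def)
  have "q - cst (poly_eval q v) \<in> max_ideal v" for q
  proof (induction q rule: mpoly_var_induct)
    case (cst c)
    then show ?case by (simp add: poly_eval_simps ring_mod.subspace_0[OF sub])
  next
    case (var j p)
    have "var j - cst (v $ j) \<in> max_ideal v"
      unfolding max_ideal_def by (intro ideal_gen) blast
    then have "p * (var j - cst (v $ j)) + cst (v $ j) * (p - cst (poly_eval p v)) \<in> max_ideal v"
      using var by (intro ring_mod.subspace_add[OF sub] ring_mod.subspace_scale[OF sub])
    then show ?case by (simp add: poly_eval_simps cst_mult algebra_simps)
  next
    case (add p q)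
    then show ?case
      using ring_mod.subspace_add[OF sub add] by (simp add: poly_eval_simps cst_add algebra_simps)
  qed
  from this[of q] show ?thesis using assms by simp
qed

text \<open>Collecting the denominators into one factor \<open>h\<close>, nonzero at
  \<open>v\<close>, leads back to \<open>J\<close> itself.\<close>

lemma local_componentD:
  assumes J: "ring_mod.subspace J" and f: "f \<in> local_component J v"
  obtains h where "poly_eval h v \<noteq> 0" "h * f \<in> J"
proof -
  have "\<exists>h k. poly_eval h v \<noteq> 0 \<and> k \<in> J \<and> Fract h 1 * x = Fract k 1"
    if "x \<in> left_ideal (local_ring v) ((\<lambda>g. Fract g 1) ` J)" for x
    using that
  proof (induction rule: left_ideal_induct)
    case zero
    show ?case using ring_mod.subspace_0[OF J] by (intro exI[of _ 1] exI[of _ 0]) (simp add: poly_eval_simps)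
  next
    case (gen a x)
    then obtain p q k where a: "a = Fract p q" "q \<notin> max_ideal v" and x: "x = Fract k 1" "k \<in> J"
      by (auto simp: local_ring_def)
    have q: "poly_eval q v \<noteq> 0" using a(2) max_ideal_eval by blast
    then have "q \<noteq> 0" by (auto simp: poly_eval_simps)
    then have "Fract q 1 * (a * x) = Fract (p * k) 1" by (simp add: a x eq_fract)
    then show ?case using q ring_mod.subspace_scale[OF J x(2)] by blast
  next
    case (add x y)
    then obtain h k h' k' where x: "poly_eval h v \<noteq> 0" "k \<in> J" "Fract h 1 * x = Fract k 1"
      and y: "poly_eval h' v \<noteq> 0" "k' \<in> J" "Fract h' 1 * y = Fract k' 1" by blast
    have "Fract (h * h') 1 * (x + y) = Fract h' 1 * (Fract h 1 * x) + Fract h 1 * (Fract h' 1 * y)"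
      by (simp only: Fract_poly_mult [symmetric] distrib_left ac_simps)
    also have "\<dots> = Fract (h' * k + h * k') 1" by (simp add: x y)
    finally show ?case
      using x y J by (intro exI[of _ "h * h'"] exI[of _ "h' * k + h * k'"])
        (simp add: poly_eval_simps ring_mod.subspace_add ring_mod.subspace_scale)
  qed
  then obtain h k where "poly_eval h v \<noteq> 0" "k \<in> J" "Fract h 1 * Fract f 1 = Fract k 1"
    using f unfolding local_component_def by blast
  then show thesis by (intro that[of h]) (auto simp: eq_fract)
qed

lemma indicial_ideal_subspace: "ring_mod.subspace (indicial_ideal A \<beta> w)"
  unfolding indicial_ideal_def
  by (rule ring_mod.subspaceI)
    (simp_all add: theta_poly_simps left_ideal_0 left_ideal_add left_ideal_mult)

text \<open>Initial forms kill the one-term series at \<open>v\<close>. The denominators from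
  \<open>R\<close> and the localising factor \<open>h\<close> cancel because they act
  injectively.\<close>

lemma indicial_annihilates:
  fixes A :: "int^'n::{finite,linorder}^'d"
  assumes generic: "generic_weight A w"
    and f: "f \<in> indicial_at_zero A \<beta> w v" and p: "p \<in> C_space A \<beta> v (NN A w v)"
  shows "f \<bullet>\<^sub>\<partial> p = 0"
proof -
  obtain F where F: "p = F v" "F \<in> supported_series A v (NN A w v)" "annihilated_by (H_ideal A \<beta>) F"
    using p by (auto simp: C_space_def)
  have ind: "translate v g \<bullet>\<^sub>\<partial> p = 0" if g: "g \<in> indicial_ideal A \<beta> w" for g
  proof -
    let ?F0 = "lsingle v p"
    have init: "T \<in> weyl \<and> dact T ?F0 = 0" if "T \<in> init_H A \<beta> w" for T
      using that unfolding init_H_def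
    proof (induction rule: left_ideal_induct)
      case (gen W T)
      then obtain c where T: "T = weyl_op (init_part (wdeg w) c)" and c: "weyl_op c \<in> H_ideal A \<beta>"
        by blast
      have "weyl_act c F = 0" using F(3) c by (auto simp: annihilated_by_def fun_eq_iff)
      from init_part_initial_term[OF generic F(2) this]
      have "dact T ?F0 = 0" by (simp add: T F(1))
      then show ?case using gen(1) by (simp add: T weyl_mult dact_mult)
    qed (simp_all add: weyl_add dact_add)
    obtain q where q: "q \<noteq> 0" "poly_op q * theta_poly g \<in> left_ideal weyl (init_H A \<beta> w)"
      using clear_denominators_left_ideal g by (auto simp: indicial_ideal_def)
    have "T \<in> weyl \<and> dact T ?F0 = 0" if "T \<in> left_ideal weyl (init_H A \<beta> w)" for T
      using that
    proof (induction rule: left_ideal_induct)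
      case (gen W T)
      then show ?case using init[of T] by (simp add: weyl_mult dact_mult)
    qed (simp_all add: weyl_add dact_add)
    then have "dact (poly_op q) (dact (theta_poly g) ?F0) = 0"
      using q(2) by (simp flip: dact_mult)
    moreover have "dact (theta_poly g) ?F0 = lsingle v (translate v g \<bullet>\<^sub>\<partial> p)"
      by (auto simp: fun_eq_iff dact_theta_poly lsingle_def)
    ultimately show ?thesis using dact_poly_op_lsingle q(1) by metis
  qed
  obtain g where g: "f = translate v g" "g \<in> local_component (indicial_ideal A \<beta> w) v"
    using f by (auto simp: indicial_at_zero_def)
  obtain h where h: "poly_eval h v \<noteq> 0" "h * g \<in> indicial_ideal A \<beta> w"
    using local_componentD[OF indicial_ideal_subspace g(2)] by blast
  have "translate v h \<bullet>\<^sub>\<partial> f \<bullet>\<^sub>\<partial> p = 0"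
    using ind[OF h(2)] by (simp add: g(1) translate_simps diff_act_mult)
  moreover have "poly_eval (translate v h) 0 \<noteq> 0"
    using h(1) by (simp add: poly_eval_translate)
  ultimately show ?thesis by (rule diff_act_unit_inj[rotated])
qed


section \<open>Solutions from polynomials annihilated by the ideal Q\<close>

text \<open>The product of the factors of \<open>fall\<close> (with base point \<open>v + z\<close>) that act invertibly on
  polynomials.\<close>

definition ifac :: "complex^'n::{finite,linorder} \<Rightarrow> (int, 'n) vec \<Rightarrow> (int, 'n) vec \<Rightarrow> 'n mpoly" where
  "ifac v z u = (\<Prod>j\<in>UNIV. \<Prod>k\<in>{z $ j<..u $ j}.
     if v $ j + of_int k = 0 then 1 else var j + cst (v $ j + of_int k))"

lemma sqfree_UNIV: "sqfree S = (\<Prod>j\<in>UNIV. if j \<in> S then var j else 1)"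
  by (simp add: sqfree_def prod.If_cases)

text \<open>At most one \<open>k\<close> makes the constant term vanish, so the bare variable occurs
  at most once.\<close>

lemma split_zero_factor:
  fixes S :: "int set"
  assumes "finite S"
  shows "(\<Prod>k\<in>S. var j + cst (c + of_int k)) = (if \<exists>k\<in>S. c + of_int k = 0 then var j else 1)
    * (\<Prod>k\<in>S. if c + of_int k = 0 then 1 else var j + cst (c + of_int k))"
proof (cases "\<exists>k\<in>S. c + of_int k = 0")
  case False
  then have "(\<Prod>k\<in>S. var j + cst (c + of_int k))
      = (\<Prod>k\<in>S. if c + of_int k = 0 then 1 else var j + cst (c + of_int k))"
    by (intro prod.cong) auto
  then show ?thesis using False by simp
next
  case True
  then obtain k where k: "k \<in> S" "c + of_int k = 0" by blast
  have "(\<Prod>l\<in>S - {k}. var j + cst (c + of_int l))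
      = (\<Prod>l\<in>S - {k}. if c + of_int l = 0 then 1 else var j + cst (c + of_int l))"
  proof (rule prod.cong)
    fix l assume "l \<in> S - {k}"
    moreover have "l = k" if "c + of_int l = 0"
    proof -
      have "c + of_int l = c + of_int k" using k(2) that by simp
      then show ?thesis by simp
    qed
    ultimately show "var j + cst (c + of_int l)
        = (if c + of_int l = 0 then 1 else var j + cst (c + of_int l))"
      by auto
  qed simp
  then show ?thesis
    using True k assms by (simp add: prod.remove[of S k])
qed

text \<open>A coordinate leaves the negative integers precisely when zero is among the values it
  takes while rising in unit steps.\<close>

lemma nsupp_step: "j \<in> nsupp (shift_vec v z) - nsupp (shift_vec v (z + expo_vec a)) \<longleftrightarrow>
    (\<exists>k\<in>{z $ j<..z $ j + int (Poly_Mapping.lookup a j)}. v $ j + of_int k = 0)"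
proof
  assume j: "j \<in> nsupp (shift_vec v z) - nsupp (shift_vec v (z + expo_vec a))"
  then obtain m where m: "m < 0" "v $ j + of_int (z $ j) = of_int m"
    by (auto simp: nsupp_def)
  have "shift_vec v (z + expo_vec a) $ j = of_int (m + int (Poly_Mapping.lookup a j))"
    using m(2) by (simp add: add.assoc[symmetric])
  from nsupp_of_int[OF this] j have "\<not> m + int (Poly_Mapping.lookup a j) < 0" by simp
  moreover have "v $ j + of_int (z $ j - m) = 0" using m(2) by (simp add: algebra_simps)
  ultimately show "\<exists>k\<in>{z $ j<..z $ j + int (Poly_Mapping.lookup a j)}. v $ j + of_int k = 0"
    using m(1) by (intro bexI[of _ "z $ j - m"]) auto
next
  assume "\<exists>k\<in>{z $ j<..z $ j + int (Poly_Mapping.lookup a j)}. v $ j + of_int k = 0"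
  then obtain k where k: "z $ j < k" "k \<le> z $ j + int (Poly_Mapping.lookup a j)"
    and "v $ j + of_int k = 0" by auto
  then have v: "v $ j = of_int (- k)" by (simp add: eq_neg_iff_add_eq_0)
  have "shift_vec v z $ j = of_int (z $ j - k)"
    "shift_vec v (z + expo_vec a) $ j = of_int (z $ j + int (Poly_Mapping.lookup a j) - k)"
    using v by simp_all
  from nsupp_of_int[OF this(1)] nsupp_of_int[OF this(2)] k
  show "j \<in> nsupp (shift_vec v z) - nsupp (shift_vec v (z + expo_vec a))" by simp
qed

lemma fall_shift_vec: "fall (shift_vec v z) a
    = sqfree (nsupp (shift_vec v z) - nsupp (shift_vec v (z + expo_vec a))) * ifac v z (z + expo_vec a)"
proof -
  \<comment> \<open>Reindexed by the total shift from \<open>v_j\<close>; the first factor belongs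
    to \<open>z_j + 1\<close>, so the interval is open at \<open>z_j\<close>.\<close>
  have "(\<Prod>k<Poly_Mapping.lookup a j. var j + cst (shift_vec v z $ j + of_nat k + 1))
      = (\<Prod>k\<in>{z $ j<..z $ j + int (Poly_Mapping.lookup a j)}. var j + cst (v $ j + of_int k))" for j
    by (rule prod.reindex_bij_witness[of _ "\<lambda>k. nat (k - z $ j - 1)" "\<lambda>k. z $ j + 1 + int k"])
      (auto simp: add_ac)
  then show ?thesis
    unfolding fall_def ifac_def sqfree_UNIV prod.distrib [symmetric] nsupp_step
    by (simp add: split_zero_factor)
qed

lemma ifac_unit: "poly_eval (ifac v z u) 0 \<noteq> 0"
  by (auto simp: ifac_def poly_eval_prod poly_eval_simps)

lemma ifac_refl [simp]: "ifac v z z = 1"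
  by (simp add: ifac_def)

lemma prod_interval:
  fixes a b c :: int and g :: "int \<Rightarrow> 'a::comm_monoid_mult"
  assumes "a \<le> b" "b \<le> c"
  shows "prod g {a<..b} * prod g {b<..c} = prod g {a<..c}"
proof -
  have "{a<..c} = {a<..b} \<union> {b<..c}" using assms by auto
  then show ?thesis by (simp add: prod.union_disjoint)
qed

lemma ifac_mult:
  assumes "\<And>j. z $ j \<le> y $ j" "\<And>j. y $ j \<le> u $ j"
  shows "ifac v z y * ifac v y u = ifac v z u"
  unfolding ifac_def prod.distrib [symmetric]
  by (intro prod.cong prod_interval assms) simp

text \<open>Additivity of oriented intervals through 0, cross-multiplied to avoid inverses;
  intervals that point downwards are empty and contribute 1.\<close>

lemma ifac_around_0:
  assumes "\<And>j. z $ j \<le> u $ j"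
  shows "ifac v z u * (ifac v u 0 * ifac v 0 z) = ifac v z 0 * ifac v 0 u"
  unfolding ifac_def prod.distrib [symmetric]
proof (rule prod.cong)
  fix j :: 'a
  let ?g = "\<lambda>k :: int. if v $ j + of_int k = 0 then 1 else var j + cst (v $ j + of_int k)"
  consider "0 \<le> z $ j" | "z $ j < 0" "0 \<le> u $ j" | "u $ j < 0" by linarith
  then show "prod ?g {z $ j<..u $ j} * (prod ?g {u $ j<..0 $ j} * prod ?g {0 $ j<..z $ j})
      = prod ?g {z $ j<..0 $ j} * prod ?g {0 $ j<..u $ j}"
  proof cases
    case 1
    then show ?thesis
      using prod_interval[of 0 "z $ j" "u $ j" ?g] assms[of j] by (simp add: mult.commute)
  next
    case 2
    then show ?thesis using prod_interval[of "z $ j" 0 "u $ j" ?g] by simp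
  next
    case 3
    then show ?thesis using prod_interval[of "z $ j" "u $ j" 0 ?g] assms[of j] by simp
  qed
qed simp

lemma nsupp_mono: "nsupp (shift_vec v (z + expo_vec a)) \<subseteq> nsupp (shift_vec v z)"
proof
  fix j assume "j \<in> nsupp (shift_vec v (z + expo_vec a))"
  then obtain m where m: "m < 0" "v $ j + (of_int (z $ j) + of_nat (Poly_Mapping.lookup a j)) = of_int m"
    by (auto simp: nsupp_def)
  then have "shift_vec v z $ j = of_int (m - int (Poly_Mapping.lookup a j))"
    by (simp add: algebra_simps)
  from nsupp_of_int[OF this] m(1) show "j \<in> nsupp (shift_vec v z)" by simp
qed

lemma shift_vec_inj: "shift_vec v u = shift_vec v u' \<longleftrightarrow> u = u'"
  by (simp add: shift_vec_def vec_eq_iff)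

lemma lattice_diff: "u \<in> lattice A \<Longrightarrow> u' \<in> lattice A \<Longrightarrow> u - u' \<in> lattice A"
  by (simp add: lattice_def vec_eq_iff matrix_vector_mult_def right_diff_distrib sum_subtractf)

lemma lattice_exponent_sum:
  assumes "u \<in> lattice A" "(\<Sum>j\<in>UNIV. of_int (A $ i $ j) * v $ j) = \<beta> $ i"
  shows "(\<Sum>j\<in>UNIV. of_int (A $ i $ j) * shift_vec v u $ j) = (\<beta> $ i :: complex)"
proof -
  have "(\<Sum>j\<in>UNIV. A $ i $ j * u $ j) = 0"
    using assms(1) by (simp add: lattice_def vec_eq_iff matrix_vector_mult_def)
  then have "(\<Sum>j\<in>UNIV. of_int (A $ i $ j) * of_int (u $ j)) = (0 :: complex)"
    by (metis (mono_tags, lifting) of_int_0 of_int_mult of_int_sum sum.cong)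
  then show ?thesis using assms(2) by (simp add: distrib_left sum.distrib)
qed

lemma P_ideal_subset_Q: "P_ideal A v N \<subseteq> Q_ideal A v N"
  unfolding Q_ideal_def ideal_prod_def
  by (auto intro!: in_ideal_sumI2 ring_mod.subspace_0)

lemma linear_mult_M_in_Q:
  assumes "I \<in> N"
  shows "linear_form A i * sqfree (I - KK N) \<in> Q_ideal A v N"
  unfolding Q_ideal_def
proof (rule in_ideal_sumI1)
  show "0 \<in> P_ideal A v N" by (simp add: P_ideal_def ring_mod.subspace_0)
  have "linear_form A i \<in> ideal (range (linear_form A))" by (intro ideal_gen) blast
  moreover have "sqfree (I - KK N) \<in> M_ideal N"
    unfolding M_ideal_def using assms by (intro ideal_gen) blast
  ultimately show "linear_form A i * sqfree (I - KK N)
      \<in> ideal_prod (ideal (range (linear_form A))) (M_ideal N)"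
    unfolding ideal_prod_def by (intro ideal_gen) blast
qed

lemma diff_act_unit_cancel:
  assumes "poly_eval f 0 \<noteq> 0" "f \<bullet>\<^sub>\<partial> p = f \<bullet>\<^sub>\<partial> q"
  shows "p = q"
  using diff_act_unit_inj[OF assms(1), of "p - q"] assms(2) by (simp add: diff_act_diff_right)

text \<open>The normalised coefficients \<open>G u\<close> are prescribed by \<open>P\<close>, the
  normalisation is undone in \<open>R u\<close>, and \<open>F\<close> collects the result.
  \<open>P_ideal\<close> provides the toric equations across the border of \<open>N\<close>, the
  linear forms provide the Euler equations.\<close>

lemma solution_from_polynomial:
  fixes A :: "int^'n::{finite,linorder}^'d"
  assumes \<beta>: "\<And>i. (\<Sum>j\<in>UNIV. of_int (A $ i $ j) * v $ j) = \<beta> $ i"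
    and N: "nsupp v \<in> N"
    and Q: "\<And>q. q \<in> Q_ideal A v N \<Longrightarrow> q \<bullet>\<^sub>\<partial> P = 0"
  shows "m_mon v N \<bullet>\<^sub>\<partial> P \<in> C_space A \<beta> v N"
proof -
  define G where "G u = (if nsupp (shift_vec v u) \<in> N
    then sqfree (nsupp (shift_vec v u) - KK N) \<bullet>\<^sub>\<partial> P else 0)" for u
  \<comment> \<open>Coordinates with \<open>u_j\<close> positive contribute factors on the left,
    those with \<open>u_j\<close> negative on the right.\<close>
  have "\<exists>r. ifac v 0 u \<bullet>\<^sub>\<partial> r = ifac v u 0 \<bullet>\<^sub>\<partial> G u" for u
    by (rule diff_act_unit_surj[OF ifac_unit])
  then obtain R where R: "\<And>u. ifac v 0 u \<bullet>\<^sub>\<partial> R u = ifac v u 0 \<bullet>\<^sub>\<partial> G u"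
    by metis
  define F where "F z = (if z \<in> shift_vec v ` lattice A then R (inv (shift_vec v) z) else 0)" for z
  have "inj (shift_vec v)" by (auto intro: injI simp: shift_vec_inj)
  then have F: "F (shift_vec v u) = R u" if "u \<in> lattice A" for u
    using that by (simp add: F_def)
  have R_0: "R u = 0" if "nsupp (shift_vec v u) \<notin> N" for u
    by (rule diff_act_unit_inj[OF ifac_unit[of v 0 u]]) (simp add: R G_def that)
  \<comment> \<open>Cancelling a common invertible factor leaves the squarefree operator of the
    coordinates that leave the negative support.\<close>
  have fall_F: "ifac v 0 z \<bullet>\<^sub>\<partial> fall (shift_vec v z) a \<bullet>\<^sub>\<partial> R (z + expo_vec a)
      = ifac v z 0 \<bullet>\<^sub>\<partial> sqfree (nsupp (shift_vec v z) - nsupp (shift_vec v (z + expo_vec a)))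
          \<bullet>\<^sub>\<partial> G (z + expo_vec a)" for z a
  proof (rule diff_act_unit_cancel[OF ifac_unit[of v "z + expo_vec a" 0]])
    let ?u = "z + expo_vec a"
    let ?s = "sqfree (nsupp (shift_vec v z) - nsupp (shift_vec v ?u))"
    have "ifac v ?u 0 * (ifac v 0 z * (?s * ifac v z ?u))
        = ?s * (ifac v z ?u * (ifac v ?u 0 * ifac v 0 z))"
      by (simp only: ac_simps)
    also have "\<dots> = ?s * ifac v z 0 * ifac v 0 ?u"
      by (subst ifac_around_0) (simp_all add: mult.assoc)
    finally have "ifac v ?u 0 \<bullet>\<^sub>\<partial> ifac v 0 z \<bullet>\<^sub>\<partial> fall (shift_vec v z) a \<bullet>\<^sub>\<partial> R ?u
        = (?s * ifac v z 0) \<bullet>\<^sub>\<partial> ifac v 0 ?u \<bullet>\<^sub>\<partial> R ?u"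
      unfolding fall_shift_vec by (simp only: diff_act_mult [symmetric])
    also have "\<dots> = ifac v ?u 0 \<bullet>\<^sub>\<partial> ifac v z 0 \<bullet>\<^sub>\<partial> ?s \<bullet>\<^sub>\<partial> G ?u"
      unfolding R diff_act_mult [symmetric] by (simp only: ac_simps)
    finally show "ifac v ?u 0 \<bullet>\<^sub>\<partial> ifac v 0 z \<bullet>\<^sub>\<partial> fall (shift_vec v z) a \<bullet>\<^sub>\<partial> R ?u
        = ifac v ?u 0 \<bullet>\<^sub>\<partial> ifac v z 0 \<bullet>\<^sub>\<partial> ?s \<bullet>\<^sub>\<partial> G ?u" .
  qed
  \<comment> \<open>\<open>S\<close> will be the negative support at the target \<open>z\<close> of
    a toric equation; \<open>z\<close> itself may lie outside the lattice, so \<open>S\<close> is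
    arbitrary here.\<close>
  have G_in: "sqfree (S - nsupp (shift_vec v u)) \<bullet>\<^sub>\<partial> G u = sqfree (S - KK N) \<bullet>\<^sub>\<partial> P"
    if "nsupp (shift_vec v u) \<in> N" "nsupp (shift_vec v u) \<subseteq> S" for u S
  proof -
    have K: "KK N \<subseteq> nsupp (shift_vec v u)" using that(1) by (auto simp: KK_def)
    have "S - KK N = (S - nsupp (shift_vec v u)) \<union> (nsupp (shift_vec v u) - KK N)"
      using that(2) K by auto
    then have "sqfree (S - KK N) = sqfree (S - nsupp (shift_vec v u)) * sqfree (nsupp (shift_vec v u) - KK N)"
      by (metis (no_types, lifting) sqfree_union Diff_disjoint Diff_Int_distrib2 Int_Diff Int_commute inf_bot_left)
    then show ?thesis using that(1) by (simp add: G_def diff_act_mult)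
  qed
  \<comment> \<open>If \<open>S\<close> contains a support in \<open>N\<close> and one outside, the
    operator is a multiple of a generator of \<open>P_ideal\<close>.\<close>
  have out: "sqfree (S - KK N) \<bullet>\<^sub>\<partial> P = 0"
    if u: "nsupp (shift_vec v u) \<in> N" "nsupp (shift_vec v u) \<subseteq> S"
      and u': "nsupp (shift_vec v u') \<notin> N" "nsupp (shift_vec v u') \<subseteq> S" "u' \<in> lattice A" for u u' S
  proof -
    let ?I = "nsupp (shift_vec v u)" and ?J = "nsupp (shift_vec v u')"
    have "KK N \<subseteq> ?I" using u(1) by (auto simp: KK_def)
    then have "S - KK N = (S - (?I \<union> ?J)) \<union> ((?I \<union> ?J) - KK N)" using u(2) u'(2) by auto
    moreover have "(S - (?I \<union> ?J)) \<inter> ((?I \<union> ?J) - KK N) = {}" by auto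
    ultimately have eq: "sqfree (S - KK N) = sqfree (S - (?I \<union> ?J)) * sqfree ((?I \<union> ?J) - KK N)"
      by (metis sqfree_union)
    have "?J \<in> NS A v - N" using u' by (auto simp: NS_def)
    then have "sqfree ((?I \<union> ?J) - KK N) \<in> P_ideal A v N"
      unfolding P_ideal_def using u(1) by (intro ideal_gen) blast
    then have "sqfree ((?I \<union> ?J) - KK N) \<in> Q_ideal A v N" using P_ideal_subset_Q by blast
    then show ?thesis by (simp add: eq diff_act_mult Q)
  qed
  have consistent: "sqfree (S - nsupp (shift_vec v u)) \<bullet>\<^sub>\<partial> G u
      = sqfree (S - nsupp (shift_vec v u')) \<bullet>\<^sub>\<partial> G u'"
    if u: "u \<in> lattice A" "nsupp (shift_vec v u) \<subseteq> S"
      and u': "u' \<in> lattice A" "nsupp (shift_vec v u') \<subseteq> S" for u u' S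
  proof -
    have G_0: "G x = 0" if "nsupp (shift_vec v x) \<notin> N" for x using that by (simp add: G_def)
    show ?thesis
      using G_in[OF _ u(2)] G_in[OF _ u'(2)] out[OF _ u(2) _ u'(2) u'(1)] out[OF _ u'(2) _ u(2) u(1)]
        G_0[of u] G_0[of u']
      by (cases "nsupp (shift_vec v u) \<in> N"; cases "nsupp (shift_vec v u') \<in> N") simp_all
  qed
  \<comment> \<open>Exponents off the lattice translate of \<open>v\<close> carry no coefficient;
    this settles both sides of a toric equation at once.\<close>
  have F_out: "fall y a \<bullet>\<^sub>\<partial> F (y + cvec a) = 0"
    if "\<nexists>z. y = shift_vec v z \<and> z + expo_vec a \<in> lattice A" for y a
  proof -
    have "y + cvec a \<notin> shift_vec v ` lattice A"
    proof
      assume "y + cvec a \<in> shift_vec v ` lattice A"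
      then obtain u where u: "u \<in> lattice A" "y + cvec a = shift_vec v u" by blast
      have "y $ j = shift_vec v (u - expo_vec a) $ j" for j
        using arg_cong[OF u(2), of "\<lambda>x. x $ j"] by (simp add: algebra_simps)
      then have "y = shift_vec v (u - expo_vec a)" by (simp add: vec_eq_iff)
      moreover have "u - expo_vec a + expo_vec a \<in> lattice A" using u(1) by simp
      ultimately show False using that by blast
    qed
    then show ?thesis by (simp add: F_def)
  qed
  have toric: "fall y a \<bullet>\<^sub>\<partial> F (y + cvec a) = fall y b \<bullet>\<^sub>\<partial> F (y + cvec b)"
    if ab: "A *v expo_vec a = A *v expo_vec b" for a b y
  proof -
    have lat: "z + expo_vec a \<in> lattice A \<longleftrightarrow> z + expo_vec b \<in> lattice A" for z
      using ab by (simp add: lattice_def matrix_vector_right_distrib)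
    show ?thesis
    proof (cases "\<exists>z. y = shift_vec v z \<and> z + expo_vec a \<in> lattice A")
      case False
      then show ?thesis using F_out[of y a] F_out[of y b] lat by simp
    next
      case True
      then obtain z where z: "y = shift_vec v z" "z + expo_vec a \<in> lattice A" by blast
      have z': "z + expo_vec b \<in> lattice A" using z(2) lat by blast
      have y: "y + cvec c = shift_vec v (z + expo_vec c)" for c
        by (simp add: z(1) vec_eq_iff)
      show ?thesis
        by (rule diff_act_unit_cancel[OF ifac_unit[of v 0 z]])
          (simp add: y F z(2) z' fall_F[of z a] fall_F[of z b] flip: z(1),
           simp add: z(1) fall_F consistent[OF z(2) nsupp_mono z' nsupp_mono])
    qed
  qed
  have euler: "dact (euler_op A \<beta> i) F = 0" for i
  proof
    fix z
    show "dact (euler_op A \<beta> i) F z = 0 z"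
    proof (cases "z \<in> shift_vec v ` lattice A")
      case False
      then show ?thesis by (simp add: F_def euler_op_theta_poly dact_theta_poly)
    next
      case True
      then obtain u where u: "z = shift_vec v u" "u \<in> lattice A" by blast
      have "translate z (linear_form A i - cst (\<beta> $ i)) = linear_form A i"
        using lattice_exponent_sum[OF u(2) \<beta>, of i]
        by (simp only: translate_simps translate_linear_form u(1)) simp
      then have 1: "dact (euler_op A \<beta> i) F z = linear_form A i \<bullet>\<^sub>\<partial> R u"
        by (simp add: euler_op_theta_poly dact_theta_poly) (simp add: u F)
      \<comment> \<open>\<open>G u\<close> is zero, or the linear form times its squarefree factor
        lies in \<open>Q\<close>. The invertible factors commute with the linear form, so the same
        follows for \<open>R u\<close>.\<close>
      have "linear_form A i \<bullet>\<^sub>\<partial> G u = 0"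
        using Q[OF linear_mult_M_in_Q] by (simp add: G_def flip: diff_act_mult)
      then have "(ifac v u 0 * linear_form A i) \<bullet>\<^sub>\<partial> G u = 0" by (simp add: diff_act_mult)
      then have "linear_form A i \<bullet>\<^sub>\<partial> ifac v u 0 \<bullet>\<^sub>\<partial> G u = 0"
        by (simp add: mult.commute flip: diff_act_mult)
      then have "(linear_form A i * ifac v 0 u) \<bullet>\<^sub>\<partial> R u = 0"
        by (simp add: diff_act_mult R)
      then have "ifac v 0 u \<bullet>\<^sub>\<partial> linear_form A i \<bullet>\<^sub>\<partial> R u = 0"
        by (simp add: mult.commute flip: diff_act_mult)
      then have "linear_form A i \<bullet>\<^sub>\<partial> R u = 0"
        by (rule diff_act_unit_inj[OF ifac_unit])
      with 1 show ?thesis by simp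
    qed
  qed
  have ann: "annihilated_by (H_ideal A \<beta>) F"
  proof (rule annihilated_by_H_idealI[OF _ euler])
    fix a b :: "'n expo" assume "A *v expo_vec a = A *v expo_vec b"
    from toric[OF this] show "dact (power_prod d_op a) F = dact (power_prod d_op b) F"
      unfolding fun_eq_iff dact_d_monom by blast
  qed
  have supp: "F \<in> supported_series A v N"
    unfolding supported_series_def
  proof (intro CollectI allI impI)
    fix z assume nz: "F z \<noteq> 0"
    then obtain u where u: "u \<in> lattice A" "z = shift_vec v u" by (auto simp: F_def split: if_splits)
    then show "\<exists>u\<in>lattice A. nsupp (shift_vec v u) \<in> N \<and> z = shift_vec v u"
      using nz R_0[of u] F by auto
  qed
  have "F v = m_mon v N \<bullet>\<^sub>\<partial> P"
    using F[of 0] R[of 0] N by (simp add: G_def m_mon_def)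
  then show ?thesis unfolding C_space_def using supp ann by (metis (mono_tags, lifting) mem_Collect_eq)
qed


section \<open>Elements of the indicial ideal from the ideal quotient\<close>

text \<open>\<open>S\<close> will be a single weight, for homogeneous operators, or the half-line
  below it, for lower terms.\<close>

definition weighted :: "real^'n::{finite,linorder} \<Rightarrow> real set \<Rightarrow> 'n weyl_coeffs set" where
  "weighted w S = {c. \<forall>k\<in>Poly_Mapping.keys c. wdeg w k \<in> S}"

lemma weighted_0: "0 \<in> weighted w S"
  by (simp add: weighted_def)

lemma weighted_single: "(l \<noteq> 0 \<Longrightarrow> wdeg w k \<in> S) \<Longrightarrow> Poly_Mapping.single k l \<in> weighted w S"
  by (simp add: weighted_def)

lemma weighted_add: "c \<in> weighted w S \<Longrightarrow> d \<in> weighted w S \<Longrightarrow> c + d \<in> weighted w S"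
  using keys_add[of c d] by (auto simp: weighted_def)

lemma weighted_sum: "(\<And>i. i \<in> T \<Longrightarrow> g i \<in> weighted w S) \<Longrightarrow> sum g T \<in> weighted w S"
  by (induction T rule: infinite_finite_induct) (simp_all add: weighted_0 weighted_add)

lemma expo_vec_add: "expo_vec (a + b) = expo_vec a + expo_vec b"
  by (simp add: vec_eq_iff lookup_add)

lemma expo_vec_minus_single:
  assumes "Poly_Mapping.lookup a j \<noteq> 0"
  shows "expo_vec (a - Poly_Mapping.single j 1) = expo_vec a - expo_vec (Poly_Mapping.single j 1)"
  using assms by (simp add: vec_eq_iff lookup_minus lookup_single when_def of_nat_diff)

text \<open>Theta has weight zero: \<open>dmul\<close> raises all weights by \<open>e\<close>, also
  in its correction terms, and \<open>xmul\<close> lowers them again.\<close>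

lemma weighted_theta:
  assumes "c \<in> weighted w S"
  shows "xmul j (dmul j c) \<in> weighted w S"
proof -
  define e where "e = wdot w (expo_vec (Poly_Mapping.single j 1))"
  have "dmul j c \<in> weighted w ((\<lambda>s. s + e) ` S)"
    unfolding dmul_def
  proof (intro weighted_sum weighted_add weighted_single)
    fix k assume k: "k \<in> Poly_Mapping.keys c"
    then have "wdeg w k \<in> S" using assms by (auto simp: weighted_def)
    then have img: "wdeg w k + e \<in> (\<lambda>s. s + e) ` S" by blast
    show "wdeg w (fst k, snd k + Poly_Mapping.single j 1) \<in> (\<lambda>s. s + e) ` S"
      using img by (simp add: case_prod_unfold expo_vec_add wdot_diff wdot_add e_def algebra_simps)
    assume "of_nat (Poly_Mapping.lookup (fst k) j) * Poly_Mapping.lookup c k \<noteq> 0"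
    then have "Poly_Mapping.lookup (fst k) j \<noteq> 0" by auto
    then show "wdeg w (fst k - Poly_Mapping.single j 1, snd k) \<in> (\<lambda>s. s + e) ` S"
      using img by (simp add: case_prod_unfold expo_vec_minus_single wdot_diff e_def algebra_simps)
  qed
  then have d: "\<And>k. k \<in> Poly_Mapping.keys (dmul j c) \<Longrightarrow> wdeg w k - e \<in> S"
    by (force simp: weighted_def)
  show ?thesis
    unfolding xmul_def
  proof (intro weighted_sum weighted_single)
    fix k assume "k \<in> Poly_Mapping.keys (dmul j c)"
    from d[OF this] show "wdeg w (fst k + Poly_Mapping.single j 1, snd k) \<in> S"
      by (simp add: case_prod_unfold expo_vec_add wdot_diff wdot_add e_def algebra_simps)
  qed
qed

lemma theta_op_weyl_op: "theta_op j * weyl_op c = weyl_op (xmul j (dmul j c))"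
  by (rule dop_eqI)
    (simp add: theta_op_def Rep_dop_weyl_op times_dop.rep_eq rat_weyl.act_xmul rat_weyl.act_dmul
      x_op_def Rep_dop_rat_op Rep_dop_d_op)

lemma c_op_weyl_op_mult: "c_op l * weyl_op c = weyl_op (smul l c)"
  by (rule dop_eqI)
    (simp add: Rep_dop_weyl_op times_dop.rep_eq rat_weyl.act_smul c_op_def Rep_dop_rat_op)

lemma theta_poly_weighted:
  assumes "c \<in> weighted w S"
  obtains d where "theta_poly f * weyl_op c = weyl_op d" "d \<in> weighted w S"
proof -
  have "\<exists>d. theta_poly f * weyl_op c = weyl_op d \<and> d \<in> weighted w S"
  proof (induction f rule: mpoly_var_induct)
    case (cst l)
    have "smul l c \<in> weighted w S"
      unfolding smul_def using assms by (intro weighted_sum weighted_single) (auto simp: weighted_def)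
    then show ?case by (auto simp: theta_poly_simps c_op_weyl_op_mult)
  next
    case (var j p)
    then show ?case
      by (metis theta_poly_simps(2,5) mult.assoc theta_op_weyl_op weighted_theta)
  next
    case (add p q)
    then show ?case
      by (metis theta_poly_simps(1) distrib_right weyl_op_add weighted_add)
  qed
  then show thesis using that by blast
qed

text \<open>Disjoint weights prevent cancellation, and a nonzero \<open>c\<close> ensures that the
  maximal weight is \<open>m\<close>.\<close>

lemma init_part_add_lower:
  assumes "c \<in> weighted w {m}" "d \<in> weighted w {..<m}" "c \<noteq> 0"
  shows "init_part (wdeg w) (c + d) = c"
proof -
  have disj: "Poly_Mapping.lookup c k = 0 \<or> Poly_Mapping.lookup d k = 0" for k
    using assms(1,2) by (fastforce simp: weighted_def in_keys_iff)
  obtain k0 where k0: "k0 \<in> Poly_Mapping.keys c"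
    using assms(3) by (meson ex_in_conv keys_eq_empty)
  have top: "wdeg w k = m" if "k \<in> Poly_Mapping.keys c" for k
    using assms(1) that by (auto simp: weighted_def)
  have low: "wdeg w k < m" if "k \<in> Poly_Mapping.keys d" for k
    using assms(2) that by (auto simp: weighted_def)
  have keys: "k \<in> Poly_Mapping.keys (c + d) \<longleftrightarrow> k \<in> Poly_Mapping.keys c \<or> k \<in> Poly_Mapping.keys d" for k
    using disj[of k] by (auto simp: in_keys_iff lookup_add)
  show ?thesis
    unfolding init_part_restr
  proof (rule poly_mapping_eqI)
    fix k
    have c_top: "\<forall>l\<in>Poly_Mapping.keys (c + d). wdeg w l \<le> wdeg w k" if "k \<in> Poly_Mapping.keys c"
    proof
      fix l assume "l \<in> Poly_Mapping.keys (c + d)"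
      then have "l \<in> Poly_Mapping.keys c \<or> l \<in> Poly_Mapping.keys d" by (simp only: keys)
      then show "wdeg w l \<le> wdeg w k"
        using top[OF that] top[of l] low[of l] by (metis less_imp_le order_refl)
    qed
    have d_low: "\<not> (\<forall>l\<in>Poly_Mapping.keys (c + d). wdeg w l \<le> wdeg w k)" if "k \<in> Poly_Mapping.keys d"
      using low[OF that] top[OF k0] k0 by (metis keys not_le)
    consider "k \<in> Poly_Mapping.keys c" | "k \<in> Poly_Mapping.keys d"
      | "k \<notin> Poly_Mapping.keys c" "k \<notin> Poly_Mapping.keys d" by blast
    then show "Poly_Mapping.lookup (restr {k. \<forall>l\<in>Poly_Mapping.keys (c + d). wdeg w l \<le> wdeg w k} (c + d)) k
        = Poly_Mapping.lookup c k"
    proof cases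
      case 1
      then have "Poly_Mapping.lookup d k = 0" using disj[of k] by (simp add: in_keys_iff)
      then show ?thesis unfolding lookup_restr mem_Collect_eq using c_top[OF 1] by (simp only: if_True lookup_add) simp
    next
      case 2
      then have "Poly_Mapping.lookup c k = 0" using disj[of k] by (simp add: in_keys_iff)
      then show ?thesis unfolding lookup_restr mem_Collect_eq using d_low[OF 2] by (simp only: if_False)
    next
      case 3
      then show ?thesis by (simp add: lookup_restr lookup_add in_keys_iff)
    qed
  qed
qed

lemma poly_op_monom: "poly_op (monom a) = power_prod x_op a"
  by (simp add: poly_op_subst commuting_subst.subst_monom[OF commuting_subst_x])

text \<open>The monomial \<open>x^a\<close> is invertible in the ring \<open>R\<close>.\<close>

lemma x_monom_cancel:
  assumes "power_prod x_op a * T \<in> left_ideal UNIV G"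
  shows "T \<in> left_ideal UNIV G"
proof -
  have "monom a \<noteq> (0 :: 'a mpoly)" by (metis lookup_monom lookup_zero zero_neq_one)
  then have "Fract 1 (monom a) * Fract (monom a) 1 = (1 :: 'a ratfun)"
    unfolding One_fract_def mult_fract by (simp add: eq_fract del: Fract_1_1)
  then have "rat_op (Fract 1 (monom a)) * power_prod x_op a = 1"
    unfolding poly_op_monom [symmetric] rat_op_mult [symmetric] by simp
  then have "T = rat_op (Fract 1 (monom a)) * (power_prod x_op a * T)"
    by (simp flip: mult.assoc)
  then show ?thesis using assms by (metis UNIV_I left_ideal_mult)
qed

text \<open>The vectors \<open>U I\<close> represent the negative supports. All operators are multiplied by
  \<open>x\<^sup>c\<close> with \<open>c = top_expo\<close>, so that they stay in the Weyl algebra; \<open>\<sigma> f\<close> is \<open>f(\<theta> - v)\<close> moved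
  across \<open>x\<^sup>c\<close>.\<close>

locale toric_frame =
  fixes A :: "int^'n::{finite,linorder}^'d" and \<beta> :: "complex^'d"
    and w :: "real^'n::{finite,linorder}" and v :: "complex^'n::{finite,linorder}"
    and U :: "'n set \<Rightarrow> (int, 'n) vec"
  assumes \<beta>: "\<And>i. (\<Sum>j\<in>UNIV. of_int (A $ i $ j) * v $ j) = \<beta> $ i"
    and N_v: "nsupp v \<in> NN A w v"
    and U_lattice: "\<And>I. I \<in> NS A v \<Longrightarrow> U I \<in> lattice A"
    and U_nsupp: "\<And>I. I \<in> NS A v \<Longrightarrow> nsupp (shift_vec v (U I)) = I"
    and U_v: "U (nsupp v) = 0"
    and U_neg: "\<And>I. I \<in> NS A v - NN A w v \<Longrightarrow> wdot w (U I) < 0"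
begin

abbreviation "N \<equiv> NN A w v"

abbreviation "K \<equiv> KK N"

abbreviation "H \<equiv> H_ideal A \<beta>"

text \<open>A common upper bound \<open>c\<close> of the representatives, clipped at zero by
  \<open>nat\<close>, so that each \<open>c - U I\<close> is again an exponent.\<close>

definition top_expo :: "'n expo" where
  "top_expo = mk_expo (\<lambda>j. nat (Max ((\<lambda>I. U I $ j) ` NS A v)))"

text \<open>A common starting point for the normalising factors of all supports.\<close>

definition bot :: "(int, 'n) vec" where
  "bot = (\<chi> j. Min ((\<lambda>I. U I $ j) ` NS A v))"

definition cofactor :: "(int, 'n) vec \<Rightarrow> 'n expo" where
  "cofactor u = mk_expo (\<lambda>j. nat (int (Poly_Mapping.lookup top_expo j) - u $ j))"

definition \<sigma> :: "'n mpoly \<Rightarrow> 'n dop" where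
  "\<sigma> f = theta_poly (translate (- (v + cvec top_expo)) f)"

text \<open>\<open>x^(c-u)\<close> carries the coefficient at \<open>v + u\<close> to the one at
  \<open>v + c\<close>. The \<open>ifac\<close> factor normalises it so that different supports are
  related by squarefree factors alone.\<close>

definition E :: "'n set \<Rightarrow> 'n dop" where
  "E I = \<sigma> (ifac v bot (U I)) * power_prod x_op (cofactor (U I))"

text \<open>An operator \<open>\<sigma> g * x\<^sup>c\<close> in \<open>B\<close> is zero or the initial form of an element of \<open>H\<close>.\<close>

definition B :: "'n dop set" where
  "B = {T. \<exists>k\<in>weighted w {..<wdeg w (top_expo, 0)}. T + weyl_op k \<in> H}"

lemma NN_NS: "I \<in> N \<Longrightarrow> I \<in> NS A v"
  by (simp add: NN_def)

lemma U_le_top: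
  assumes "I \<in> NS A v"
  shows "U I $ j \<le> int (Poly_Mapping.lookup top_expo j)"
proof -
  have "U I $ j \<le> Max ((\<lambda>I. U I $ j) ` NS A v)"
    using assms by (intro Max_ge) auto
  then show ?thesis by (simp add: top_expo_def)
qed

lemma bot_le_U: "I \<in> NS A v \<Longrightarrow> bot $ j \<le> U I $ j"
  by (simp add: bot_def)

lemma cvec_cofactor:
  assumes "\<And>j. u $ j \<le> int (Poly_Mapping.lookup top_expo j)"
  shows "cvec (cofactor u) $ j = cvec top_expo $ j - of_int (u $ j)"
proof -
  have "of_nat (nat (int (Poly_Mapping.lookup top_expo j) - u $ j))
      = (of_int (int (Poly_Mapping.lookup top_expo j) - u $ j) :: complex)"
    using assms[of j] by (metis diff_ge_0_iff_ge int_nat_eq of_int_of_nat_eq)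
  then show ?thesis by (simp add: cofactor_def)
qed

lemma cofactor_0: "cofactor 0 = top_expo"
  by (rule poly_mapping_eqI) (simp add: cofactor_def)

section \<open>Toric and Euler relations between the operators \<open>E I\<close>\<close>

lemmas \<sigma>_simps = theta_poly_simps translate_simps

lemma \<sigma>_mult: "\<sigma> (f * g) = \<sigma> f * \<sigma> g"
  and \<sigma>_add: "\<sigma> (f + g) = \<sigma> f + \<sigma> g"
  and \<sigma>_cst: "\<sigma> (cst c) = c_op c"
  by (simp_all add: \<sigma>_def \<sigma>_simps)

lemma \<sigma>_weyl [simp]: "\<sigma> f \<in> weyl"
  by (simp add: \<sigma>_def)

lemma \<sigma>_commute: "\<sigma> f * \<sigma> g = \<sigma> g * \<sigma> f"
  by (metis \<sigma>_mult mult.commute)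

lemma dact_\<sigma>: "dact (\<sigma> f) F z = translate (z - (v + cvec top_expo)) f \<bullet>\<^sub>\<partial> F z"
  by (simp add: \<sigma>_def dact_theta_poly translate_translate algebra_simps)

text \<open>The bound keeps both cofactors free of truncated subtraction; then the actions on series
  agree.\<close>

lemma x_d_\<sigma>:
  assumes "\<And>j. z $ j + int (Poly_Mapping.lookup a j) \<le> int (Poly_Mapping.lookup top_expo j)"
  shows "power_prod x_op (cofactor z) * power_prod d_op a
    = \<sigma> (fall (shift_vec v z) a) * power_prod x_op (cofactor (z + expo_vec a))"
proof (rule dact_faithful)
  fix F y
  have z: "z $ j \<le> int (Poly_Mapping.lookup top_expo j)" for j
    using assms[of j] by simp
  have 1: "y - (v + cvec top_expo) + shift_vec v z = y - cvec (cofactor z)"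
    by (simp add: vec_eq_iff cvec_cofactor[OF z] flip: cvec_nth)
  have 2: "y - cvec (cofactor (z + expo_vec a)) = y - cvec (cofactor z) + cvec a"
    using assms by (simp add: vec_eq_iff cvec_cofactor z flip: cvec_nth)
  show "dact (power_prod x_op (cofactor z) * power_prod d_op a) F y
      = dact (\<sigma> (fall (shift_vec v z) a) * power_prod x_op (cofactor (z + expo_vec a))) F y"
    by (simp add: dact_mult dact_x_monom dact_d_monom dact_\<sigma> translate_fall 1 2)
qed (simp_all add: weyl_mult)

text \<open>The toric binomial of \<open>U I\<close> and \<open>U J\<close>, based at their common
  lower bound \<open>z\<close>, is multiplied by \<open>x^(c-z)\<close> and by the normalising
  factor from \<open>bot\<close> to \<open>z\<close>.\<close>

lemma E_relation:
  assumes I: "I \<in> NS A v" and J: "J \<in> NS A v"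
  shows "\<sigma> (sqfree (J - I)) * E I - \<sigma> (sqfree (I - J)) * E J \<in> H"
proof -
  define z where "z = (\<chi> j. min (U I $ j) (U J $ j))"
  define a where "a = mk_expo (\<lambda>j. nat (U I $ j - z $ j))"
  define b where "b = mk_expo (\<lambda>j. nat (U J $ j - z $ j))"
  have a: "z + expo_vec a = U I" and b: "z + expo_vec b = U J"
    by (simp_all add: vec_eq_iff a_def b_def z_def)
  have ab: "A *v expo_vec a = A *v expo_vec b"
    using lattice_diff[OF U_lattice[OF I] U_lattice[OF J]] a b
    by (intro lattice_expo_vec) (metis add_diff_cancel_left)
  have az: "z $ j + int (Poly_Mapping.lookup a j) \<le> int (Poly_Mapping.lookup top_expo j)" for j
    using U_le_top[OF I, of j] by (simp flip: a)
  have bz: "z $ j + int (Poly_Mapping.lookup b j) \<le> int (Poly_Mapping.lookup top_expo j)" for j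
    using U_le_top[OF J, of j] by (simp flip: b)
  \<comment> \<open>Each coordinate of \<open>z\<close> is one of the two given ones, and lowering a
    coordinate cannot remove it from the negative support.\<close>
  have nz: "nsupp (shift_vec v z) = I \<union> J"
  proof
    show "I \<union> J \<subseteq> nsupp (shift_vec v z)"
      using nsupp_mono[of v z a] nsupp_mono[of v z b] by (simp add: a b U_nsupp I J)
    show "nsupp (shift_vec v z) \<subseteq> I \<union> J"
    proof
      fix j assume j: "j \<in> nsupp (shift_vec v z)"
      have "z $ j = U I $ j \<or> z $ j = U J $ j" by (auto simp: z_def min_def)
      then have "j \<in> nsupp (shift_vec v (U I)) \<or> j \<in> nsupp (shift_vec v (U J))"
        using j by (auto simp: nsupp_def)
      then show "j \<in> I \<union> J" by (simp add: U_nsupp I J)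
    qed
  qed
  have bot_z: "bot $ j \<le> z $ j" for j using bot_le_U[OF I] bot_le_U[OF J] by (simp add: z_def)
  have zI: "z $ j \<le> U I $ j" and zJ: "z $ j \<le> U J $ j" for j by (simp_all add: z_def)
  have eq: "ifac v bot z * (sqfree S * ifac v z u) = sqfree S * ifac v bot u"
    if "\<And>j. z $ j \<le> u $ j" for S u
    using ifac_mult[of bot z u v] bot_z that by (metis mult.left_commute)
  have fI: "ifac v bot z * fall (shift_vec v z) a = sqfree (J - I) * ifac v bot (U I)"
    using eq[of "U I" "J - I", OF zI] by (simp add: fall_shift_vec a nz U_nsupp I Un_Diff)
  have fJ: "ifac v bot z * fall (shift_vec v z) b = sqfree (I - J) * ifac v bot (U J)"
    using eq[of "U J" "I - J", OF zJ] by (simp add: fall_shift_vec b nz U_nsupp J Un_Diff)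
  have "\<sigma> (ifac v bot z) * (power_prod x_op (cofactor z) * (power_prod d_op a - power_prod d_op b)) \<in> H"
    by (intro H_ideal_mult H_ideal_binomial ab) simp_all
  also have "\<sigma> (ifac v bot z) * (power_prod x_op (cofactor z) * (power_prod d_op a - power_prod d_op b))
    = \<sigma> (ifac v bot z * fall (shift_vec v z) a) * power_prod x_op (cofactor (U I))
      - \<sigma> (ifac v bot z * fall (shift_vec v z) b) * power_prod x_op (cofactor (U J))"
    unfolding right_diff_distrib x_d_\<sigma>[OF az] x_d_\<sigma>[OF bz] a b by (simp add: \<sigma>_mult mult.assoc)
  finally show ?thesis
    unfolding fI fJ by (simp add: E_def \<sigma>_mult mult.assoc)
qed

text \<open>Moving \<open>x^(c-u)\<close> across theta shifts the argument. As \<open>u\<close> is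
  in the lattice, the sum of \<open>v\<close> and \<open>u\<close> contributes exactly
  \<open>\<beta>\<close>.\<close>

lemma E_euler:
  assumes I: "I \<in> NS A v"
  shows "\<sigma> (linear_form A i) * E I \<in> H"
proof -
  let ?x = "power_prod x_op (cofactor (U I))"
  have comm: "\<sigma> (linear_form A i) * ?x = ?x * euler_op A \<beta> i"
  proof (rule dact_faithful)
    fix F y
    have U: "(\<Sum>j\<in>UNIV. of_int (A $ i $ j) * of_int (U I $ j)) = (0 :: complex)"
      using lattice_exponent_sum[OF U_lattice[OF I] \<beta>, of i] \<beta>[of i]
      by (simp add: distrib_left sum.distrib)
    have sum: "(\<Sum>j\<in>UNIV. of_int (A $ i $ j) * (y - cvec (cofactor (U I))) $ j)
        = (\<Sum>j\<in>UNIV. of_int (A $ i $ j) * (y - (v + cvec top_expo)) $ j) + \<beta> $ i"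
      using U by (simp add: cvec_cofactor[OF U_le_top[OF I]] algebra_simps sum.distrib sum_subtractf
          flip: \<beta> cvec_nth)
    show "dact (\<sigma> (linear_form A i) * ?x) F y = dact (?x * euler_op A \<beta> i) F y"
      by (simp only: dact_mult \<sigma>_weyl weyl_generators euler_op_theta_poly theta_poly_weyl dact_\<sigma>
          dact_x_monom dact_theta_poly translate_simps translate_linear_form sum cst_add)
        simp
  qed (simp_all add: weyl_mult euler_op_theta_poly)
  have "\<sigma> (linear_form A i) * E I = \<sigma> (ifac v bot (U I)) * (\<sigma> (linear_form A i) * ?x)"
    unfolding E_def
    by (simp only: mult.assoc [symmetric] \<sigma>_commute[of "linear_form A i" "ifac v bot (U I)"])
  also have "\<dots> = \<sigma> (ifac v bot (U I)) * (?x * euler_op A \<beta> i)" by (simp only: comm)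
  finally show ?thesis by (simp add: H_ideal_mult H_ideal_euler)
qed

section \<open>Congruences modulo \<open>B\<close>\<close>

lemma H_subset_B: "T \<in> H \<Longrightarrow> T \<in> B"
  unfolding B_def by (auto intro!: bexI[of _ 0] weighted_0)

lemma B_add: "S \<in> B \<Longrightarrow> T \<in> B \<Longrightarrow> S + T \<in> B"
proof -
  assume "S \<in> B" "T \<in> B"
  then obtain k l where k: "k \<in> weighted w {..<wdeg w (top_expo, 0)}" "S + weyl_op k \<in> H"
    and l: "l \<in> weighted w {..<wdeg w (top_expo, 0)}" "T + weyl_op l \<in> H"
    unfolding B_def by blast
  have "(S + weyl_op k) + (T + weyl_op l) \<in> H" by (rule H_ideal_add[OF k(2) l(2)])
  moreover have "(S + weyl_op k) + (T + weyl_op l) = (S + T) + weyl_op (k + l)"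
    by (simp add: weyl_op_add)
  ultimately show ?thesis
    unfolding B_def using weighted_add[OF k(1) l(1)] by auto
qed

text \<open>Polynomials in theta have weight zero and preserve the bound on the lower terms.\<close>

lemma B_mult:
  assumes "T \<in> B"
  shows "\<sigma> f * T \<in> B"
proof -
  obtain k where k: "k \<in> weighted w {..<wdeg w (top_expo, 0)}" "T + weyl_op k \<in> H"
    using assms unfolding B_def by blast
  obtain l where l: "\<sigma> f * weyl_op k = weyl_op l" "l \<in> weighted w {..<wdeg w (top_expo, 0)}"
    unfolding \<sigma>_def by (rule theta_poly_weighted[OF k(1)])
  have "\<sigma> f * (T + weyl_op k) \<in> H" using k(2) by (simp add: H_ideal_mult)
  then show ?thesis unfolding B_def using l by (auto simp: distrib_left)
qed

lemma B_0: "0 \<in> B"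
  by (simp add: H_subset_B H_ideal_0)

lemma B_diff: "S \<in> B \<Longrightarrow> T \<in> B \<Longrightarrow> S - T \<in> B"
  using B_add[of S "\<sigma> (cst (-1)) * T"] B_mult[of T "cst (-1)"]
  by (simp add: \<sigma>_cst c_op_uminus)

lemma B_cong: "S - T \<in> B \<Longrightarrow> S \<in> B \<longleftrightarrow> T \<in> B"
  using B_add[of "S - T" T] B_diff[of S "S - T"] by auto

text \<open>\<open>U J\<close> has negative weight, so \<open>x^(c-u)\<close> has lower weight than
  \<open>x^c\<close> and is, up to sign, its own lower correction.\<close>

lemma E_low:
  assumes J: "J \<in> NS A v - N"
  shows "E J \<in> B"
proof -
  let ?k = "Poly_Mapping.single (cofactor (U J), 0) (-1) :: 'n weyl_coeffs"
  have ev: "expo_vec (cofactor (U J)) = expo_vec top_expo - U J"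
    using J U_le_top[of J] by (simp add: vec_eq_iff cofactor_def)
  have e0: "expo_vec (0 :: 'n expo) = 0" by (simp add: vec_eq_iff)
  have "wdeg w (cofactor (U J), 0) < wdeg w (top_expo, 0)"
    using U_neg[OF J] by (simp add: ev e0 wdot_diff)
  then have "?k \<in> weighted w {..<wdeg w (top_expo, 0)}"
    by (intro weighted_single) simp
  moreover have "power_prod x_op (cofactor (U J)) + weyl_op ?k = 0"
    by (simp add: weyl_op_single c_op_uminus commuting_subst.power_prod_0[OF commuting_subst_d])
  ultimately have "power_prod x_op (cofactor (U J)) \<in> B"
    unfolding B_def using H_ideal_0 by (intro CollectI bexI[of _ ?k]) simp_all
  then show ?thesis unfolding E_def by (rule B_mult)
qed

text \<open>The lift of the ideal \<open>M\<close>: a monomial \<open>s\<^sup>\<alpha>\<close> divisible by \<open>s\<^sup>I\<^sup>-\<^sup>K\<close> is sent to its cofactor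
  times \<open>E I\<close>; up to \<open>B\<close> the choice of \<open>I\<close> does not matter.\<close>

definition \<Psi>_monom :: "'n expo \<Rightarrow> 'n dop" where
  "\<Psi>_monom \<alpha> = (if \<exists>I\<gamma>. fst I\<gamma> \<in> N \<and> \<alpha> = snd I\<gamma> + indE (fst I\<gamma> - K)
     then (let I\<gamma> = SOME I\<gamma>. fst I\<gamma> \<in> N \<and> \<alpha> = snd I\<gamma> + indE (fst I\<gamma> - K)
       in \<sigma> (monom (snd I\<gamma>)) * E (fst I\<gamma>)) else 0)"

definition \<Psi> :: "'n mpoly \<Rightarrow> 'n dop" where
  "\<Psi> q = (\<Sum>\<alpha>\<in>Poly_Mapping.keys q. c_op (Poly_Mapping.lookup q \<alpha>) * \<Psi>_monom \<alpha>)"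

lemma K_subset: "I \<in> N \<Longrightarrow> K \<subseteq> I"
  by (auto simp: KK_def)

text \<open>Two factorisations of the same monomial have cofactors with a common part
  \<open>\<delta>\<close>, so the two lifts differ by a multiple of
  \<open>E_relation\<close>.\<close>

lemma \<Psi>_monom_cong:
  assumes I: "I \<in> N"
  shows "\<sigma> (monom \<gamma>) * E I - \<Psi>_monom (\<gamma> + indE (I - K)) \<in> B"
proof -
  define J\<delta> where "J\<delta> = (SOME J\<delta>. fst J\<delta> \<in> N \<and> \<gamma> + indE (I - K) = snd J\<delta> + indE (fst J\<delta> - K))"
  have ex: "\<exists>J\<delta>. fst J\<delta> \<in> N \<and> \<gamma> + indE (I - K) = snd J\<delta> + indE (fst J\<delta> - K)"
    using I by (intro exI[of _ "(I, \<gamma>)"]) simp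
  obtain J \<gamma>' where J\<gamma>': "J\<delta> = (J, \<gamma>')" by (cases J\<delta>)
  have J: "J \<in> N" and \<gamma>': "\<gamma> + indE (I - K) = \<gamma>' + indE (J - K)"
    using someI_ex[OF ex] unfolding J\<delta>_def [symmetric] J\<gamma>' by simp_all
  have \<Psi>: "\<Psi>_monom (\<gamma> + indE (I - K)) = \<sigma> (monom \<gamma>') * E J"
    unfolding \<Psi>_monom_def J\<delta>_def [symmetric] Let_def using ex by (simp add: J\<gamma>')
  have nth: "Poly_Mapping.lookup \<gamma> j + (if j \<in> I - K then 1 else 0)
      = Poly_Mapping.lookup \<gamma>' j + (if j \<in> J - K then 1 else 0)" for j
    using arg_cong[OF \<gamma>', of "\<lambda>a. Poly_Mapping.lookup a j"] by (simp add: lookup_add lookup_indE)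
  \<comment> \<open>On \<open>J - I\<close> only the second factorisation has a squarefree factor,
    so \<open>\<gamma>\<close> is positive there and the subtraction is exact.\<close>
  define \<delta> where "\<delta> = \<gamma> - indE (J - I)"
  have \<gamma>: "\<gamma> = \<delta> + indE (J - I)"
  proof (rule poly_mapping_eqI)
    fix j show "Poly_Mapping.lookup \<gamma> j = Poly_Mapping.lookup (\<delta> + indE (J - I)) j"
      using nth[of j] K_subset[OF I] by (auto simp: \<delta>_def lookup_add lookup_minus lookup_indE split: if_splits)
  qed
  have \<gamma>'': "\<gamma>' = \<delta> + indE (I - J)"
  proof (rule poly_mapping_eqI)
    fix j show "Poly_Mapping.lookup \<gamma>' j = Poly_Mapping.lookup (\<delta> + indE (I - J)) j"
      using nth[of j] K_subset[OF I] K_subset[OF J]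
      by (auto simp: \<delta>_def lookup_add lookup_minus lookup_indE split: if_splits)
  qed
  have "\<sigma> (monom \<gamma>) * E I - \<sigma> (monom \<gamma>') * E J
      = \<sigma> (monom \<delta>) * (\<sigma> (sqfree (J - I)) * E I - \<sigma> (sqfree (I - J)) * E J)"
    by (simp add: \<gamma> \<gamma>'' monom_add \<sigma>_mult sqfree_monom right_diff_distrib mult.assoc)
  then show ?thesis
    unfolding \<Psi> using E_relation[OF NN_NS[OF I] NN_NS[OF J]] by (simp add: B_mult H_subset_B)
qed

lemma \<Psi>_add: "\<Psi> (p + q) = \<Psi> p + \<Psi> q"
  unfolding \<Psi>_def
  by (rule setsum_keys_plus_distrib[where f = "\<lambda>\<alpha> l. c_op l * \<Psi>_monom \<alpha>"])
    (simp_all add: c_op_add distrib_right)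

lemma \<Psi>_single: "\<Psi> (Poly_Mapping.single \<alpha> l) = c_op l * \<Psi>_monom \<alpha>"
  by (cases "l = 0") (simp_all add: \<Psi>_def)

lemma \<Psi>_0 [simp]: "\<Psi> 0 = 0"
  by (simp add: \<Psi>_def)

lemma \<Psi>_mult_sqfree:
  assumes I: "I \<in> N"
  shows "\<sigma> h * E I - \<Psi> (h * sqfree (I - K)) \<in> B"
proof (induction h rule: mpoly_induct)
  case (single \<gamma> l)
  have "Poly_Mapping.single \<gamma> l * sqfree (I - K) = Poly_Mapping.single (\<gamma> + indE (I - K)) l"
    by (simp add: sqfree_monom monom_def mult_single)
  moreover have "\<sigma> (Poly_Mapping.single \<gamma> l) = \<sigma> (cst l) * \<sigma> (monom \<gamma>)"
    by (simp add: cst_mult_monom flip: \<sigma>_mult)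
  ultimately have "\<sigma> (Poly_Mapping.single \<gamma> l) * E I - \<Psi> (Poly_Mapping.single \<gamma> l * sqfree (I - K))
      = \<sigma> (cst l) * (\<sigma> (monom \<gamma>) * E I - \<Psi>_monom (\<gamma> + indE (I - K)))"
    by (simp add: \<Psi>_single right_diff_distrib mult.assoc \<sigma>_cst)
  then show ?case using B_mult[OF \<Psi>_monom_cong[OF I]] by simp
next
  case (add p q)
  have "\<sigma> (p + q) * E I - \<Psi> ((p + q) * sqfree (I - K))
    = (\<sigma> p * E I - \<Psi> (p * sqfree (I - K))) + (\<sigma> q * E I - \<Psi> (q * sqfree (I - K)))"
    by (simp add: \<sigma>_add distrib_right \<Psi>_add)
  then show ?case using B_add[OF add] by simp
qed

lemma \<Psi>_mult_sqfree_B: "I \<in> N \<Longrightarrow> \<Psi> (h * sqfree (I - K)) \<in> B \<longleftrightarrow> \<sigma> h * E I \<in> B"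
  using B_cong[OF \<Psi>_mult_sqfree] by blast

text \<open>The quantifier over \<open>h\<close> makes this an ideal, although \<open>\<Psi>\<close>
  is defined monomial by monomial.\<close>

definition Z :: "'n mpoly set" where
  "Z = {q. \<forall>h. \<Psi> (h * q) \<in> B}"

lemma Z_subspace: "ring_mod.subspace Z"
proof (rule ring_mod.subspaceI)
  show "0 \<in> Z" by (simp add: Z_def B_0)
  fix p q c assume p: "p \<in> Z"
  show "c * p \<in> Z" using p by (simp add: Z_def flip: mult.assoc)
  assume "q \<in> Z"
  with p show "p + q \<in> Z" by (simp add: Z_def distrib_left \<Psi>_add B_add)
qed

text \<open>\<open>E_relation\<close> trades \<open>s^(J-I) E I\<close> for
  \<open>s^(I-J) E J\<close>, and \<open>E J\<close> lies in \<open>B\<close> because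
  \<open>J\<close> is outside \<open>N\<close>.\<close>

lemma P_ideal_subset_Z: "P_ideal A v N \<subseteq> Z"
  unfolding P_ideal_def
proof (rule ideal_minimal[OF _ Z_subspace], clarify)
  fix I J assume I: "I \<in> N" and J: "J \<in> NS A v" "J \<notin> N"
  have "I \<union> J - K = (J - I) \<union> (I - K)" using K_subset[OF I] by auto
  then have sq: "sqfree (I \<union> J - K) = sqfree (J - I) * sqfree (I - K)"
    by (metis Diff_disjoint Int_Diff Int_commute inf_bot_left sqfree_union Diff_Int_distrib2 empty_Diff)
  have "\<Psi> (h * sqfree (I \<union> J - K)) \<in> B" for h
  proof -
    have "\<sigma> (sqfree (I - J)) * E J \<in> B" using E_low J by (intro B_mult) blast
    then have "\<sigma> (sqfree (J - I)) * E I \<in> B"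
      using B_cong[OF H_subset_B[OF E_relation[OF NN_NS[OF I] J(1)]]] by blast
    then have "\<sigma> (h * sqfree (J - I)) * E I \<in> B"
      using B_mult by (simp add: \<sigma>_mult mult.assoc)
    then show ?thesis using \<Psi>_mult_sqfree_B[OF I, of "h * sqfree (J - I)"] by (simp add: sq mult.assoc)
  qed
  then show "sqfree (I \<union> J - K) \<in> Z" by (simp add: Z_def)
qed

text \<open>\<open>E_euler\<close> settles the products of generators; the two factors are then
  extended to their ideals one after the other.\<close>

lemma linear_M_subset_Z:
  assumes "f \<in> ideal (range (linear_form A))" "g \<in> M_ideal N"
  shows "f * g \<in> Z"
proof -
  have "M_ideal N \<subseteq> {g. linear_form A i * g \<in> Z}" for i
    unfolding M_ideal_def
  proof (rule ideal_minimal)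
    show "{sqfree (I - K) |I. I \<in> N} \<subseteq> {g. linear_form A i * g \<in> Z}"
    proof clarify
      fix I assume I: "I \<in> N"
      have "\<sigma> (h * linear_form A i) * E I \<in> B" for h
        using B_mult[OF H_subset_B[OF E_euler[OF NN_NS[OF I]]]] by (simp add: \<sigma>_mult mult.assoc)
      then show "linear_form A i * sqfree (I - K) \<in> Z"
        using \<Psi>_mult_sqfree_B[OF I] by (simp add: Z_def flip: mult.assoc)
    qed
    show "ring_mod.subspace {g. linear_form A i * g \<in> Z}"
      by (rule ring_mod.subspaceI)
        (simp_all add: ring_mod.subspace_0[OF Z_subspace] ring_mod.subspace_add[OF Z_subspace]
          ring_mod.subspace_scale[OF Z_subspace] distrib_left mult.left_commute[of "linear_form A i"])
  qed
  then have "range (linear_form A) \<subseteq> {f. \<forall>g\<in>M_ideal N. f * g \<in> Z}" by blast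
  moreover have "ring_mod.subspace {f. \<forall>g\<in>M_ideal N. f * g \<in> Z}"
    by (rule ring_mod.subspaceI)
      (simp_all add: ring_mod.subspace_0[OF Z_subspace] ring_mod.subspace_add[OF Z_subspace]
        ring_mod.subspace_scale[OF Z_subspace] distrib_right mult.assoc)
  ultimately have "ideal (range (linear_form A)) \<subseteq> {f. \<forall>g\<in>M_ideal N. f * g \<in> Z}"
    by (rule ideal_minimal)
  then show ?thesis using assms by blast
qed

lemma Q_ideal_subset_Z: "Q_ideal A v N \<subseteq> Z"
proof -
  have "ideal_prod (ideal (range (linear_form A))) (M_ideal N) \<subseteq> Z"
    unfolding ideal_prod_def by (rule ideal_minimal[OF _ Z_subspace]) (auto intro: linear_M_subset_Z)
  then show ?thesis
    unfolding Q_ideal_def ideal_sum_def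
    using P_ideal_subset_Z ring_mod.subspace_add[OF Z_subspace] by blast
qed

text \<open>Polynomials in theta preserve the weight of \<open>x^c\<close>, so the operator is
  homogeneous: zero or an initial form. Crossing \<open>x^c\<close> removes the shift by
  \<open>c\<close>, and then \<open>x^c\<close> cancels.\<close>

lemma initial_in_indicial:
  assumes "\<sigma> g * power_prod x_op top_expo \<in> B"
  shows "translate (- v) g \<in> indicial_ideal A \<beta> w"
proof -
  let ?T = "\<sigma> g * power_prod x_op top_expo"
  have "Poly_Mapping.single (top_expo, 0) 1 \<in> weighted w {wdeg w (top_expo, 0)}"
    by (intro weighted_single) simp
  then obtain k where k: "?T = weyl_op k" "k \<in> weighted w {wdeg w (top_expo, 0)}"
    unfolding x_monom_weyl_op \<sigma>_def by (rule theta_poly_weighted)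
  obtain l where l: "l \<in> weighted w {..<wdeg w (top_expo, 0)}" "?T + weyl_op l \<in> H"
    using assms unfolding B_def by blast
  have "?T \<in> init_H A \<beta> w"
  proof (cases "k = 0")
    case True
    then show ?thesis by (simp add: k init_H_def left_ideal_0)
  next
    case False
    then have "init_part (wdeg w) (k + l) = k" by (rule init_part_add_lower[OF k(2) l(1)])
    moreover have "weyl_op (k + l) \<in> H" using l(2) k(1) by (simp add: weyl_op_add)
    ultimately show ?thesis
      unfolding init_H_def k(1) by (intro left_ideal_gen) (auto, metis)
  qed
  moreover have "?T = power_prod x_op top_expo * theta_poly (translate (- v) g)"
    by (rule dact_faithful)
      (simp_all add: weyl_mult dact_mult dact_\<sigma> dact_x_monom dact_theta_poly translate_translate
        algebra_simps)
  ultimately have "power_prod x_op top_expo * theta_poly (translate (- v) g) \<in> left_ideal UNIV (init_H A \<beta> w)"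
    by (metis UNIV_I left_ideal_gen)
  then show ?thesis unfolding indicial_ideal_def by (simp add: x_monom_cancel)
qed

text \<open>The support of \<open>v\<close> is represented by 0, so its \<open>E\<close> reduces to
  \<open>\<sigma> (ifac v bot 0)\<close> times \<open>x^c\<close>.\<close>

lemma quotient_in_indicial:
  assumes "f \<in> ideal_quot (Q_ideal A v N) (m_mon v N)"
  shows "translate (- v) (f * ifac v bot 0) \<in> indicial_ideal A \<beta> w"
proof -
  have "f * sqfree (nsupp v - K) \<in> Z"
    using assms Q_ideal_subset_Z by (auto simp: ideal_quot_def m_mon_def)
  then have "\<Psi> (1 * (f * sqfree (nsupp v - K))) \<in> B" unfolding Z_def by blast
  then have "\<sigma> f * E (nsupp v) \<in> B" using \<Psi>_mult_sqfree_B[OF N_v] by simp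
  then have "\<sigma> (f * ifac v bot 0) * power_prod x_op top_expo \<in> B"
    by (simp add: E_def U_v cofactor_0 \<sigma>_mult mult.assoc)
  then show ?thesis by (rule initial_in_indicial)
qed

end

section \<open>Passage to the local component\<close>

lemma max_ideal_nonunit: "poly_eval q v \<noteq> 0 \<Longrightarrow> q \<notin> max_ideal v"
proof -
  have "max_ideal v \<subseteq> {q. poly_eval q v = 0}"
    unfolding max_ideal_def
  proof (rule ideal_minimal)
    show "range (\<lambda>j. var j - cst (v $ j)) \<subseteq> {q. poly_eval q v = 0}"
      by (auto simp: poly_eval_simps)
    show "ring_mod.subspace {q. poly_eval q v = 0}"
      by (rule ring_mod.subspaceI) (simp_all add: poly_eval_simps)
  qed
  then show "poly_eval q v \<noteq> 0 \<Longrightarrow> q \<notin> max_ideal v" by blast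
qed

lemma local_componentI:
  assumes "poly_eval g v \<noteq> 0" "f * g \<in> J"
  shows "f \<in> local_component J v"
proof -
  have "g \<noteq> 0" using assms(1) by (auto simp: poly_eval_simps)
  then have "Fract f 1 = (\<Sum>x\<in>{Fract (f * g) 1}. Fract 1 g * x)"
    by (simp add: eq_fract)
  moreover have "Fract 1 g \<in> local_ring v"
    using max_ideal_nonunit[OF assms(1)] by (auto simp: local_ring_def)
  ultimately show ?thesis
    unfolding local_component_def left_ideal_def using assms(2)
    by (intro CollectI exI[of _ "{Fract (f * g) 1}"] exI[of _ "\<lambda>_. Fract 1 g"]) auto
qed

text \<open>The extra factor \<open>ifac v bot 0\<close> left by the lift, once translated, is
  nonzero at \<open>v\<close> and disappears on localising.\<close>

lemma quotient_subset_indicial: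
  fixes A :: "int^'n::{finite,linorder}^'d"
  assumes \<beta>: "\<And>i. (\<Sum>j\<in>UNIV. of_int (A $ i $ j) * v $ j) = \<beta> $ i"
    and N_v: "nsupp v \<in> NN A w v"
  shows "ideal_quot (Q_ideal A v (NN A w v)) (m_mon v (NN A w v)) \<subseteq> indicial_at_zero A \<beta> w v"
proof
  fix f assume f: "f \<in> ideal_quot (Q_ideal A v (NN A w v)) (m_mon v (NN A w v))"
  \<comment> \<open>Representatives: 0 for the support of \<open>v\<close>, and for a support
    outside \<open>NN\<close> a vector of negative weight that witnesses this.\<close>
  have "\<exists>u. I \<in> NS A v \<longrightarrow> u \<in> lattice A \<and> nsupp (shift_vec v u) = I \<and> (I = nsupp v \<longrightarrow> u = 0)
      \<and> (I \<notin> NN A w v \<longrightarrow> wdot w u < 0)" for I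
  proof (cases "I = nsupp v")
    case True
    then show ?thesis using N_v by (intro exI[of _ 0]) simp
  next
    case False
    show ?thesis
    proof (cases "I \<in> NN A w v")
      case True
      then show ?thesis using False by (auto simp: NN_def NS_def)
    next
      case out: False
      then show ?thesis using False by (auto simp: NN_def not_le)
    qed
  qed
  then obtain U where U: "\<And>I. I \<in> NS A v \<longrightarrow> U I \<in> lattice A \<and> nsupp (shift_vec v (U I)) = I
      \<and> (I = nsupp v \<longrightarrow> U I = 0) \<and> (I \<notin> NN A w v \<longrightarrow> wdot w (U I) < 0)"
    by metis
  have "nsupp v \<in> NS A v" using N_v by (simp add: NN_def)
  interpret toric_frame A \<beta> w v U
    by unfold_locales (use U \<beta> N_v \<open>nsupp v \<in> NS A v\<close> in auto)
  have "translate (- v) f * translate (- v) (ifac v bot 0) \<in> indicial_ideal A \<beta> w"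
    using quotient_in_indicial[OF f] by (simp add: translate_simps)
  then have "translate (- v) f \<in> local_component (indicial_ideal A \<beta> w) v"
    by (intro local_componentI[of "translate (- v) (ifac v bot 0)"])
      (simp_all add: poly_eval_translate ifac_unit)
  then have "translate v (translate (- v) f) \<in> indicial_at_zero A \<beta> w v"
    unfolding indicial_at_zero_def by (rule imageI)
  then show "f \<in> indicial_at_zero A \<beta> w v" by (simp add: translate_translate)
qed

theorem theorem4p9:
  fixes A :: "int^'n::{finite,linorder}^'d"
    and \<beta> :: "complex^'d"
    and w :: "real^'n::{finite,linorder}"
    and v0 :: "complex^'n::{finite,linorder}"
  assumes rank: "rank (map_matrix rat_of_int A) = CARD('d)"
    and homogeneous: "columns_in_hyperplane A"
    and generic: "generic_weight A w"
    and exponent: "fake_exponent A \<beta> w v0"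
  shows "C_space A \<beta> v0 (NN A w v0) = perp (indicial_at_zero A \<beta> w v0)
    \<and> indicial_at_zero A \<beta> w v0 = Ann (C_space A \<beta> v0 (NN A w v0))
    \<and> Ann (C_space A \<beta> v0 (NN A w v0)) =
        ideal_quot (Q_ideal A v0 (NN A w v0)) (m_mon v0 (NN A w v0))"
proof -
  let ?N = "NN A w v0"
  let ?C = "C_space A \<beta> v0 ?N" and ?ind = "indicial_at_zero A \<beta> w v0"
  let ?Q = "Q_ideal A v0 ?N"
  let ?Qm = "ideal_quot ?Q (m_mon v0 ?N)"
  note euler = fake_exponent_euler[OF exponent]
  note N = fake_exponent_NN[OF exponent]
  have m: "m_mon v0 ?N = monom (indE (nsupp v0 - KK ?N))"
    by (simp add: m_mon_def sqfree_monom)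
  have solution: "m_mon v0 ?N \<bullet>\<^sub>\<partial> P \<in> ?C" if "\<And>q. q \<in> ?Q \<Longrightarrow> q \<bullet>\<^sub>\<partial> P = 0" for P
    using solution_from_polynomial[OF euler N that] .
  have ind_Ann: "?ind \<subseteq> Ann ?C"
    using indicial_annihilates[OF generic] by (auto simp: Ann_def)
  have Ann_Qm: "Ann ?C \<subseteq> ?Qm"
  proof
    fix f assume f: "f \<in> Ann ?C"
    show "f \<in> ?Qm"
    proof (rule ccontr)
      assume "f \<notin> ?Qm"
      then have "f * monom (indE (nsupp v0 - KK ?N)) \<notin> ?Q" by (simp add: ideal_quot_def m)
      then obtain P where P: "\<And>q. q \<in> ?Q \<Longrightarrow> q \<bullet>\<^sub>\<partial> P = 0"
        "f \<bullet>\<^sub>\<partial> monom (indE (nsupp v0 - KK ?N)) \<bullet>\<^sub>\<partial> P \<noteq> 0"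
        using Ann_quotient_dual[OF Q_ideal_subspace graded_Q_ideal] by blast
      then show False using solution[OF P(1)] f by (simp add: Ann_def m)
    qed
  qed
  have Qm_ind: "?Qm \<subseteq> ?ind"
    by (rule quotient_subset_indicial[OF euler N])
  have eq: "?ind = Ann ?C" "Ann ?C = ?Qm"
    using ind_Ann Ann_Qm Qm_ind by blast+
  have "?C \<subseteq> perp ?ind"
    unfolding eq(1) by (auto simp: perp_def Ann_def poly_eval_simps)
  moreover have "perp ?ind \<subseteq> ?C"
  proof
    fix p assume "p \<in> perp ?ind"
    \<comment> \<open>The equality of ideals reduces this to duality for the quotient, which writes
      \<open>p\<close> as \<open>m_mon\<close> applied to a polynomial killed by
      \<open>Q\<close>.\<close>
    then have "p \<in> perp (ideal_quot ?Q (monom (indE (nsupp v0 - KK ?N))))"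
      using eq by (simp add: m)
    then obtain P where P: "\<And>q. q \<in> ?Q \<Longrightarrow> q \<bullet>\<^sub>\<partial> P = 0"
      "monom (indE (nsupp v0 - KK ?N)) \<bullet>\<^sub>\<partial> P = p"
      using perp_quotient_dual[OF Q_ideal_subspace graded_Q_ideal] by blast
    then show "p \<in> ?C" using solution[OF P(1)] by (simp add: m)
  qed
  ultimately show ?thesis using eq by blast
qed

end
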